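(* Let $f:\mathbb{R}\to\mathbb{R}$ be a $C^2$ strictly convex function with $\lim_{|u|\to\infty} f(u)/|u|=\infty$, let $\alpha\in L^\infty([0,\infty);\mathbb{R})$, $\beta(t)=\int_0^t\alpha(\theta)\,d\theta$, $u_0\in L^\infty([0,\infty))$ and $u_b\in BV([0,\infty))$. Let $u$ be the explicit solution defined in the context. Let $(x,t)$ be an interior point of the quarter plane $[0,\infty)\times[0,\infty)$ which is a point of discontinuity of $u$ lying on a generalized characteristic $X(t)$ (as defined in the context; so $x=X(t)$). If $X$ is differentiable at $t$, then $$f'(u(x-,t))>\dot X(t)>f'(u(x+,t)).$$ Consequently, at almost every point of discontinuity $(x,t)=(X(t),t)$ of $u$ along the corresponding generalized characteristic curve $X$, the inequality $f'(u(x-,t))>\dot X(t)>f'(u(x+,t))$ holds.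
   Context: Notation. $f^*(p)=\max_{v\in\mathbb{R}}\{pv-f(v)\}$; $\lambda_f$ is the point where $f'$ changes sign; $\bar u_b(t)=\max\{u_b(t),\lambda_f\}$. The function $h$ and $h$-curves. An $h$-curve joining $(x_1,t_1)$ and $(x_2,t_2)$, $0\le t_2<t_1$, is a curve $X$ with $X(t_1)=x_1$, $X(t_2)=x_2$ and $\dot X(\theta)=f'(y_0e^{\beta(\theta)})$ for a (unique) $y_0\in\mathbb{R}$. For $x_2=0$ this $y_0$ is denoted $h(x_1,t_1,t_2)$; for $t_2=0$ it is denoted $h(x_1-x_2,t_1)$. Value function. For $x\ge0$, $t\ge 0$ let $\Gamma(x,t)$ be the set of Lipschitz functions $\gamma:[0,t]\to[0,\infty)$ with $\gamma(t)=x$, and $$J(\gamma,x,t)=\int_{\{\gamma(\theta)\ne0\}}f^*(\dot\gamma(\theta))e^{-\beta(\theta)}d\theta-\int_{\{\gamma(\theta)=0\}}f(\bar u_b(\theta))e^{-\beta(\theta)}d\theta+\int_0^{\gamma(0)}u_0(y)\,dy .$$ Then $W(x,t)=\inf_{\gamma\in\Gamma(x,t)}J(\gamma,x,t)$. Initial and boundary functionals. Let $$H_A(x,t)=\Big\{y:\ y+\int_0^\tau f'(h(x-y,t)e^{\beta(\theta)})d\theta\ge0\ \text{ for all } 0\le\tau\le t\Big\},$$ $$H_B(x,t)=\Big\{\tau\in[0,t):\ \int_\tau^s f'(h(x,t,\tau)e^{\beta(\theta)})d\theta\ge0\ \text{ for all } \tau\le s\le t\Big\}.$$ For $y\in H_A(x,t)$,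 $A(y,x,t)=\int_0^te^{-\beta(\theta)}f^*(f'(h(x-y,t)e^{\beta(\theta)}))d\theta+\int_0^yu_0(\theta)d\theta$, and for $\tau\in H_B(x,t)$, $B(\tau,x,t)=\int_\tau^te^{-\beta(\theta)}f^*(f'(h(x,t,\tau)e^{\beta(\theta)}))d\theta+W(0,\tau)$. Put $A(x,t)=\min_{y\in H_A(x,t)}A(y,x,t)$, $B(x,t)=\min_{\tau\in H_B(x,t)}B(\tau,x,t)$; $y_*(x,t)\le y^*(x,t)$ are the smallest and largest minimizers of $A(\cdot,x,t)$, and $\tau_*(x,t)\le\tau^*(x,t)$ the smallest and largest minimizers of $B(\cdot,x,t)$. Explicit solution. $u(x,t)=e^{\beta(t)}h(x-y_*(x,t),t)$ if $A(x,t)\le B(x,t)$ and $u(x,t)=e^{\beta(t)}h(x,t,\tau_*(x,t))$ if $A(x,t)>B(x,t)$. Characteristic triangles. For $x\ge0$, $t>0$ the characteristic triangle $\Delta(x,t)$ is: (1) if $A(x,t)<B(x,t)$, the region bounded by the $h$-curves joining $(x,t)$ to $(y_*(x,t),0)$ and to $(y^*(x,t),0)$ (and the $x$-axis); (2) if $A(x,t)>B(x,t)$, the region bounded by the $h$-curves joining $(x,t)$ to $(0,\tau_*(x,t))$ and to $(0,\tau^*(x,t))$ (and the $t$-axis); (3) if $A(x,t)=B(x,t)$, the region, including the point $(0,0)$, bounded by the $h$-curve joining $(x,t)$ to $(y^*(x,t),0)$, the $h$-curve joining $(x,t)$ to $(0,\tau^*(x,t))$ and the axes; (4) at a boundary point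 with $A(0,t)<B(0,t)$, the region bounded by the $h$-curve $\gamma:[0,t]\to[0,\infty)$ joining $(0,t)$ to $(y^*(0,t),0)$, with $\gamma(\theta)>0$ for all $\theta\in[0,t)$ (and the axes). Generalized characteristic. Given $t_1>0$ and a point $(x_1,t_1)$, the generalized characteristic through $(x_1,t_1)$ is the unique Lipschitz curve $x=X(t)$, $t\ge t_1$, with $X(t_1)=x_1$ such that the characteristic triangles $\Delta(X(t),t)$ form an increasing family (with respect to inclusion) as $t$ increases. *)

theory Defs
  imports "HOL-Analysis.Analysis"
begin

text \<open>
  Data: the flux \<open>f\<close>, the source coefficient \<open>\<alpha>\<close>, the initial datum \<open>u0\<close> and the boundary datum
  \<open>ub\<close>. Functions on \<open>[0,\<infinity>)\<close> are total functions on the reals of which only the values on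
  \<open>{0..}\<close> matter.
\<close>

definition L_infinity :: "(real \<Rightarrow> real) \<Rightarrow> bool" where
  "L_infinity g \<longleftrightarrow> g \<in> borel_measurable (lebesgue_on {0..}) \<and>
     (\<exists>M. AE x in lebesgue_on {0..}. \<bar>g x\<bar> \<le> M)"

definition bounded_variation_on :: "real set \<Rightarrow> (real \<Rightarrow> real) \<Rightarrow> bool" where
  "bounded_variation_on S g \<longleftrightarrow>
     (\<exists>M. \<forall>n. \<forall>s :: nat \<Rightarrow> real. mono_on {..n} s \<and> s ` {..n} \<subseteq> S \<longrightarrow>
        (\<Sum>i<n. \<bar>g (s (Suc i)) - g (s i)\<bar>) \<le> M)"

text \<open>As usual for BV, only the class modulo null sets matters.\<close>

definition BV :: "(real \<Rightarrow> real) \<Rightarrow> bool" where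
  "BV g \<longleftrightarrow> (\<exists>g'. bounded_variation_on {0..} g' \<and> (AE t in lebesgue_on {0..}. g t = g' t))"

definition strictly_convex :: "(real \<Rightarrow> real) \<Rightarrow> bool" where
  "strictly_convex f \<longleftrightarrow> (\<forall>x y r. x \<noteq> y \<and> 0 < r \<and> r < 1 \<longrightarrow>
     f ((1 - r) * x + r * y) < (1 - r) * f x + r * f y)"

definition C2 :: "(real \<Rightarrow> real) \<Rightarrow> bool" where
  "C2 f \<longleftrightarrow> (\<forall>v. f differentiable (at v)) \<and> (\<forall>v. deriv f differentiable (at v)) \<and>
     continuous_on UNIV (deriv (deriv f))"

text \<open>For superlinear continuous \<open>f\<close> the supremum is attained.\<close>

definition conjugate :: "(real \<Rightarrow> real) \<Rightarrow> real \<Rightarrow> real" where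
  "conjugate f p = (SUP v. p * v - f v)"

definition sign_change :: "(real \<Rightarrow> real) \<Rightarrow> real" where
  "sign_change f = (THE l. \<forall>v. (v < l \<longrightarrow> deriv f v < 0) \<and> (l < v \<longrightarrow> 0 < deriv f v))"

definition ub_bar :: "(real \<Rightarrow> real) \<Rightarrow> (real \<Rightarrow> real) \<Rightarrow> real \<Rightarrow> real" where
  "ub_bar f ub t = max (ub t) (sign_change f)"

definition beta :: "(real \<Rightarrow> real) \<Rightarrow> real \<Rightarrow> real" where
  "beta \<alpha> t = (LINT \<theta>:{0..t}|lebesgue. \<alpha> \<theta>)"


subsection \<open>h-curves\<close>

definition h_curve_slope ::
  "(real \<Rightarrow> real) \<Rightarrow> (real \<Rightarrow> real) \<Rightarrow> real \<Rightarrow> (real \<Rightarrow> real) \<Rightarrow> real \<times> real \<Rightarrow> real \<times> real \<Rightarrow> bool" where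
  "h_curve_slope f \<alpha> y0 X = (\<lambda>(x1, t1) (x2, t2). X t1 = x1 \<and> X t2 = x2 \<and>
     (\<forall>\<theta>\<in>{t2..t1}. (X has_real_derivative deriv f (y0 * exp (beta \<alpha> \<theta>))) (at \<theta> within {t2..t1})))"

text \<open>For \<open>t1 = t2\<close> and \<open>x1 = x2\<close> this is the degenerate curve reduced to a point; it is needed only
  for characteristic triangles at boundary points, see \<open>tau_min\<close> below.\<close>

definition h_curve ::
  "(real \<Rightarrow> real) \<Rightarrow> (real \<Rightarrow> real) \<Rightarrow> (real \<Rightarrow> real) \<Rightarrow> real \<times> real \<Rightarrow> real \<times> real \<Rightarrow> bool" where
  "h_curve f \<alpha> X p q \<longleftrightarrow> (\<exists>y0. h_curve_slope f \<alpha> y0 X p q)"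

text \<open>\<open>h f \<alpha> x t \<tau>\<close> is \<open>h(x,t,\<tau>)\<close>. Since h-curves are invariant under translation in \<open>x\<close>,
  the two-argument function \<open>h(x,t)\<close> is \<open>h f \<alpha> x t 0\<close>.\<close>

definition h :: "(real \<Rightarrow> real) \<Rightarrow> (real \<Rightarrow> real) \<Rightarrow> real \<Rightarrow> real \<Rightarrow> real \<Rightarrow> real" where
  "h f \<alpha> x t \<tau> = (THE y0. \<exists>X. h_curve_slope f \<alpha> y0 X (x, t) (0, \<tau>))"


subsection \<open>Value function\<close>

definition Gamma :: "real \<Rightarrow> real \<Rightarrow> (real \<Rightarrow> real) set" where
  "Gamma x t = {\<gamma>. (\<exists>L. L-lipschitz_on {0..t} \<gamma>) \<and> (\<forall>\<theta>\<in>{0..t}. 0 \<le> \<gamma> \<theta>) \<and> \<gamma> t = x}"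

definition J ::
  "(real \<Rightarrow> real) \<Rightarrow> (real \<Rightarrow> real) \<Rightarrow> (real \<Rightarrow> real) \<Rightarrow> (real \<Rightarrow> real) \<Rightarrow> (real \<Rightarrow> real) \<Rightarrow> real \<Rightarrow> real" where
  "J f \<alpha> u0 ub \<gamma> t =
     (LINT \<theta>:{\<theta>\<in>{0..t}. \<gamma> \<theta> \<noteq> 0}|lebesgue. conjugate f (deriv \<gamma> \<theta>) * exp (- beta \<alpha> \<theta>))
   - (LINT \<theta>:{\<theta>\<in>{0..t}. \<gamma> \<theta> = 0}|lebesgue. f (ub_bar f ub \<theta>) * exp (- beta \<alpha> \<theta>))
   + (LINT y:{0..\<gamma> 0}|lebesgue. u0 y)"

definition W ::
  "(real \<Rightarrow> real) \<Rightarrow> (real \<Rightarrow> real) \<Rightarrow> (real \<Rightarrow> real) \<Rightarrow> (real \<Rightarrow> real) \<Rightarrow> real \<Rightarrow> real \<Rightarrow> real" where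
  "W f \<alpha> u0 ub x t = (INF \<gamma>\<in>Gamma x t. J f \<alpha> u0 ub \<gamma> t)"


subsection \<open>Initial and boundary functionals\<close>

definition H_A :: "(real \<Rightarrow> real) \<Rightarrow> (real \<Rightarrow> real) \<Rightarrow> real \<Rightarrow> real \<Rightarrow> real set" where
  "H_A f \<alpha> x t = {y. \<forall>\<tau>\<in>{0..t}.
     0 \<le> y + (LINT \<theta>:{0..\<tau>}|lebesgue. deriv f (h f \<alpha> (x - y) t 0 * exp (beta \<alpha> \<theta>)))}"

definition H_B :: "(real \<Rightarrow> real) \<Rightarrow> (real \<Rightarrow> real) \<Rightarrow> real \<Rightarrow> real \<Rightarrow> real set" where
  "H_B f \<alpha> x t = {\<tau>\<in>{0..<t}. \<forall>s\<in>{\<tau>..t}.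
     0 \<le> (LINT \<theta>:{\<tau>..s}|lebesgue. deriv f (h f \<alpha> x t \<tau> * exp (beta \<alpha> \<theta>)))}"

definition A_fun ::
  "(real \<Rightarrow> real) \<Rightarrow> (real \<Rightarrow> real) \<Rightarrow> (real \<Rightarrow> real) \<Rightarrow> real \<Rightarrow> real \<Rightarrow> real \<Rightarrow> real" where
  "A_fun f \<alpha> u0 y x t =
     (LINT \<theta>:{0..t}|lebesgue.
        exp (- beta \<alpha> \<theta>) * conjugate f (deriv f (h f \<alpha> (x - y) t 0 * exp (beta \<alpha> \<theta>))))
   + (LINT \<theta>:{0..y}|lebesgue. u0 \<theta>)"

definition B_fun ::
  "(real \<Rightarrow> real) \<Rightarrow> (real \<Rightarrow> real) \<Rightarrow> (real \<Rightarrow> real) \<Rightarrow> (real \<Rightarrow> real) \<Rightarrow> real \<Rightarrow> real \<Rightarrow> real \<Rightarrow> real" where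
  "B_fun f \<alpha> u0 ub \<tau> x t =
     (LINT \<theta>:{\<tau>..t}|lebesgue.
        exp (- beta \<alpha> \<theta>) * conjugate f (deriv f (h f \<alpha> x t \<tau> * exp (beta \<alpha> \<theta>))))
   + W f \<alpha> u0 ub 0 \<tau>"

text \<open>The minimal values live in \<open>ereal\<close> because \<open>H_B\<close> can be empty at boundary points \<open>x = 0\<close>,
  in which case \<open>B(0,t) = \<infinity>\<close>.\<close>

definition A_min ::
  "(real \<Rightarrow> real) \<Rightarrow> (real \<Rightarrow> real) \<Rightarrow> (real \<Rightarrow> real) \<Rightarrow> real \<Rightarrow> real \<Rightarrow> ereal" where
  "A_min f \<alpha> u0 x t = (INF y\<in>H_A f \<alpha> x t. ereal (A_fun f \<alpha> u0 y x t))"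

definition B_min ::
  "(real \<Rightarrow> real) \<Rightarrow> (real \<Rightarrow> real) \<Rightarrow> (real \<Rightarrow> real) \<Rightarrow> (real \<Rightarrow> real) \<Rightarrow> real \<Rightarrow> real \<Rightarrow> ereal" where
  "B_min f \<alpha> u0 ub x t = (INF \<tau>\<in>H_B f \<alpha> x t. ereal (B_fun f \<alpha> u0 ub \<tau> x t))"

definition A_minimizers ::
  "(real \<Rightarrow> real) \<Rightarrow> (real \<Rightarrow> real) \<Rightarrow> (real \<Rightarrow> real) \<Rightarrow> real \<Rightarrow> real \<Rightarrow> real set" where
  "A_minimizers f \<alpha> u0 x t =
     {y. is_arg_min (\<lambda>y. A_fun f \<alpha> u0 y x t) (\<lambda>y. y \<in> H_A f \<alpha> x t) y}"

definition B_minimizers ::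
  "(real \<Rightarrow> real) \<Rightarrow> (real \<Rightarrow> real) \<Rightarrow> (real \<Rightarrow> real) \<Rightarrow> (real \<Rightarrow> real) \<Rightarrow> real \<Rightarrow> real \<Rightarrow> real set" where
  "B_minimizers f \<alpha> u0 ub x t =
     {\<tau>. is_arg_min (\<lambda>\<tau>. B_fun f \<alpha> u0 ub \<tau> x t) (\<lambda>\<tau>. \<tau> \<in> H_B f \<alpha> x t) \<tau>}"

definition y_min ::
  "(real \<Rightarrow> real) \<Rightarrow> (real \<Rightarrow> real) \<Rightarrow> (real \<Rightarrow> real) \<Rightarrow> real \<Rightarrow> real \<Rightarrow> real" where
  "y_min f \<alpha> u0 x t = Inf (A_minimizers f \<alpha> u0 x t)"

definition y_max ::
  "(real \<Rightarrow> real) \<Rightarrow> (real \<Rightarrow> real) \<Rightarrow> (real \<Rightarrow> real) \<Rightarrow> real \<Rightarrow> real \<Rightarrow> real" where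
  "y_max f \<alpha> u0 x t = Sup (A_minimizers f \<alpha> u0 x t)"

text \<open>
  For \<open>x > 0\<close> the set of minimizers is nonempty and compact, and the infimum and supremum below are
  its smallest and largest elements. At boundary points \<open>x = 0\<close> the minimizers may accumulate at
  the excluded endpoint \<open>\<tau> = t\<close>, or the infimum of \<open>B(\<cdot>,0,t)\<close> may only be approached as
  \<open>\<tau> \<rightarrow> t\<close>; the limiting value \<open>t\<close> is used then, and the corresponding h-curve is a point.
\<close>

definition tau_min ::
  "(real \<Rightarrow> real) \<Rightarrow> (real \<Rightarrow> real) \<Rightarrow> (real \<Rightarrow> real) \<Rightarrow> (real \<Rightarrow> real) \<Rightarrow> real \<Rightarrow> real \<Rightarrow> real" where
  "tau_min f \<alpha> u0 ub x t =
     (if B_minimizers f \<alpha> u0 ub x t = {} then t else Inf (B_minimizers f \<alpha> u0 ub x t))"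

definition tau_max ::
  "(real \<Rightarrow> real) \<Rightarrow> (real \<Rightarrow> real) \<Rightarrow> (real \<Rightarrow> real) \<Rightarrow> (real \<Rightarrow> real) \<Rightarrow> real \<Rightarrow> real \<Rightarrow> real" where
  "tau_max f \<alpha> u0 ub x t =
     (if B_minimizers f \<alpha> u0 ub x t = {} then t else Sup (B_minimizers f \<alpha> u0 ub x t))"


subsection \<open>Explicit solution, characteristic triangles, generalized characteristics\<close>

definition u ::
  "(real \<Rightarrow> real) \<Rightarrow> (real \<Rightarrow> real) \<Rightarrow> (real \<Rightarrow> real) \<Rightarrow> (real \<Rightarrow> real) \<Rightarrow> real \<Rightarrow> real \<Rightarrow> real" where
  "u f \<alpha> u0 ub x t =
     (if A_min f \<alpha> u0 x t \<le> B_min f \<alpha> u0 ub x t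
      then exp (beta \<alpha> t) * h f \<alpha> (x - y_min f \<alpha> u0 x t) t 0
      else exp (beta \<alpha> t) * h f \<alpha> x t (tau_min f \<alpha> u0 ub x t))"

text \<open>
  The triangles are closed regions. From a common apex, the h-curve to \<open>(y_min,0)\<close> lies to the left of
  the one to \<open>(y_max,0)\<close>, whereas the one to \<open>(0,tau_max)\<close> lies to the left of the one to
  \<open>(0,tau_min)\<close>. An h-curve to \<open>(0,\<tau>)\<close> bounds the region only at times \<open>\<theta> \<ge> \<tau>\<close>; below that, the
  region extends to the \<open>t\<close>-axis.
\<close>

definition char_triangle ::
  "(real \<Rightarrow> real) \<Rightarrow> (real \<Rightarrow> real) \<Rightarrow> (real \<Rightarrow> real) \<Rightarrow> (real \<Rightarrow> real) \<Rightarrow> real \<Rightarrow> real \<Rightarrow> (real \<times> real) set" where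
  "char_triangle f \<alpha> u0 ub x t =
    (let A = A_min f \<alpha> u0 x t; B = B_min f \<alpha> u0 ub x t;
         yl = y_min f \<alpha> u0 x t; yr = y_max f \<alpha> u0 x t;
         \<tau>l = tau_min f \<alpha> u0 ub x t; \<tau>u = tau_max f \<alpha> u0 ub x t
     in if A < B \<and> 0 < x then
          {(\<xi>, \<theta>). \<exists>\<gamma>1 \<gamma>2. h_curve f \<alpha> \<gamma>1 (x, t) (yl, 0) \<and> h_curve f \<alpha> \<gamma>2 (x, t) (yr, 0) \<and>
             0 \<le> \<theta> \<and> \<theta> \<le> t \<and> \<gamma>1 \<theta> \<le> \<xi> \<and> \<xi> \<le> \<gamma>2 \<theta>}
        else if A < B then
          {(\<xi>, \<theta>). \<exists>\<gamma>. h_curve f \<alpha> \<gamma> (x, t) (yr, 0) \<and> (\<forall>s\<in>{0..<t}. 0 < \<gamma> s) \<and>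
             0 \<le> \<theta> \<and> \<theta> \<le> t \<and> 0 \<le> \<xi> \<and> \<xi> \<le> \<gamma> \<theta>}
        else if A > B then
          {(\<xi>, \<theta>). \<exists>\<gamma>1 \<gamma>2. h_curve f \<alpha> \<gamma>1 (x, t) (0, \<tau>u) \<and> h_curve f \<alpha> \<gamma>2 (x, t) (0, \<tau>l) \<and>
             \<tau>l \<le> \<theta> \<and> \<theta> \<le> t \<and> 0 \<le> \<xi> \<and> (\<tau>u \<le> \<theta> \<longrightarrow> \<gamma>1 \<theta> \<le> \<xi>) \<and> \<xi> \<le> \<gamma>2 \<theta>}
        else
          {(\<xi>, \<theta>). \<exists>\<gamma>1 \<gamma>2. h_curve f \<alpha> \<gamma>1 (x, t) (0, \<tau>u) \<and> h_curve f \<alpha> \<gamma>2 (x, t) (yr, 0) \<and>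
             0 \<le> \<theta> \<and> \<theta> \<le> t \<and> 0 \<le> \<xi> \<and> (\<tau>u \<le> \<theta> \<longrightarrow> \<gamma>1 \<theta> \<le> \<xi>) \<and> \<xi> \<le> \<gamma>2 \<theta>})"

text \<open>
  The Lipschitz condition is required on bounded time intervals, since characteristic speeds
  need not be bounded on \<open>[t1,\<infinity>)\<close> when \<open>beta \<alpha>\<close> is unbounded. The defining property of the
  generalized characteristic is stated as a predicate; that a curve with this property is unique
  is a result about the predicate, not a part of it.
\<close>

definition generalized_characteristic ::
  "(real \<Rightarrow> real) \<Rightarrow> (real \<Rightarrow> real) \<Rightarrow> (real \<Rightarrow> real) \<Rightarrow> (real \<Rightarrow> real) \<Rightarrow> real \<Rightarrow> real \<Rightarrow> (real \<Rightarrow> real) \<Rightarrow> bool" where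
  "generalized_characteristic f \<alpha> u0 ub x1 t1 X \<longleftrightarrow>
     X t1 = x1 \<and>
     (\<forall>T\<ge>t1. \<exists>L. L-lipschitz_on {t1..T} X) \<and>
     (\<forall>t\<ge>t1. 0 \<le> X t) \<and>
     (\<forall>s t. t1 \<le> s \<and> s \<le> t \<longrightarrow>
        char_triangle f \<alpha> u0 ub (X s) s \<subseteq> char_triangle f \<alpha> u0 ub (X t) t)"

definition discontinuity_point ::
  "(real \<Rightarrow> real) \<Rightarrow> (real \<Rightarrow> real) \<Rightarrow> (real \<Rightarrow> real) \<Rightarrow> (real \<Rightarrow> real) \<Rightarrow> real \<Rightarrow> real \<Rightarrow> bool" where
  "discontinuity_point f \<alpha> u0 ub x t \<longleftrightarrow> \<not> isCont (\<lambda>(x, t). u f \<alpha> u0 ub x t) (x, t)"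

end

theory Submission
  imports Defs
begin

text \<open>
  The \<open>h\<close>-curve with parameter \<open>a\<close> moves with speed \<open>f'(a exp \<beta>)\<close>, and Young's inequality with this
  parameter shows that it is strictly cheaper than every other curve with the same end points. Hence
  \<open>W(x,t)\<close> with \<open>x > 0\<close> is attained along an \<open>h\<close>-curve that comes from one of the axes, limits of
  minimizers are minimizers, and minimizers with different apices at the same time do not cross.
  Therefore \<open>u(x-,t)\<close> and \<open>u(x+,t)\<close> are \<open>exp \<beta>(t)\<close> times the largest and the smallest parameter of
  a minimizer at \<open>(x,t)\<close>; these differ at a discontinuity, and near its apex the characteristic triangle
  is bounded by the corresponding two curves. Since the triangles increase along \<open>X\<close>, the extreme
  minimizers at \<open>(X(s),s)\<close> converge to those at \<open>(x,t)\<close> as \<open>s\<close> decreases to \<open>t\<close>. Comparing the values of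
  \<open>W\<close> along these minimizers, the right derivative of \<open>W(X(s),s)\<close> at \<open>t\<close> is \<open>a D - exp(-\<beta>) f(a exp \<beta>)\<close> with
  \<open>D\<close> the right derivative of \<open>X\<close>, for both extreme parameters \<open>a\<close>. So \<open>D\<close> is the slope of the chord of
  \<open>f\<close> between \<open>u(x+,t)\<close> and \<open>u(x-,t)\<close>, and strict convexity gives the strict inequalities. The
  almost-everywhere statement follows because Lipschitz functions are differentiable almost everywhere.
\<close>

text \<open>Minimizing curves are labelled by their parameter \<open>a\<close> instead of their
  foot, so feet on either axis are treated alike. For fixed \<theta>, \<open>spd a \<theta>\<close>
  is the derivative in \<open>a\<close> of the strictly convex function
  \<open>eng a \<theta>\<close>. Hence every test parameter \<open>c\<close> bounds the running cost
  of a path off the boundary from below by \<open>c\<close> times the displacement minus the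
  increment of \<open>F c\<close>, which depends on the end points and times only. Growth bounds,
  compactness, uniqueness and the derivative of the value function all come from a suitable choice
  of \<open>c\<close>. The obstacle is the boundary, where the running cost is a different one: the
  inequality is available only between contacts, and a direct h-curve may leave the quarter plane.
  So paths are cut at a first or last contact, and near an interior apex everything happens in a
  short time window in which no minimizing curve touches the boundary. Competitors are Lipschitz
  paths whose cost contains \<open>deriv\<close>; differentiability almost everywhere therefore
  enters already in the estimates for the value function.\<close>

subsection \<open>Differentiability of Lipschitz functions\<close>

text \<open>Vitali's theorem selects disjoint intervals around the points of \<open>B\<close>, and Henstock's lemma bounds
  the sum of the errors on them, hence their total length.\<close>

lemma negligible_slow_differentiation:
  fixes f :: "real \<Rightarrow> real"
  assumes f: "f integrable_on {a..b}" and \<mu>: "\<mu> > 0"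
    and B: "\<And>x. x \<in> B \<Longrightarrow> a < x \<and> x < b \<and>
      (\<forall>d>0. \<exists>c r. 0 < r \<and> r < d \<and> x \<in> cball c r \<and>
         2 * r * \<mu> \<le> \<bar>2 * r * f x - integral (cball c r) f\<bar>)"
  shows "negligible B"
  unfolding negligible_outer_le
proof (intro allI impI)
  fix e :: real assume e: "e > 0"
  have f': "f integrable_on cbox a b" using f by simp
  obtain \<gamma> where \<gamma>: "gauge \<gamma>"
    and H: "\<And>p. \<lbrakk>p tagged_partial_division_of (cbox a b); \<gamma> fine p\<rbrakk> \<Longrightarrow>
             sum (\<lambda>(x,k). norm (measure lborel k *\<^sub>R f x - integral k f)) p < e * \<mu>"
    using Henstock_lemma[OF f', of "e * \<mu>"] e \<mu> by auto
  \<comment> \<open>The tag \<open>x\<close> is stored with its interval, which need not be centred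
    at \<open>x\<close>, so that the selected disjoint intervals form a tagged partial division.
    Each 2 * r * \<mu> is at most one term of the Henstock sum, whose bound e * \<mu> was chosen for
    this.\<close>
  define K where "K = {(x, c, r). x \<in> B \<and> 0 < r \<and> x \<in> cball c r \<and> cball c r \<subseteq> cbox a b \<and>
      cball c r \<subseteq> \<gamma> x \<and> 2 * r * \<mu> \<le> \<bar>2 * r * f x - integral (cball c r) f\<bar>}"
  have cover: "\<exists>i. i \<in> K \<and> x \<in> cball (fst (snd i)) (snd (snd i)) \<and> snd (snd i) < d"
    if x: "x \<in> B" and d: "0 < d" for x d
  proof -
    have "open (\<gamma> x \<inter> {a<..<b})" "x \<in> \<gamma> x \<inter> {a<..<b}"
      using \<gamma> B[OF x] by (auto simp: gauge_def)
    then obtain d1 where d1: "d1 > 0" "ball x d1 \<subseteq> \<gamma> x \<inter> {a<..<b}"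
      using open_contains_ball by meson
    \<comment> \<open>An interval of radius below d1 / 2 through \<open>x\<close> lies in the ball
      of radius \<open>d1\<close> about \<open>x\<close>.\<close>
    obtain c r where cr: "0 < r" "r < min d (d1 / 2)" "x \<in> cball c r"
      "2 * r * \<mu> \<le> \<bar>2 * r * f x - integral (cball c r) f\<bar>"
      using B[OF x] d d1(1) by (metis half_gt_zero min_less_iff_conj)
    have "cball c r \<subseteq> ball x d1"
    proof
      fix y assume "y \<in> cball c r"
      then have "dist x y \<le> 2 * r" using cr(3) dist_triangle[of x y c]
        by (simp add: dist_commute)
      then show "y \<in> ball x d1" using cr(2) by (auto simp: dist_commute)
    qed
    then have "(x, c, r) \<in> K"
      unfolding K_def using x cr d1(2) by fastforce
    then show ?thesis using cr by (intro exI[of _ "(x, c, r)"]) auto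
  qed
  have rpos: "\<And>i. i \<in> K \<Longrightarrow> 0 < snd (snd i)" by (auto simp: K_def)
  obtain C where C: "countable C" "C \<subseteq> K"
    "pairwise (\<lambda>i j. disjnt (cball (fst (snd i)) (snd (snd i))) (cball (fst (snd j)) (snd (snd j)))) C"
    "negligible (B - (\<Union>i\<in>C. cball (fst (snd i)) (snd (snd i))))"
    using Vitali_covering_theorem_cballs[OF rpos cover] by blast
  let ?b = "\<lambda>i::real \<times> real \<times> real. cball (fst (snd i)) (snd (snd i))"
  have bound: "measure lebesgue (\<Union>i\<in>I. ?b i) \<le> e" if I: "I \<subseteq> C" "finite I" for I
  proof -
    have IK: "\<And>i. i \<in> I \<Longrightarrow> i \<in> K" using I C by blast
    have disj: "\<And>i j. i \<in> I \<Longrightarrow> j \<in> I \<Longrightarrow> i \<noteq> j \<Longrightarrow> ?b i \<inter> ?b j = {}"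
      using C(3) I unfolding pairwise_def disjnt_def by blast
    let ?p = "(\<lambda>i. (fst i, ?b i)) ` I"
    have inj: "inj_on (\<lambda>i. (fst i, ?b i)) I"
    proof (rule inj_onI, rule ccontr)
      fix i j assume ij: "i \<in> I" "j \<in> I" "(fst i, ?b i) = (fst j, ?b j)" "i \<noteq> j"
      then have "?b i = {}" using disj[of i j] by auto
      moreover have "fst i \<in> ?b i" using IK[OF ij(1)] by (auto simp: K_def)
      ultimately show False by blast
    qed
    have tp: "?p tagged_partial_division_of (cbox a b)"
      unfolding tagged_partial_division_of_def
    proof (intro conjI allI impI)
      show "finite ?p" using I by simp
    next
      fix x k assume "(x, k) \<in> ?p"
      then obtain i where i: "i \<in> I" "x = fst i" "k = ?b i" by auto
      show "x \<in> k" "k \<subseteq> cbox a b" using IK[OF i(1)] i by (auto simp: K_def)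
      show "\<exists>a b. k = cbox a b" unfolding i cball_eq_atLeastAtMost cbox_interval by blast
    next
      fix x1 K1 x2 K2 assume "(x1, K1) \<in> ?p \<and> (x2, K2) \<in> ?p \<and> (x1, K1) \<noteq> (x2, K2)"
      then obtain i j where ij: "i \<in> I" "K1 = ?b i" "j \<in> I" "K2 = ?b j" "i \<noteq> j" by blast
      then have "K1 \<inter> K2 = {}" using disj by simp
      then show "interior K1 \<inter> interior K2 = {}" using interior_subset by blast
    qed
    have "?b i \<subseteq> \<gamma> (fst i)" if "i \<in> I" for i using IK[OF that] unfolding K_def by auto
    then have fine: "\<gamma> fine ?p" unfolding fine_def by blast
    have "measure lebesgue (\<Union>i\<in>I. ?b i) \<le> (\<Sum>i\<in>I. measure lebesgue (?b i))"
      by (rule measure_UNION_le) (use I in auto)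
    also have "\<dots> = (\<Sum>i\<in>I. 2 * snd (snd i))"
    proof (rule sum.cong)
      fix i assume "i \<in> I"
      then show "measure lebesgue (?b i) = 2 * snd (snd i)"
        using rpos[OF IK] by (simp add: cball_eq_atLeastAtMost less_imp_le)
    qed simp
    also have "\<dots> \<le> (\<Sum>i\<in>I. norm (measure lborel (?b i) *\<^sub>R f (fst i) - integral (?b i) f) / \<mu>)"
    proof (rule sum_mono)
      fix i assume "i \<in> I"
      from IK[OF this] obtain x c r where i: "i = (x, c, r)"
        "0 < r" "2 * r * \<mu> \<le> \<bar>2 * r * f x - integral (cball c r) f\<bar>" by (auto simp: K_def)
      then show "2 * snd (snd i) \<le> norm (measure lborel (?b i) *\<^sub>R f (fst i) - integral (?b i) f) / \<mu>"
        using \<mu> by (simp add: cball_eq_atLeastAtMost field_simps)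
    qed
    also have "\<dots> = (\<Sum>(x,k)\<in>?p. norm (measure lborel k *\<^sub>R f x - integral k f)) / \<mu>"
      by (subst sum.reindex[OF inj]) (simp add: sum_divide_distrib o_def)
    also have "\<dots> \<le> e" using H[OF tp fine] \<mu> by (simp add: field_simps)
    finally show ?thesis .
  qed
  have U: "(\<Union>i\<in>C. ?b i) \<in> lmeasurable" "measure lebesgue (\<Union>i\<in>C. ?b i) \<le> e"
    using fmeasurable_UN_bound[OF C(1) _ bound] measure_UN_bound[OF C(1) _ bound] by auto
  let ?N = "B - (\<Union>i\<in>C. ?b i)"
  have N: "?N \<in> lmeasurable" "measure lebesgue ?N = 0"
    using C(4) negligible_imp_measurable negligible_imp_measure0 by blast+
  show "\<exists>T. B \<subseteq> T \<and> T \<in> lmeasurable \<and> measure lebesgue T \<le> e"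
  proof (intro exI conjI)
    show "B \<subseteq> ?N \<union> (\<Union>i\<in>C. ?b i)" by blast
    show "?N \<union> (\<Union>i\<in>C. ?b i) \<in> lmeasurable" using N U by (rule_tac fmeasurable.Un)
    have "measure lebesgue (?N \<union> (\<Union>i\<in>C. ?b i)) \<le> measure lebesgue ?N + measure lebesgue (\<Union>i\<in>C. ?b i)"
      using N U by (intro measure_Un_le) auto
    then show "measure lebesgue (?N \<union> (\<Union>i\<in>C. ?b i)) \<le> e" using N U by simp
  qed
qed

text \<open>Lebesgue differentiation. If \<open>f x\<close> is not the derivative at
  \<open>x\<close>, then for some \<open>n\<close> the difference quotients miss it by more than 1 /
  (n + 1) arbitrarily close to \<open>x\<close>. Intervals with end point \<open>x\<close> witness
  this, so the exceptional set is covered by countably many sets of the preceding kind.\<close>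

lemma negligible_not_has_derivative_integral:
  fixes f :: "real \<Rightarrow> real"
  assumes f: "f integrable_on {a..b}"
  shows "negligible {x \<in> {a<..<b}. \<not> ((\<lambda>t. integral {a..t} f) has_real_derivative f x) (at x)}"
    (is "negligible ?S")
proof -
  let ?F = "\<lambda>t. integral {a..t} f"
  define B where "B n = {x. a < x \<and> x < b \<and>
      (\<forall>d>0. \<exists>c r. 0 < r \<and> r < d \<and> x \<in> cball c r \<and>
         2 * r * inverse (real (Suc n)) \<le> \<bar>2 * r * f x - integral (cball c r) f\<bar>)}" for n
  have "negligible (B n)" for n
    by (rule negligible_slow_differentiation[OF f, of "inverse (real (Suc n))"]) (auto simp: B_def)
  then have "negligible (\<Union>n. B n)" by (intro negligible_countable_Union) auto
  moreover have "?S \<subseteq> (\<Union>n. B n)"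
  proof
    fix x assume x: "x \<in> ?S"
    then have xab: "a < x" "x < b" by auto
    have "\<not> (\<forall>e>0. \<exists>d>0. \<forall>y. norm (y - x) < d \<longrightarrow> norm (?F y - ?F x - f x * (y - x)) \<le> e * norm (y - x))"
      using x by (auto simp: has_field_derivative_def has_derivative_at_alt bounded_linear_mult_right)
    then obtain e where e: "e > 0" and bad: "\<And>d. d > 0 \<Longrightarrow> \<exists>y. norm (y - x) < d \<and>
        \<not> norm (?F y - ?F x - f x * (y - x)) \<le> e * norm (y - x)" by metis
    obtain n where n: "inverse (real (Suc n)) < e" using reals_Archimedean[OF e] by auto
    have "x \<in> B n"
      unfolding B_def mem_Collect_eq
    proof (intro conjI allI impI xab)
      fix d :: real assume d: "d > 0"
      obtain y where y: "norm (y - x) < min d (min (x - a) (b - x))"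
        "\<not> norm (?F y - ?F x - f x * (y - x)) \<le> e * norm (y - x)"
        using bad[of "min d (min (x - a) (b - x))"] d xab by auto
      \<comment> \<open>Centre and radius of the interval between \<open>x\<close> and
        \<open>y\<close>.\<close>
      define c r where "c = (x + y) / 2" and "r = \<bar>y - x\<bar> / 2"
      have yx: "y \<noteq> x" using y by auto
      have ab: "a \<le> y" "y \<le> b" using y(1) by (auto simp: abs_less_iff)
      have cb: "cball c r = {min x y..max x y}"
        unfolding cball_eq_atLeastAtMost c_def r_def by (auto simp: min_def max_def field_simps abs_if)
      have add: "?F s + integral {s..t} f = ?F t" if "a \<le> s" "s \<le> t" "t \<le> b" for s t
        by (rule Henstock_Kurzweil_Integration.integral_combine)
          (use that f in \<open>auto intro: integrable_on_subinterval\<close>)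
      have eq: "\<bar>2 * r * f x - integral (cball c r) f\<bar> = \<bar>?F y - ?F x - f x * (y - x)\<bar>"
      proof (cases "x < y")
        case True
        then have "2 * r * f x - integral (cball c r) f = - (?F y - ?F x - f x * (y - x))"
          unfolding cb unfolding r_def using add[of x y] ab xab by (simp add: min_def max_def field_simps)
        then show ?thesis by linarith
      next
        case False
        then have "y < x" using yx by simp
        then have "2 * r * f x - integral (cball c r) f = ?F y - ?F x - f x * (y - x)"
          unfolding cb unfolding r_def using add[of y x] ab xab
          by (simp add: min_def max_def field_simps abs_if)
        then show ?thesis by simp
      qed
      have "2 * r * inverse (real (Suc n)) \<le> \<bar>2 * r * f x - integral (cball c r) f\<bar>"
      proof -
        have "2 * r * inverse (real (Suc n)) \<le> 2 * r * e" using n unfolding r_def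
          by (intro mult_left_mono) auto
        also have "\<dots> \<le> \<bar>2 * r * f x - integral (cball c r) f\<bar>"
          unfolding eq using y(2) by (simp add: r_def algebra_simps)
        finally show ?thesis .
      qed
      moreover have "x \<in> cball c r" unfolding cb by auto
      moreover have "0 < r" "r < d" using y(1) yx by (auto simp: r_def)
      ultimately show "\<exists>c r. 0 < r \<and> r < d \<and> x \<in> cball c r \<and>
         2 * r * inverse (real (Suc n)) \<le> \<bar>2 * r * f x - integral (cball c r) f\<bar>" by blast
    qed
    then show "x \<in> (\<Union>n. B n)" by blast
  qed
  ultimately show ?thesis by (rule negligible_subset)
qed

text \<open>The inverse of \<open>G\<close> pushes Lebesgue measure to the measure that assigns \<open>G t - G s\<close> to
  \<open>{s..t}\<close>. It is absolutely continuous because Lipschitz images of null sets are null sets.\<close>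

lemma bilipschitz_density:
  fixes G :: "real \<Rightarrow> real"
  assumes lo: "\<And>s t. s \<le> t \<Longrightarrow> t - s \<le> G t - G s"
    and up: "\<And>s t. s \<le> t \<Longrightarrow> G t - G s \<le> L * (t - s)"
  obtains \<phi> where "\<phi> \<in> borel_measurable borel"
    "\<And>s t. s \<le> t \<Longrightarrow> set_integrable lborel {s..t} \<phi>"
    "\<And>s t. s \<le> t \<Longrightarrow> (LINT x:{s..t}|lborel. \<phi> x) = G t - G s"
proof -
  have absG: "\<bar>G t - G s\<bar> \<le> \<bar>L\<bar> * \<bar>t - s\<bar>" for s t
  proof -
    have "\<bar>G t - G s\<bar> \<le> L * \<bar>t - s\<bar>"
      using lo[of s t] up[of s t] lo[of t s] up[of t s] by (cases "s \<le> t") (auto simp: abs_if)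
    also have "\<dots> \<le> \<bar>L\<bar> * \<bar>t - s\<bar>" by (intro mult_right_mono) auto
    finally show ?thesis .
  qed
  have mono: "G s < G t \<longleftrightarrow> s < t" for s t
    using lo[of s t] lo[of t s] by (cases "s < t") auto
  have inj: "inj G" by (rule injI) (metis mono less_irrefl linorder_less_linear)
  have lipG: "\<bar>L\<bar>-lipschitz_on UNIV G"
    using absG by (intro lipschitz_onI) (auto simp: dist_real_def)
  have contG: "continuous_on UNIV G" by (rule lipschitz_on_continuous_on[OF lipG])
  have surj: "\<exists>t. G t = y" for y
  proof -
    let ?a = "\<bar>y\<bar> + \<bar>G 0\<bar>"
    have 1: "G (- ?a) \<le> y" "y \<le> G ?a" using lo[of "- ?a" 0] lo[of 0 ?a] by linarith+
    have "\<exists>t\<ge>- ?a. t \<le> ?a \<and> G t = y"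
      by (rule IVT'[of G]) (use 1 in \<open>auto intro: continuous_on_subset[OF contG]\<close>)
    then show ?thesis by blast
  qed
  define g where "g = inv G"
  have Gg: "G (g y) = y" for y unfolding g_def using surj by (metis f_inv_into_f rangeI)
  have gG: "g (G x) = x" for x unfolding g_def using inj by simp
  have "1-lipschitz_on UNIV g"
  proof (rule lipschitz_onI)
    fix x y
    have "\<bar>g x - g y\<bar> \<le> \<bar>G (g x) - G (g y)\<bar>"
      using lo[of "g x" "g y"] lo[of "g y" "g x"] by (cases "g x \<le> g y") auto
    then show "dist (g x) (g y) \<le> 1 * dist x y" by (simp add: Gg dist_real_def)
  qed auto
  then have "continuous_on UNIV g" by (rule lipschitz_on_continuous_on)
  then have g[measurable]: "g \<in> borel_measurable borel" by (rule borel_measurable_continuous_onI)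
  have vim: "g -` A = G ` A" for A
  proof (intro set_eqI iffI)
    fix y assume "y \<in> g -` A"
    then show "y \<in> G ` A" using Gg[of y] by (intro image_eqI[of _ _ "g y"]) auto
  qed (auto simp: gG)
  define N where "N = distr lborel borel g"
  have ac: "absolutely_continuous lborel N"
    unfolding absolutely_continuous_def
  proof
    fix A :: "real set" assume A: "A \<in> null_sets lborel"
    then have "negligible A" by (simp add: negligible_iff_null_sets null_sets_completionI)
    then have "negligible (G ` A)"
      by (rule negligible_locally_Lipschitz_image[rotated])
        (use absG in \<open>auto intro!: exI[of _ UNIV] exI[of _ "\<bar>L\<bar>"]\<close>)
    then have "emeasure lebesgue (g -` A) = 0" unfolding vim negligible_iff_null_sets by auto
    moreover have "A \<in> sets borel" using A by auto
    moreover from this have "g -` A \<in> sets borel" using measurable_sets[OF g] by simp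
    ultimately show "A \<in> null_sets N"
      by (auto simp: N_def emeasure_distr null_sets_def)
  qed
  obtain h where h[measurable]: "h \<in> borel_measurable lborel" and hN: "density lborel h = N"
    using sigma_finite_measure.Radon_Nikodym[OF lborel.sigma_finite_measure_axioms ac] by (auto simp: N_def)
  have hi: "(\<integral>\<^sup>+x. h x * indicator {s..t} x \<partial>lborel) = ennreal (G t - G s)" if "s \<le> t" for s t
  proof -
    have "(\<integral>\<^sup>+x. h x * indicator {s..t} x \<partial>lborel) = emeasure N {s..t}"
      unfolding hN[symmetric] by (rule emeasure_density[symmetric]) auto
    also have "\<dots> = emeasure lborel (g -` {s..t})" by (simp add: N_def emeasure_distr)
    also have "g -` {s..t} = {G s..G t}"
    proof -
      have "s \<le> g x \<longleftrightarrow> G s \<le> x" "g x \<le> t \<longleftrightarrow> x \<le> G t" for x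
        by (metis Gg mono not_le)+
      then show ?thesis by auto
    qed
    also have "emeasure lborel {G s..G t} = ennreal (G t - G s)" using lo[OF that] that by simp
    finally show ?thesis .
  qed
  \<comment> \<open>Finiteness is checked on bounded intervals, because the total mass of
    \<open>N\<close> is infinite.\<close>
  have fin: "AE x in lborel. x \<in> {-real n..real n} \<longrightarrow> h x \<noteq> \<infinity>" for n
  proof -
    have "AE x in lborel. h x * indicator {-real n..real n} x \<noteq> \<infinity>"
      by (rule nn_integral_PInf_AE) (auto simp: hi)
    then show ?thesis by eventually_elim (auto simp: indicator_def split: if_splits)
  qed
  have "AE x in lborel. \<forall>n. x \<in> {-real n..real n} \<longrightarrow> h x \<noteq> \<infinity>" unfolding AE_all_countable using fin by blast
  then have hfin: "AE x in lborel. h x \<noteq> \<infinity>"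
  proof eventually_elim
    case (elim x)
    obtain n where "\<bar>x\<bar> \<le> real n" using real_arch_simple by blast
    then show ?case using elim by (auto simp: abs_le_iff)
  qed
  define \<phi> where "\<phi> x = enn2real (h x)" for x
  have m: "\<phi> \<in> borel_measurable borel" unfolding \<phi>_def by measurable
  note m[measurable]
  have nn: "(\<integral>\<^sup>+x. ennreal (indicator {s..t} x *\<^sub>R \<phi> x) \<partial>lborel) = ennreal (G t - G s)" if "s \<le> t" for s t
    unfolding hi[OF that, symmetric]
    by (rule nn_integral_cong_AE, use hfin in eventually_elim)
      (auto simp: \<phi>_def indicator_def less_top)
  have "integrable lborel (\<lambda>x. indicator {s..t} x *\<^sub>R \<phi> x) \<and>
        integral\<^sup>L lborel (\<lambda>x. indicator {s..t} x *\<^sub>R \<phi> x) = G t - G s" if "s \<le> t" for s t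
  proof -
    have 1: "(\<lambda>x. indicator {s..t} x *\<^sub>R \<phi> x) \<in> borel_measurable lborel" by measurable
    have 2: "AE x in lborel. 0 \<le> indicator {s..t} x *\<^sub>R \<phi> x" by (auto simp: \<phi>_def)
    have 3: "0 \<le> G t - G s" using lo[OF that] that by simp
    show ?thesis using nn_integral_eq_integrable[OF 1 2 3] nn[OF that] by simp
  qed
  then show ?thesis using m by (intro that[of \<phi>]) (auto simp: set_integrable_def set_lebesgue_integral_def)
qed

text \<open>\<open>\<phi>\<close> is a Borel version of \<open>deriv \<gamma>\<close>, bounded
  everywhere; it makes integrands containing \<open>deriv \<gamma>\<close> measurable and carries
  the fundamental theorem of calculus. A steep linear term turns \<gamma> into a bilipschitz
  function, whose density is its derivative almost everywhere by the two preceding results.\<close>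

lemma lipschitz_AE_derivative:
  fixes \<gamma> :: "real \<Rightarrow> real"
  assumes lip: "L-lipschitz_on {a..b} \<gamma>"
  obtains \<phi> where "\<phi> \<in> borel_measurable borel" "\<forall>x. \<bar>\<phi> x\<bar> \<le> L"
    "AE x in lebesgue. x \<in> {a<..<b} \<longrightarrow> (\<gamma> has_real_derivative \<phi> x) (at x)"
    "\<forall>s t. a \<le> s \<longrightarrow> s \<le> t \<longrightarrow> t \<le> b \<longrightarrow> (LINT x:{s..t}|lebesgue. \<phi> x) = \<gamma> t - \<gamma> s"
proof (cases "a \<le> b")
  case False
  then show ?thesis using that[of "\<lambda>_. 0"] lipschitz_on_nonneg[OF lip] by auto
next
  case ab: True
  have L0: "0 \<le> L" by (rule lipschitz_on_nonneg[OF lip])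
  \<comment> \<open>Clamping to {a..b} extends \<gamma> to the whole line with the same Lipschitz
    constant.\<close>
  define k where "k t = max a (min b t)" for t
  have kab: "k t \<in> {a..b}" for t using ab by (auto simp: k_def)
  have klip: "\<bar>\<gamma> (k t) - \<gamma> (k s)\<bar> \<le> L * \<bar>t - s\<bar>" for s t
  proof -
    have "\<bar>\<gamma> (k t) - \<gamma> (k s)\<bar> \<le> L * \<bar>k t - k s\<bar>"
      using lipschitz_onD[OF lip kab kab] by (simp add: dist_real_def)
    also have "\<dots> \<le> L * \<bar>t - s\<bar>" using L0 by (intro mult_left_mono) (auto simp: k_def)
    finally show ?thesis .
  qed
  \<comment> \<open>The slopes of \<gamma> lie in [-L, L]; after adding L + 1 they lie in
    [1, 2 * L + 1].\<close>
  define G where "G t = \<gamma> (k t) + (L + 1) * t" for t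
  obtain \<phi>0 where m0: "\<phi>0 \<in> borel_measurable borel"
    and si0: "\<And>s t. s \<le> t \<Longrightarrow> set_integrable lborel {s..t} \<phi>0"
    and I0: "\<And>s t. s \<le> t \<Longrightarrow> (LINT x:{s..t}|lborel. \<phi>0 x) = G t - G s"
  proof (rule bilipschitz_density[of G "2 * L + 1"])
    fix s t :: real assume "s \<le> t"
    then show "t - s \<le> G t - G s" "G t - G s \<le> (2 * L + 1) * (t - s)"
      using klip[of t s] by (auto simp: G_def abs_le_iff algebra_simps)
  qed auto
  note m0[measurable]
  define \<phi>1 where "\<phi>1 x = \<phi>0 x - (L + 1)" for x
  have m1[measurable]: "\<phi>1 \<in> borel_measurable borel" unfolding \<phi>1_def by measurable
  have ci: "set_integrable lborel {s..t} (\<lambda>_. L + 1)" for s t :: real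
    by (rule borel_integrable_atLeastAtMost') simp
  have si1: "set_integrable lborel {s..t} \<phi>1" if "s \<le> t" for s t
    unfolding \<phi>1_def by (intro set_integral_diff si0[OF that] ci)
  have I1: "(LINT x:{s..t}|lborel. \<phi>1 x) = \<gamma> t - \<gamma> s" if "a \<le> s" "s \<le> t" "t \<le> b" for s t
  proof -
    have "(LINT x:{s..t}|lborel. \<phi>1 x) = (LINT x:{s..t}|lborel. \<phi>0 x) - (LINT x:{s..t}|lborel. L + 1)"
      unfolding \<phi>1_def by (intro set_integral_diff si0[OF that(2)] ci)
    also have "(LINT x:{s..t}|lborel. L + 1) = (t - s) * (L + 1)"
      using that by (simp add: set_lebesgue_integral_def)
    finally show ?thesis using I0[OF that(2)] that by (simp add: G_def k_def algebra_simps)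
  qed
  have hk: "\<phi>1 integrable_on {s..t}" "(LINT x:{s..t}|lborel. \<phi>1 x) = integral {s..t} \<phi>1" if "s \<le> t" for s t
    using set_borel_integral_eq_integral[OF si1[OF that]] by auto
  have neg: "negligible {x \<in> {a<..<b}. \<not> ((\<lambda>t. integral {a..t} \<phi>1) has_real_derivative \<phi>1 x) (at x)}"
    by (rule negligible_not_has_derivative_integral[OF hk(1)[OF ab]])
  have der1: "AE x in lebesgue. x \<in> {a<..<b} \<longrightarrow> (\<gamma> has_real_derivative \<phi>1 x) (at x)"
  proof (rule AE_I'[OF neg[unfolded negligible_iff_null_sets]], safe)
    fix x assume x: "x \<in> {a<..<b}" "\<not> (\<gamma> has_real_derivative \<phi>1 x) (at x)"
      and d: "((\<lambda>t. integral {a..t} \<phi>1) has_real_derivative \<phi>1 x) (at x)"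
    have "((\<lambda>t. integral {a..t} \<phi>1 + \<gamma> a) has_real_derivative \<phi>1 x) (at x)"
      using d by (auto intro!: derivative_eq_intros)
    then have "(\<gamma> has_real_derivative \<phi>1 x) (at x)"
    proof (rule has_field_derivative_transform_within_open[of _ _ _ "{a<..<b}"])
      fix y assume "y \<in> {a<..<b}"
      then show "integral {a..y} \<phi>1 + \<gamma> a = \<gamma> y" using hk(2)[of a y] I1[of a y] by simp
    qed (use x in auto)
    then show False using x by blast
  qed
  \<comment> \<open>Truncation gives the bound at every point. Almost everywhere in the interval it
    changes nothing, since a derivative of an L-Lipschitz function lies in [-L, L].\<close>
  define \<phi> where "\<phi> x = max (- L) (min L (\<phi>1 x))" for x
  have m[measurable]: "\<phi> \<in> borel_measurable borel" unfolding \<phi>_def by measurable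
  have eq: "AE x in lebesgue. x \<in> {a<..<b} \<longrightarrow> \<phi> x = \<phi>1 x \<and> (\<gamma> has_real_derivative \<phi>1 x) (at x)"
    using der1
  proof eventually_elim
    case (elim x)
    show ?case
    proof
      assume x: "x \<in> {a<..<b}"
      then have d: "(\<gamma> has_real_derivative \<phi>1 x) (at x)" using elim by auto
      then have "((\<lambda>y. \<bar>(\<gamma> y - \<gamma> x) / (y - x)\<bar>) \<longlongrightarrow> \<bar>\<phi>1 x\<bar>) (at x)"
        by (intro tendsto_rabs) (simp add: has_field_derivative_iff)
      moreover have "eventually (\<lambda>y. \<bar>(\<gamma> y - \<gamma> x) / (y - x)\<bar> \<le> L) (at x)"
      proof -
        have "eventually (\<lambda>y. y \<in> {a<..<b}) (at x)" using x by (intro eventually_at_in_open') auto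
        moreover have "eventually (\<lambda>y. y \<noteq> x) (at x)" by (simp add: eventually_at_filter)
        ultimately show ?thesis
        proof eventually_elim
          case (elim y)
          have "\<bar>\<gamma> y - \<gamma> x\<bar> \<le> L * \<bar>y - x\<bar>"
            using lipschitz_onD[OF lip, of y x] x elim by (auto simp: dist_real_def)
          then show ?case using elim by (simp add: abs_divide divide_le_eq)
        qed
      qed
      ultimately have "\<bar>\<phi>1 x\<bar> \<le> L" by (rule tendsto_upperbound) simp
      then show "\<phi> x = \<phi>1 x \<and> (\<gamma> has_real_derivative \<phi>1 x) (at x)" using d by (auto simp: \<phi>_def)
    qed
  qed
  show ?thesis
  proof (rule that[OF m])
    show "\<forall>x. \<bar>\<phi> x\<bar> \<le> L" using L0 by (auto simp: \<phi>_def)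
    show "AE x in lebesgue. x \<in> {a<..<b} \<longrightarrow> (\<gamma> has_real_derivative \<phi> x) (at x)"
      using eq by eventually_elim auto
  next
    show "\<forall>s t. a \<le> s \<longrightarrow> s \<le> t \<longrightarrow> t \<le> b \<longrightarrow> (LINT x:{s..t}|lebesgue. \<phi> x) = \<gamma> t - \<gamma> s"
    proof (intro allI impI)
      fix s t assume st: "a \<le> s" "s \<le> t" "t \<le> b"
      have ends: "AE x in lebesgue. x \<noteq> a \<and> x \<noteq> b"
        using AE_not_in[of "{a}" lebesgue] AE_not_in[of "{b}" lebesgue]
        by (auto simp: negligible_iff_null_sets[symmetric])
      have "(LINT x:{s..t}|lebesgue. \<phi> x) = (LINT x:{s..t}|lebesgue. \<phi>1 x)"
        unfolding set_lebesgue_integral_def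
      proof (rule integral_cong_AE)
        show "AE x in lebesgue. indicator {s..t} x *\<^sub>R \<phi> x = indicator {s..t} x *\<^sub>R \<phi>1 x"
          using eq ends by eventually_elim (use st in \<open>auto simp: indicator_def\<close>)
      qed (rule measurable_completion; measurable)+
      also have "\<dots> = (LINT x:{s..t}|lborel. \<phi>1 x)"
        unfolding set_lebesgue_integral_def by (rule integral_completion) measurable
      finally show "(LINT x:{s..t}|lebesgue. \<phi> x) = \<gamma> t - \<gamma> s" using I1[OF st] by simp
    qed
  qed
qed

lemma locally_lipschitz_AE_differentiable:
  fixes X :: "real \<Rightarrow> real"
  assumes "\<And>T. a \<le> T \<Longrightarrow> \<exists>L. L-lipschitz_on {a..T} X"
  shows "AE t in lebesgue. a < t \<longrightarrow> (\<exists>D. (X has_real_derivative D) (at t))"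
proof -
  have "AE t in lebesgue. t \<in> {a<..<a + real n} \<longrightarrow> (\<exists>D. (X has_real_derivative D) (at t))" for n
  proof -
    obtain L where L: "L-lipschitz_on {a..a + real n} X" using assms[of "a + real n"] by auto
    obtain \<phi> where "\<phi> \<in> borel_measurable borel" "\<forall>x. \<bar>\<phi> x\<bar> \<le> L"
      and \<phi>: "AE x in lebesgue. x \<in> {a<..<a + real n} \<longrightarrow> (X has_real_derivative \<phi> x) (at x)"
      and "\<forall>s t. a \<le> s \<longrightarrow> s \<le> t \<longrightarrow> t \<le> a + real n \<longrightarrow> (LINT x:{s..t}|lebesgue. \<phi> x) = X t - X s"
      by (rule lipschitz_AE_derivative[OF L])
    show ?thesis using \<phi> by eventually_elim blast
  qed
  then have "AE t in lebesgue. \<forall>n. t \<in> {a<..<a + real n} \<longrightarrow> (\<exists>D. (X has_real_derivative D) (at t))"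
    unfolding AE_all_countable by blast
  then show ?thesis
  proof eventually_elim
    case (elim t)
    obtain n where "t - a < real n" using reals_Archimedean2 by blast
    then show ?case using elim[rule_format, of n] by auto
  qed
qed

subsection \<open>Primitives and functions of bounded variation\<close>

text \<open>A Lebesgue set integral over \<open>{0..s}\<close>, the form that occurs in
  \<open>beta\<close>, \<open>H_A\<close> and \<open>J\<close>; it vanishes for negative
  \<open>s\<close>.\<close>

definition prim :: "(real \<Rightarrow> real) \<Rightarrow> real \<Rightarrow> real" where
  "prim k s = (LINT \<theta>:{0..s}|lebesgue. k \<theta>)"

lemma LINT_combine:
  fixes k :: "real \<Rightarrow> real"
  assumes "k absolutely_integrable_on {a..c}" "a \<le> b" "b \<le> c"
  shows "(LINT \<theta>:{a..c}|lebesgue. k \<theta>) = (LINT \<theta>:{a..b}|lebesgue. k \<theta>) + (LINT \<theta>:{b..c}|lebesgue. k \<theta>)"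
proof -
  have 1: "k absolutely_integrable_on {a..b}" "k absolutely_integrable_on {b..c}"
    using assms by (auto intro: absolutely_integrable_on_subinterval)
  show ?thesis
    using set_lebesgue_integral_eq_integral[OF assms(1)] set_lebesgue_integral_eq_integral(2)[OF 1(1)]
      set_lebesgue_integral_eq_integral(2)[OF 1(2)]
      Henstock_Kurzweil_Integration.integral_combine[OF assms(2,3), of k] by simp
qed

lemma LINT_ends_AE: "AE x in lebesgue. x \<noteq> (a::real) \<and> x \<noteq> b"
  using AE_not_in[of "{a}" lebesgue] AE_not_in[of "{b}" lebesgue]
  by (auto simp: negligible_iff_null_sets[symmetric])

lemma abs_int_continuous:
  fixes k :: "real \<Rightarrow> real"
  shows "continuous_on UNIV k \<Longrightarrow> k absolutely_integrable_on {r..s}"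
  by (rule absolutely_integrable_continuous_real) (rule continuous_on_subset, auto)

lemma prim_0 [simp]: "prim k 0 = 0"
proof -
  have "(LINT \<theta>:{0..0::real}|lebesgue. k \<theta>) = 0"
    unfolding set_lebesgue_integral_def
    by (rule integral_eq_zero_AE) (use LINT_ends_AE[of 0 0] in eventually_elim, auto)
  then show ?thesis by (simp add: prim_def)
qed

lemma prim_diff:
  assumes "continuous_on UNIV k" "0 \<le> r" "r \<le> s"
  shows "(LINT \<theta>:{r..s}|lebesgue. k \<theta>) = prim k s - prim k r"
  using LINT_combine[OF abs_int_continuous[OF assms(1)] assms(2,3)] by (simp add: prim_def)

lemma prim_eq_integral:
  assumes "continuous_on UNIV k"
  shows "prim k s = integral {0..s} k"
  unfolding prim_def by (rule set_lebesgue_integral_eq_integral(2)[OF abs_int_continuous[OF assms]])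

lemma prim_has_derivative:
  assumes k: "continuous_on UNIV k" and s: "0 \<le> s"
  shows "(prim k has_real_derivative k s) (at s within {0..})"
proof -
  have "(prim k has_real_derivative k s) (at s within {0..s+1})"
    using integral_has_real_derivative[of 0 "s+1" k s] s continuous_on_subset[OF k]
    by (simp add: prim_eq_integral[OF k, abs_def] )
  moreover have "at s within {0..s+1} = at s within {0..}"
    by (rule at_within_nhd[of _ "{..<s+1}"]) auto
  ultimately show ?thesis by simp
qed

lemma prim_le:
  assumes k: "continuous_on UNIV k" and m: "continuous_on UNIV m" and "0 \<le> r" "r \<le> s"
    and le: "\<And>\<theta>. r \<le> \<theta> \<Longrightarrow> \<theta> \<le> s \<Longrightarrow> k \<theta> \<le> m \<theta>"
  shows "prim k s - prim k r \<le> prim m s - prim m r"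
  unfolding prim_diff[OF k assms(3,4), symmetric] prim_diff[OF m assms(3,4), symmetric]
  by (rule set_integral_mono) (use le abs_int_continuous k m in auto)

lemma prim_const: "0 \<le> s \<Longrightarrow> prim (\<lambda>_. c) s = c * s"
  by (subst prim_eq_integral) auto

lemma prim_less:
  assumes k: "continuous_on UNIV k" and m: "continuous_on UNIV m" and "0 \<le> r" "r < s"
    and less: "\<And>\<theta>. r \<le> \<theta> \<Longrightarrow> \<theta> \<le> s \<Longrightarrow> k \<theta> < m \<theta>"
  shows "prim k s - prim k r < prim m s - prim m r"
proof -
  have c: "continuous_on {r..s} (\<lambda>x. m x - k x)"
    using k m by (intro continuous_intros) (auto intro: continuous_on_subset)
  \<comment> \<open>By compactness the difference of the integrands has a positive minimum
    \<open>d\<close>, which contributes at least d * (s - r).\<close>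
  obtain z where z: "z \<in> {r..s}" "\<And>y. y \<in> {r..s} \<Longrightarrow> m z - k z \<le> m y - k y"
    using continuous_attains_inf[OF _ _ c] assms by auto
  define d where "d = m z - k z"
  have d: "d > 0" using less z by (auto simp: d_def)
  have km: "continuous_on UNIV (\<lambda>x. k x + d)" using k by (intro continuous_intros)
  have "prim (\<lambda>x. k x + d) s - prim (\<lambda>x. k x + d) r \<le> prim m s - prim m r"
    by (rule prim_le[OF km m]) (use z assms in \<open>auto simp: d_def algebra_simps\<close>)
  moreover have "prim (\<lambda>x. k x + d) t = prim k t + d * t" if "0 \<le> t" for t
    using that abs_int_continuous[OF k, of 0 t] abs_int_continuous[of "\<lambda>_. d" 0 t]
    by (simp add: prim_eq_integral[OF k] prim_eq_integral[OF km] set_lebesgue_integral_eq_integral(1)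
        Henstock_Kurzweil_Integration.integral_add)
  moreover have "d * r < d * s" using d assms by simp
  ultimately show ?thesis using assms by (simp add: algebra_simps)
qed

lemma continuous_on_slice:
  assumes k: "continuous_on UNIV (\<lambda>(a, \<theta>). k a \<theta>)"
  shows "continuous_on UNIV (k a)"
proof -
  have "continuous_on UNIV (\<lambda>\<theta>. (\<lambda>(a, \<theta>). k a \<theta>) (a, \<theta>))"
    by (rule continuous_on_compose2[OF k]) (auto intro!: continuous_intros)
  then show ?thesis by simp
qed

lemma continuous_bounded_on_rectangle:
  fixes k :: "real \<Rightarrow> real \<Rightarrow> real"
  assumes k: "continuous_on UNIV (\<lambda>(a, \<theta>). k a \<theta>)"
  obtains G where "0 < G" "\<forall>a \<theta>. \<bar>a\<bar> \<le> K \<longrightarrow> 0 \<le> \<theta> \<longrightarrow> \<theta> \<le> T \<longrightarrow> \<bar>k a \<theta>\<bar> \<le> G"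
proof -
  have "compact ((\<lambda>(a, \<theta>). k a \<theta>) ` ({-K..K} \<times> {0..T}))"
    by (rule compact_continuous_image)
      (use k in \<open>auto intro: continuous_on_subset compact_Times\<close>)
  then obtain B where B: "\<And>y. y \<in> (\<lambda>(a, \<theta>). k a \<theta>) ` ({-K..K} \<times> {0..T}) \<Longrightarrow> \<bar>y\<bar> \<le> B"
    using compact_imp_bounded by (force simp: bounded_iff)
  have "\<bar>k a \<theta>\<bar> \<le> \<bar>B\<bar> + 1" if "\<bar>a\<bar> \<le> K" "0 \<le> \<theta>" "\<theta> \<le> T" for a \<theta>
  proof -
    have "\<bar>k a \<theta>\<bar> \<le> B"
      by (rule B, rule image_eqI[of _ _ "(a, \<theta>)"]) (use that in \<open>auto simp: abs_le_iff\<close>)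
    then show ?thesis by simp
  qed
  then show ?thesis by (intro that[of "\<bar>B\<bar> + 1"]) auto
qed

text \<open>The substitution \<theta> = s * u moves the varying upper limit into an integrand over
  the fixed interval [0, 1], where continuity of parametric integrals applies.\<close>

lemma prim_tendsto:
  fixes k :: "real \<Rightarrow> real \<Rightarrow> real"
  assumes k: "continuous_on UNIV (\<lambda>(a, \<theta>). k a \<theta>)"
    and a: "(a \<longlongrightarrow> a0) F" and s: "(s \<longlongrightarrow> s0) F" and pos: "eventually (\<lambda>n. 0 \<le> s n) F" and s0: "0 \<le> s0"
  shows "((\<lambda>n. prim (k (a n)) (s n)) \<longlongrightarrow> prim (k a0) s0) F"
proof -
  have kc: "continuous_on UNIV (k a)" for a
    by (rule continuous_on_slice[OF k])
  define P where "P = (\<lambda>p. integral (cbox 0 1) (\<lambda>u. snd p * k (fst p) (snd p * u)))"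
  have "continuous_on UNIV P"
    unfolding P_def
  proof (rule integral_continuous_on_param)
    have "continuous_on (UNIV \<times> cbox 0 1) (\<lambda>x::(real \<times> real) \<times> real. (\<lambda>(a, \<theta>). k a \<theta>) (fst (fst x), snd (fst x) * snd x))"
      by (rule continuous_on_compose2[OF k]) (auto intro!: continuous_intros)
    then have "continuous_on (UNIV \<times> cbox 0 1) (\<lambda>x::(real \<times> real) \<times> real.
        snd (fst x) * k (fst (fst x)) (snd (fst x) * snd x))"
      by (intro continuous_intros) simp
    then show "continuous_on (UNIV \<times> cbox 0 1) (\<lambda>(p, t). snd p * k (fst p) (snd p * t))"
      by (simp add: case_prod_beta)
  qed
  then have "isCont P (a0, s0)" by (simp add: continuous_on_eq_continuous_at)
  then have *: "((\<lambda>n. P (a n, s n)) \<longlongrightarrow> P (a0, s0)) F"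
    by (rule isCont_tendsto_compose) (intro tendsto_intros a s)
  have eq: "P (a, s) = prim (k a) s" if "0 \<le> s" for a s
  proof (cases "s = 0")
    case False
    then have s: "s > 0" using that by simp
    have "(\<lambda>x. x / s) ` {0..s} = {0..1}"
      using s by (auto simp: image_iff intro!: bexI[of _ "s * _"])
    then have "integral {0..1} (\<lambda>x. k a (s * x)) = (1 / \<bar>s\<bar>) *\<^sub>R integral {0..s} (k a)"
      using integral_stretch_real[of s 0 s "k a"] s by simp
    then show ?thesis using s by (simp add: P_def prim_eq_integral[OF kc])
  qed (simp add: P_def)
  show ?thesis
    using * unfolding eq[OF s0]
    by (rule Lim_transform_eventually) (use pos in eventually_elim, simp add: eq)
qed

text \<open>Parameter and upper limit move together; joint continuity makes the integrand uniformly
  close to \<open>k a0 t\<close> on the shrinking interval.\<close>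

lemma prim_quotient_tendsto:
  fixes k :: "real \<Rightarrow> real \<Rightarrow> real"
  assumes k: "continuous_on UNIV (\<lambda>(a, \<theta>). k a \<theta>)"
    and a: "a \<longlonglongrightarrow> a0" and s: "s \<longlonglongrightarrow> t" and gt: "\<And>n::nat. t < s n" and t: "0 \<le> t"
  shows "(\<lambda>n. (prim (k (a n)) (s n) - prim (k (a n)) t) / (s n - t)) \<longlonglongrightarrow> k a0 t"
proof (rule LIMSEQ_I)
  fix e :: real assume e: "0 < e"
  have kc: "continuous_on UNIV (k a)" for a
    by (rule continuous_on_slice[OF k])
  have "isCont (\<lambda>(a, \<theta>). k a \<theta>) (a0, t)" using k by (simp add: continuous_on_eq_continuous_at)
  then obtain d where d: "d > 0" "\<And>p. dist p (a0, t) < d \<Longrightarrow> dist (k (fst p) (snd p)) (k a0 t) < e / 2"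
    using e unfolding continuous_at_eps_delta case_prod_beta by (metis fst_conv snd_conv half_gt_zero)
  have near: "\<bar>k a \<theta> - k a0 t\<bar> < e / 2" if "\<bar>a - a0\<bar> < d / 2" "\<bar>\<theta> - t\<bar> < d / 2" for a \<theta>
  proof -
    have "dist (a, \<theta>) (a0, t) \<le> \<bar>a - a0\<bar> + \<bar>\<theta> - t\<bar>"
      using sqrt_sum_squares_le_sum_abs by (simp add: dist_Pair_Pair dist_real_def)
    then show ?thesis using d(2)[of "(a, \<theta>)"] that by (simp add: dist_real_def)
  qed
  have "eventually (\<lambda>n. \<bar>a n - a0\<bar> < d / 2) sequentially" "eventually (\<lambda>n. \<bar>s n - t\<bar> < d / 2) sequentially"
    using tendstoD[OF a, of "d/2"] tendstoD[OF s, of "d/2"] d(1) by (auto simp: dist_real_def)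
  then have "eventually (\<lambda>n. norm ((prim (k (a n)) (s n) - prim (k (a n)) t) / (s n - t) - k a0 t) < e) sequentially"
  proof eventually_elim
    case (elim n)
    have st: "t < s n" by (rule gt)
    have "\<bar>k (a n) \<theta> - k a0 t\<bar> < e / 2" if "t \<le> \<theta>" "\<theta> \<le> s n" for \<theta>
      by (rule near) (use that elim in auto)
    then have b: "k (a n) \<theta> \<le> k a0 t + e / 2" "k a0 t - e / 2 \<le> k (a n) \<theta>" if "t \<le> \<theta>" "\<theta> \<le> s n" for \<theta>
      using that by (smt (verit))+
    have "prim (k (a n)) (s n) - prim (k (a n)) t \<le> prim (\<lambda>_. k a0 t + e / 2) (s n) - prim (\<lambda>_. k a0 t + e / 2) t"
      by (rule prim_le[OF kc]) (use st t b in auto)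
    moreover have "prim (\<lambda>_. k a0 t - e / 2) (s n) - prim (\<lambda>_. k a0 t - e / 2) t \<le> prim (k (a n)) (s n) - prim (k (a n)) t"
      by (rule prim_le[OF _ kc]) (use st t b in auto)
    ultimately have "prim (k (a n)) (s n) - prim (k (a n)) t \<le> k a0 t * (s n - t) + e / 2 * (s n - t)"
      "k a0 t * (s n - t) - e / 2 * (s n - t) \<le> prim (k (a n)) (s n) - prim (k (a n)) t"
      using st t by (simp_all add: prim_const field_simps)
    then have "\<bar>prim (k (a n)) (s n) - prim (k (a n)) t - k a0 t * (s n - t)\<bar> \<le> e / 2 * (s n - t)"
      by (simp only: abs_le_iff) linarith
    also have "\<dots> < e * (s n - t)" using e st by simp
    finally have "\<bar>prim (k (a n)) (s n) - prim (k (a n)) t - k a0 t * (s n - t)\<bar> / (s n - t) < e"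
      using st by (simp add: divide_less_eq)
    moreover have "(prim (k (a n)) (s n) - prim (k (a n)) t) / (s n - t) - k a0 t =
       (prim (k (a n)) (s n) - prim (k (a n)) t - k a0 t * (s n - t)) / (s n - t)"
      using st by (simp add: field_simps)
    ultimately show ?case using st by (simp add: abs_divide)
  qed
  then show "\<exists>no. \<forall>n\<ge>no. norm ((prim (k (a n)) (s n) - prim (k (a n)) t) / (s n - t) - k a0 t) < e"
    by (simp add: eventually_sequentially)
qed

text \<open>Jordan decomposition: increments of the variation function dominate those of
  \<open>g\<close>, so both it and its difference with \<open>g\<close> are monotone.\<close>

lemma bounded_variation_on_decompose:
  assumes "bounded_variation_on {0..} g"
  obtains p q :: "real \<Rightarrow> real" where "mono p" "mono q" "\<And>t. 0 \<le> t \<Longrightarrow> g t = p t - q t"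
proof -
  obtain M where M: "\<And>n s. mono_on {..n} s \<Longrightarrow> s ` {..n} \<subseteq> {0..} \<Longrightarrow>
      (\<Sum>i<n. \<bar>g (s (Suc i)) - g (s i)\<bar>) \<le> M"
    using assms unfolding bounded_variation_on_def by blast
  define S where "S t = {\<Sum>i<n. \<bar>g (s (Suc i)) - g (s i)\<bar> | n s. mono_on {..n} s \<and> s ` {..n} \<subseteq> {0..t}}" for t
  define V where "V t = Sup (S (max 0 t))" for t
  have bdd: "bdd_above (S t)" for t
    by (rule bdd_aboveI[of _ M]) (force simp: S_def intro!: M)
  have ne: "S t \<noteq> {}" if "0 \<le> t" for t
    unfolding S_def using that by (auto simp: mono_on_def intro!: exI[of _ 0] exI[of _ "\<lambda>_. 0"])
  have key: "V s + \<bar>g t - g s\<bar> \<le> V t" if st: "0 \<le> s" "s \<le> t" for s t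
  proof -
    have "x \<le> V t - \<bar>g t - g s\<bar>" if x: "x \<in> S s" for x
    proof -
      obtain n \<sigma> where \<sigma>: "mono_on {..n} \<sigma>" "\<sigma> ` {..n} \<subseteq> {0..s}"
        "x = (\<Sum>i<n. \<bar>g (\<sigma> (Suc i)) - g (\<sigma> i)\<bar>)" using x by (auto simp: S_def)
      \<comment> \<open>The partition up to \<open>s\<close> is prolonged by the points
        \<open>s\<close> and \<open>t\<close>, which adds at least the absolute increment of
        \<open>g\<close> from \<open>s\<close> to \<open>t\<close>.\<close>
      define \<rho> where "\<rho> i = (if i \<le> n then \<sigma> i else if i = Suc n then s else t)" for i
      have in0: "\<And>i. i \<le> n \<Longrightarrow> 0 \<le> \<sigma> i \<and> \<sigma> i \<le> s" using \<sigma>(2) by auto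
      have "mono_on {..Suc (Suc n)} \<rho>"
        by (rule mono_onI) (use \<sigma>(1) in0 st in \<open>auto simp: \<rho>_def mono_on_def intro: order_trans\<close>)
      moreover have "\<rho> ` {..Suc (Suc n)} \<subseteq> {0..t}" using in0 st by (force simp: \<rho>_def)
      ultimately have "(\<Sum>i<Suc (Suc n). \<bar>g (\<rho> (Suc i)) - g (\<rho> i)\<bar>) \<in> S t" unfolding S_def by blast
      then have "(\<Sum>i<Suc (Suc n). \<bar>g (\<rho> (Suc i)) - g (\<rho> i)\<bar>) \<le> V t"
        unfolding V_def using st by (auto intro!: cSup_upper bdd)
      moreover have "(\<Sum>i<n. \<bar>g (\<rho> (Suc i)) - g (\<rho> i)\<bar>) = x"
        unfolding \<sigma>(3) by (rule sum.cong) (auto simp: \<rho>_def)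
      ultimately show ?thesis by (simp add: \<rho>_def)
    qed
    then have "V s \<le> V t - \<bar>g t - g s\<bar>" unfolding V_def[of s] using st ne by (intro cSup_least) auto
    then show ?thesis by simp
  qed
  have Vm: "V (max 0 t) = V t" for t by (simp add: V_def)
  show ?thesis
  proof (rule that[of V "\<lambda>t. V t - g (max 0 t)"])
    show "mono V"
      by (rule monoI) (use key[of "max 0 _" "max 0 _"] Vm in \<open>smt (verit) max.mono\<close>)
    show "mono (\<lambda>t. V t - g (max 0 t))"
    proof (rule monoI)
      fix x y :: real assume "x \<le> y"
      then have "V (max 0 x) + \<bar>g (max 0 y) - g (max 0 x)\<bar> \<le> V (max 0 y)" by (intro key) auto
      then show "V x - g (max 0 x) \<le> V y - g (max 0 y)" unfolding Vm by linarith
    qed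
  qed auto
qed

text \<open>\<open>BV\<close> fixes \<open>ub\<close> only modulo null sets; \<open>k\<close> is a
  representative that can be integrated. It is Borel as a difference of monotone functions, and
  partitions with the two points 0 and t bound it.\<close>

lemma BV_measurable_bounded:
  assumes "BV g"
  obtains M k where "k \<in> borel_measurable lebesgue" "\<forall>t. \<bar>k t\<bar> \<le> M"
    "AE t in lebesgue. 0 \<le> t \<longrightarrow> g t = k t"
proof -
  obtain g' where g': "bounded_variation_on {0..} g'" "AE t in lebesgue_on {0..}. g t = g' t"
    using assms by (auto simp: BV_def)
  obtain p q where pq: "mono p" "mono q" "\<And>t. 0 \<le> t \<Longrightarrow> g' t = p t - q t"
    using bounded_variation_on_decompose[OF g'(1)] by blast
  obtain M where M: "\<And>n s. mono_on {..n} s \<Longrightarrow> s ` {..n} \<subseteq> {0..} \<Longrightarrow>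
      (\<Sum>i<n. \<bar>g' (s (Suc i)) - g' (s i)\<bar>) \<le> M"
    using g'(1) unfolding bounded_variation_on_def by blast
  have bd: "\<bar>g' t\<bar> \<le> M + \<bar>g' 0\<bar>" if "0 \<le> t" for t
  proof -
    have "(\<Sum>i<1. \<bar>g' ((\<lambda>i. if i = 0 then 0 else t) (Suc i)) - g' ((\<lambda>i. if i = 0 then 0 else t) i)\<bar>) \<le> M"
      by (rule M) (use that in \<open>auto simp: mono_on_def\<close>)
    then show ?thesis by simp
  qed
  define k where "k t = (if 0 \<le> t then g' t else 0)" for t
  have [measurable]: "p \<in> borel_measurable borel" "q \<in> borel_measurable borel"
    using pq borel_measurable_mono by blast+
  have "(\<lambda>t. if 0 \<le> t then p t - q t else 0) \<in> borel_measurable borel" by measurable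
  also have "(\<lambda>t. if 0 \<le> t then p t - q t else 0) = k" using pq by (auto simp: k_def)
  finally have "k \<in> borel_measurable lebesgue" by (simp add: measurable_completion)
  moreover have "\<bar>k t\<bar> \<le> M + \<bar>g' 0\<bar>" for t using bd[of t] bd[of 0] by (auto simp: k_def)
  moreover have "AE t in lebesgue. 0 \<le> t \<longrightarrow> g t = k t"
    using g'(2) by (auto simp: AE_restrict_space_iff k_def)
  ultimately show ?thesis using that by blast
qed

subsection \<open>The flux and its conjugate\<close>

locale flux =
  fixes f :: "real \<Rightarrow> real"
  assumes C2: "C2 f" and sconv: "strictly_convex f"
    and superlinear: "filterlim (\<lambda>v. f v / \<bar>v\<bar>) at_top at_infinity"
begin

abbreviation g :: "real \<Rightarrow> real" where "g \<equiv> deriv f"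

lemma f_deriv: "(f has_real_derivative g v) (at v)"
  using C2 by (simp add: C2_def DERIV_deriv_iff_real_differentiable)

lemma f_cont: "continuous_on UNIV f"
  using f_deriv by (meson DERIV_isCont continuous_at_imp_continuous_on)

lemma g_cont: "continuous_on UNIV g"
  using C2 by (metis C2_def DERIV_deriv_iff_real_differentiable DERIV_isCont continuous_at_imp_continuous_on)

lemma f_convex: "convex_on UNIV f"
proof (rule convex_onI)
  fix t x y :: real assume t: "0 < t" "t < 1"
  show "f ((1 - t) *\<^sub>R x + t *\<^sub>R y) \<le> (1 - t) * f x + t * f y"
  proof (cases "x = y")
    case True then show ?thesis by (simp add: algebra_simps)
  next
    case False
    then show ?thesis using sconv t unfolding strictly_convex_def by (auto intro: less_imp_le)
  qed
qed auto

lemma tangent_le: "f x + g x * (y - x) \<le> f y"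
  using convex_on_imp_above_tangent[OF f_convex _ _ _ f_deriv[of x, unfolded has_field_derivative_def[symmetric]], of y]
  by (simp add: f_deriv algebra_simps)

text \<open>At the midpoint of \<open>x\<close> and \<open>y\<close>, \<open>f\<close> is strictly
  below the chord but not below the tangent at \<open>x\<close>; doubling this gap gives strictness
  at \<open>y\<close>.\<close>

lemma tangent_less:
  assumes "x \<noteq> y"
  shows "f x + g x * (y - x) < f y"
proof -
  have "f ((1 - 1/2) * x + 1/2 * y) < (1 - 1/2) * f x + 1/2 * f y"
    using sconv assms unfolding strictly_convex_def by (metis half_gt_zero_iff zero_less_one field_sum_of_halves less_add_same_cancel1)
  moreover have "f x + g x * (((1 - 1/2) * x + 1/2 * y) - x) \<le> f ((1 - 1/2) * x + 1/2 * y)"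
    by (rule tangent_le)
  ultimately show ?thesis by (simp add: algebra_simps)
qed

lemma g_strict_mono: "strict_mono g"
proof (rule strict_monoI)
  fix x y :: real assume "x < y"
  then have "f x + g x * (y - x) < f y" "f y + g y * (x - y) < f x" by (auto intro: tangent_less)
  then have "0 < (g y - g x) * (y - x)" by (simp add: algebra_simps)
  then show "g x < g y" using \<open>x < y\<close> by (simp add: zero_less_mult_iff)
qed

lemma g_less_iff [simp]: "g x < g y \<longleftrightarrow> x < y" and g_le_iff [simp]: "g x \<le> g y \<longleftrightarrow> x \<le> y"
  using g_strict_mono by (simp_all add: strict_mono_less strict_mono_less_eq)

lemma g_unbounded: "\<exists>v>0. g v \<ge> c" "\<exists>v<0. g v \<le> c"
proof -
  \<comment> \<open>The tangent at \<open>v\<close>, evaluated at 0, brings in f 0; the summand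
    \<bar>f 0\<bar> compensates for it because v \<ge> 1.\<close>
  have "eventually (\<lambda>v. f v / \<bar>v\<bar> \<ge> \<bar>c\<bar> + \<bar>f 0\<bar>) at_infinity"
    using superlinear by (simp add: filterlim_at_top)
  then obtain B where B: "\<And>v. \<bar>v\<bar> \<ge> B \<Longrightarrow> f v / \<bar>v\<bar> \<ge> \<bar>c\<bar> + \<bar>f 0\<bar>"
    unfolding eventually_at_infinity by auto
  define v where "v = max 1 B"
  have v: "v \<ge> 1" by (simp add: v_def)
  have "(\<bar>c\<bar> + \<bar>f 0\<bar>) * v \<le> f v" "(\<bar>c\<bar> + \<bar>f 0\<bar>) * v \<le> f (- v)"
    using B[of v] B[of "- v"] v by (auto simp: v_def le_divide_eq split: if_splits)
  moreover have "f v + g v * (0 - v) \<le> f 0" "f (- v) + g (- v) * (0 + v) \<le> f 0"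
    using tangent_le[of v 0] tangent_le[of "-v" 0] by auto
  moreover have "\<bar>f 0\<bar> * 1 \<le> \<bar>f 0\<bar> * v" using v by (intro mult_left_mono) auto
  ultimately have "\<bar>c\<bar> * v \<le> g v * v" "\<bar>c\<bar> * v \<le> - g (- v) * v" by (auto simp: algebra_simps)
  then have "\<bar>c\<bar> \<le> g v" "\<bar>c\<bar> \<le> - g (- v)"
    using v mult_right_le_imp_le[of "\<bar>c\<bar>" v "- g (- v)"] by auto
  then have "0 < v \<and> c \<le> g v" "- v < 0 \<and> g (- v) \<le> c" using v by linarith+
  then show "\<exists>v>0. g v \<ge> c" "\<exists>v<0. g v \<le> c" by blast+
qed

lemma g_surj: "\<exists>v. g v = c"
proof -
  obtain v w where "g v \<ge> c" "g w \<le> c" "w < 0" "0 < v" using g_unbounded by meson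
  then show ?thesis
    using IVT'[of g w c v] continuous_on_subset[OF g_cont] by fastforce
qed

lemma conjugate_eq: "conjugate f (g v) = g v * v - f v"
  unfolding conjugate_def
proof (rule cSup_eq_maximum)
  fix x assume "x \<in> range (\<lambda>w. g v * w - f w)"
  then show "x \<le> g v * v - f v" using tangent_le[of v] by (auto simp: algebra_simps)
qed auto

lemma conjugate_ge: "p * v - f v \<le> conjugate f p"
proof -
  obtain w where w: "p = g w" using g_surj by metis
  show ?thesis using tangent_le[of w v] unfolding w conjugate_eq by (simp add: algebra_simps)
qed

text \<open>A finite convex function on the line is continuous. Convexity follows by testing both
  end slopes with the maximizer \<open>w\<close> of the intermediate slope.\<close>

lemma conjugate_cont: "continuous_on UNIV (conjugate f)"
proof -
  have "convex_on UNIV (conjugate f)"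
  proof (rule convex_onI)
    fix t p q :: real assume t: "0 < t" "t < 1"
    obtain w where w: "(1 - t) *\<^sub>R p + t *\<^sub>R q = g w" using g_surj by metis
    have "conjugate f ((1 - t) *\<^sub>R p + t *\<^sub>R q) = ((1 - t) * p + t * q) * w - f w"
      using w by (simp add: conjugate_eq)
    also have "\<dots> = (1 - t) * (p * w - f w) + t * (q * w - f w)" by (simp add: algebra_simps)
    also have "\<dots> \<le> (1 - t) * conjugate f p + t * conjugate f q"
      using t by (intro add_mono mult_left_mono conjugate_ge) auto
    finally show "conjugate f ((1 - t) *\<^sub>R p + t *\<^sub>R q) \<le> (1 - t) * conjugate f p + t * conjugate f q" .
  qed auto
  then show ?thesis by (intro convex_on_continuous) auto
qed

end

section \<open>Bounded data: integrability, Lipschitz primitives, first and last zeros\<close>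

lemma abs_int_bounded:
  fixes k :: "real \<Rightarrow> real"
  assumes "(\<lambda>x. indicator {r..s} x * k x) \<in> borel_measurable lebesgue"
    and "AE x in lebesgue. x \<in> {r..s} \<longrightarrow> \<bar>k x\<bar> \<le> M"
  shows "k absolutely_integrable_on {r..s}"
  unfolding set_integrable_def
proof (rule integrableI_bounded_set[where A = "{r..s}" and B = M])
  show "(\<lambda>x. indicator {r..s} x *\<^sub>R k x) \<in> borel_measurable lebesgue" using assms(1) by simp
  show "emeasure lebesgue {r..s} < \<infinity>" by (cases "r \<le> s") auto
  show "AE x\<in>{r..s} in lebesgue. norm (indicat_real {r..s} x *\<^sub>R k x) \<le> M"
    using assms(2) by eventually_elim auto
qed auto

lemma L_infinity_bound:
  assumes "L_infinity k"
  obtains M where "0 \<le> M" "AE x in lebesgue. 0 \<le> x \<longrightarrow> \<bar>k x\<bar> \<le> M"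
proof -
  obtain M where "AE x in lebesgue_on {0..}. \<bar>k x\<bar> \<le> M" using assms by (auto simp: L_infinity_def)
  then have M: "AE x in lebesgue. 0 \<le> x \<longrightarrow> \<bar>k x\<bar> \<le> M" by (auto simp: AE_restrict_space_iff)
  show ?thesis
    by (rule that[of "max 0 M"]) (use M in \<open>auto elim: eventually_mono\<close>)
qed

lemma L_infinity_abs_int:
  assumes k: "L_infinity k" and r: "0 \<le> r"
  shows "k absolutely_integrable_on {r..s}"
proof -
  obtain M where "AE x in lebesgue. 0 \<le> x \<longrightarrow> \<bar>k x\<bar> \<le> M" using L_infinity_bound[OF k] .
  then have "AE x in lebesgue. x \<in> {r..s} \<longrightarrow> \<bar>k x\<bar> \<le> M" by eventually_elim (use r in auto)
  moreover have "(\<lambda>x. indicator {0..} x * k x) \<in> borel_measurable lebesgue"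
    using k by (simp add: L_infinity_def borel_measurable_restrict_space_iff mult.commute)
  then have "(\<lambda>x. indicator {r..s} x * (indicator {0..} x * k x)) \<in> borel_measurable lebesgue"
    by (rule borel_measurable_times[rotated]) (intro borel_measurable_indicator, simp)
  moreover have "(\<lambda>x. indicator {r..s} x * (indicator {0..} x * k x)) = (\<lambda>x. indicator {r..s} x * k x)"
    using r by (auto simp: indicator_def)
  ultimately show ?thesis by (intro abs_int_bounded) auto
qed

lemma L_infinity_prim_lipschitz:
  assumes k: "L_infinity k"
  obtains M where "0 \<le> M" "\<And>x y. 0 \<le> x \<Longrightarrow> 0 \<le> y \<Longrightarrow> \<bar>prim k x - prim k y\<bar> \<le> M * \<bar>x - y\<bar>"
proof -
  obtain M where M: "0 \<le> M" "AE x in lebesgue. 0 \<le> x \<longrightarrow> \<bar>k x\<bar> \<le> M" using L_infinity_bound[OF k] .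
  have *: "\<bar>prim k y - prim k x\<bar> \<le> M * (y - x)" if "0 \<le> x" "x \<le> y" for x y
  proof -
    have "prim k y - prim k x = (LINT \<theta>:{x..y}|lebesgue. k \<theta>)"
      using LINT_combine[OF L_infinity_abs_int[OF k order_refl] that] by (simp add: prim_def)
    moreover have "(LINT \<theta>:{x..y}|lebesgue. k \<theta>) \<le> (LINT \<theta>:{x..y}|lebesgue. M)"
      by (rule set_integral_mono_AE)
        (use that M(2) in \<open>auto intro: L_infinity_abs_int[OF k] abs_int_continuous elim!: eventually_mono\<close>)
    moreover have "(LINT \<theta>:{x..y}|lebesgue. - M) \<le> (LINT \<theta>:{x..y}|lebesgue. k \<theta>)"
      by (rule set_integral_mono_AE)
        (use that M(2) in \<open>auto intro: L_infinity_abs_int[OF k] abs_int_continuous elim!: eventually_mono\<close>)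
    moreover have "(LINT \<theta>:{x..y}|lebesgue. c) = c * (y - x)" for c
      using that by (subst prim_diff) (auto simp: prim_const algebra_simps)
    ultimately show ?thesis by (simp add: abs_le_iff)
  qed
  show ?thesis
  proof (rule that[OF M(1)])
    fix x y :: real assume "0 \<le> x" "0 \<le> y"
    then show "\<bar>prim k x - prim k y\<bar> \<le> M * \<bar>x - y\<bar>"
      using *[of x y] *[of y x] by (cases "x \<le> y") (auto simp: abs_minus_commute)
  qed
qed

lemma prim_linear:
  assumes k: "continuous_on UNIV k" and m: "continuous_on UNIV m" and "0 \<le> s"
  shows "prim (\<lambda>\<theta>. c * k \<theta> - m \<theta>) s = c * prim k s - prim m s"
  unfolding prim_def
  by (subst set_integral_diff) (use abs_int_continuous k m in auto)

text \<open>The end point \<open>r\<close> is added to the zero set so that a maximum exists; it is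
  the default when there is no zero. Paths are cut at such times to obtain pieces off the
  boundary.\<close>

lemma last_zero:
  fixes k :: "real \<Rightarrow> real"
  assumes "continuous_on {r..s} k" "r \<le> s" 
  obtains \<rho> where "r \<le> \<rho>" "\<rho> \<le> s" "\<rho> = r \<or> k \<rho> = 0" "\<And>\<theta>. \<rho> < \<theta> \<Longrightarrow> \<theta> \<le> s \<Longrightarrow> k \<theta> \<noteq> 0"
proof -
  let ?S = "insert r {\<theta> \<in> {r..s}. k \<theta> = 0}"
  have "closed {\<theta> \<in> {r..s}. k \<theta> = 0}"
    using continuous_closed_preimage_constant[OF assms(1)] by simp
  then have "compact ?S"
    by (intro compact_insert) (auto simp: compact_eq_bounded_closed intro: bounded_subset[of "{r..s}"])
  then obtain \<rho> where \<rho>: "\<rho> \<in> ?S" "\<And>\<theta>. \<theta> \<in> ?S \<Longrightarrow> \<theta> \<le> \<rho>"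
    using compact_attains_sup[of ?S] by blast
  show ?thesis
  proof (rule that)
    show "r \<le> \<rho>" "\<rho> \<le> s" "\<rho> = r \<or> k \<rho> = 0" using \<rho>(1) assms(2) by auto
    then show "k \<theta> \<noteq> 0" if "\<rho> < \<theta>" "\<theta> \<le> s" for \<theta> using \<rho>(2)[of \<theta>] that by auto
  qed
qed

lemma first_zero:
  fixes k :: "real \<Rightarrow> real"
  assumes "continuous_on {r..s} k" "r \<le> s" 
  obtains \<rho> where "r \<le> \<rho>" "\<rho> \<le> s" "\<rho> = s \<or> k \<rho> = 0" "\<And>\<theta>. r \<le> \<theta> \<Longrightarrow> \<theta> < \<rho> \<Longrightarrow> k \<theta> \<noteq> 0"
proof -
  let ?S = "insert s {\<theta> \<in> {r..s}. k \<theta> = 0}"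
  have "closed {\<theta> \<in> {r..s}. k \<theta> = 0}"
    using continuous_closed_preimage_constant[OF assms(1)] by simp
  then have "compact ?S"
    by (intro compact_insert) (auto simp: compact_eq_bounded_closed intro: bounded_subset[of "{r..s}"])
  then obtain \<rho> where \<rho>: "\<rho> \<in> ?S" "\<And>\<theta>. \<theta> \<in> ?S \<Longrightarrow> \<rho> \<le> \<theta>"
    using compact_attains_inf[of ?S] by blast
  show ?thesis
  proof (rule that)
    show "r \<le> \<rho>" "\<rho> \<le> s" "\<rho> = s \<or> k \<rho> = 0" using \<rho>(1) assms(2) by auto
    then show "k \<theta> \<noteq> 0" if "r \<le> \<theta>" "\<theta> < \<rho>" for \<theta> using \<rho>(2)[of \<theta>] that by auto
  qed
qed

subsection \<open>Parameters of \<open>h\<close>-curves\<close>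

locale bvp = flux +
  fixes \<alpha> u0 ub :: "real \<Rightarrow> real"
  assumes \<alpha>: "L_infinity \<alpha>" and u0: "L_infinity u0" and ub: "BV ub"
begin

abbreviation b :: "real \<Rightarrow> real" where "b \<equiv> beta \<alpha>"
abbreviation U0 :: "real \<Rightarrow> real" where "U0 \<equiv> prim u0"

text \<open>The \<open>h\<close>-curve with parameter \<open>a\<close> has speed \<open>spd a\<close>, and \<open>Z x t a\<close> is its translate through
  \<open>(x, t)\<close>. By the equality case of Young's inequality its running cost is \<open>a * spd a - eng a\<close>, so
  \<open>cost\<close> is expressed without the conjugate of \<open>f\<close>.\<close>

definition spd :: "real \<Rightarrow> real \<Rightarrow> real" where "spd a \<theta> = g (a * exp (b \<theta>))"
definition eng :: "real \<Rightarrow> real \<Rightarrow> real" where "eng a \<theta> = exp (- b \<theta>) * f (a * exp (b \<theta>))"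
abbreviation Phi :: "real \<Rightarrow> real \<Rightarrow> real" where "Phi a \<equiv> prim (spd a)"
abbreviation F :: "real \<Rightarrow> real \<Rightarrow> real" where "F a \<equiv> prim (eng a)"
definition cost :: "real \<Rightarrow> real \<Rightarrow> real \<Rightarrow> real" where
  "cost a r s = a * (Phi a s - Phi a r) - (F a s - F a r)"
definition Z :: "real \<Rightarrow> real \<Rightarrow> real \<Rightarrow> real \<Rightarrow> real" where
  "Z x t a \<theta> = x - (Phi a t - Phi a \<theta>)"

lemma b_cont: "continuous_on UNIV b"
proof -
  obtain M where M: "0 \<le> M" "\<And>x y. 0 \<le> x \<Longrightarrow> 0 \<le> y \<Longrightarrow> \<bar>prim \<alpha> x - prim \<alpha> y\<bar> \<le> M * \<bar>x - y\<bar>"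
    using L_infinity_prim_lipschitz[OF \<alpha>] by blast
  \<comment> \<open>For negative times the integration interval is empty and \<open>b\<close> is 0;
    so \<open>b\<close> is Lipschitz on the whole line.\<close>
  have bp: "b t = prim \<alpha> (max 0 t)" for t
  proof (cases "0 \<le> t")
    case False
    then have "b t = 0" by (simp add: beta_def set_lebesgue_integral_def)
    then show ?thesis using False by (simp add: max_def)
  qed (simp add: beta_def prim_def)
  have "M-lipschitz_on UNIV b"
  proof (rule lipschitz_onI)
    fix x y :: real
    have "\<bar>b x - b y\<bar> \<le> M * \<bar>max 0 x - max 0 y\<bar>" unfolding bp by (rule M) auto
    also have "\<dots> \<le> M * \<bar>x - y\<bar>" using M(1) by (intro mult_left_mono) auto
    finally show "dist (b x) (b y) \<le> M * dist x y" by (simp add: dist_real_def)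
  qed (rule M)
  then show ?thesis by (rule lipschitz_on_continuous_on)
qed

lemma b_measurable [measurable]: "b \<in> borel_measurable borel"
  by (rule borel_measurable_continuous_onI[OF b_cont])

lemma exp_b_bound:
  obtains E where "1 \<le> E" "\<And>\<theta>. 0 \<le> \<theta> \<Longrightarrow> \<theta> \<le> T \<Longrightarrow> exp (b \<theta>) \<le> E \<and> exp (- b \<theta>) \<le> E"
proof -
  have "compact (b ` {0..T})"
    by (rule compact_continuous_image) (auto intro: continuous_on_subset[OF b_cont])
  then obtain B where B: "\<And>\<theta>. 0 \<le> \<theta> \<Longrightarrow> \<theta> \<le> T \<Longrightarrow> \<bar>b \<theta>\<bar> \<le> B"
    using compact_imp_bounded by (force simp: bounded_iff)
  show ?thesis
  proof (rule that[of "exp \<bar>B\<bar>"])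
    fix \<theta> assume "0 \<le> \<theta>" "\<theta> \<le> T"
    then show "exp (b \<theta>) \<le> exp \<bar>B\<bar> \<and> exp (- b \<theta>) \<le> exp \<bar>B\<bar>" using B[of \<theta>] by auto
  qed auto
qed

lemma spd_cont2: "continuous_on UNIV (\<lambda>(a, \<theta>). spd a \<theta>)"
  unfolding spd_def case_prod_beta
  by (intro continuous_on_compose2[OF g_cont] continuous_intros continuous_on_compose2[OF b_cont]) auto

lemma eng_cont2: "continuous_on UNIV (\<lambda>(a, \<theta>). eng a \<theta>)"
  unfolding eng_def case_prod_beta
  by (intro continuous_on_mult continuous_on_compose2[OF f_cont] continuous_intros continuous_on_compose2[OF b_cont]) auto

lemmas spd_cont = continuous_on_slice[OF spd_cont2]
lemmas eng_cont = continuous_on_slice[OF eng_cont2]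
lemmas Phi_tendsto = prim_tendsto[OF spd_cont2]
lemmas F_tendsto = prim_tendsto[OF eng_cont2]

lemma spd_less_iff [simp]: "spd a \<theta> < spd c \<theta> \<longleftrightarrow> a < c" and spd_le_iff [simp]: "spd a \<theta> \<le> spd c \<theta> \<longleftrightarrow> a \<le> c"
  by (auto simp: spd_def)

lemma Phi_has_derivative: "0 < \<theta> \<Longrightarrow> (Phi a has_real_derivative spd a \<theta>) (at \<theta>)"
  using prim_has_derivative[OF spd_cont, of \<theta> a] at_within_interior[of \<theta> "{0..}"] by simp

lemma Phi_cont: "continuous_on {0..} (Phi a)"
  using prim_has_derivative[OF spd_cont] by (meson DERIV_continuous_on atLeast_iff)

lemma Z_cont: "continuous_on {0..} (Z x t a)"
  unfolding Z_def by (intro continuous_intros Phi_cont)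

lemma Phi_lipschitz: "0 \<le> r \<Longrightarrow> \<exists>L. L-lipschitz_on {r..s} (Phi a)"
proof -
  assume r: "0 \<le> r"
  have "compact (spd a ` {r..s})"
    by (rule compact_continuous_image) (auto intro: continuous_on_subset[OF spd_cont])
  then obtain B where B: "\<And>\<theta>. r \<le> \<theta> \<Longrightarrow> \<theta> \<le> s \<Longrightarrow> \<bar>spd a \<theta>\<bar> \<le> B"
    using compact_imp_bounded by (force simp: bounded_iff)
  have "\<bar>B\<bar>-lipschitz_on {r..s} (Phi a)"
  proof (rule bounded_derivative_imp_lipschitz)
    fix \<theta> assume "\<theta> \<in> {r..s}"
    then show "(Phi a has_derivative (*) (spd a \<theta>)) (at \<theta> within {r..s})"
      using prim_has_derivative[OF spd_cont, of \<theta> a] r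
      by (auto simp: has_field_derivative_def intro: has_derivative_subset)
    show "onorm ((*) (spd a \<theta>)) \<le> \<bar>B\<bar>"
      using B[of \<theta>] \<open>\<theta> \<in> {r..s}\<close> by (intro onorm_le) (auto simp: abs_mult intro!: mult_right_mono)
  qed auto
  then show ?thesis by blast
qed

lemma Z_lipschitz: "0 \<le> r \<Longrightarrow> \<exists>L. L-lipschitz_on {r..s} (Z x t a)"
proof -
  assume "0 \<le> r"
  then obtain L where "L-lipschitz_on {r..s} (Phi a)" using Phi_lipschitz by blast
  then have "L-lipschitz_on {r..s} (Z x t a)" by (auto simp: lipschitz_on_def Z_def dist_real_def)
  then show ?thesis by blast
qed

lemma Phi_incr_less: "\<lbrakk>0 \<le> r; r < s; a < c\<rbrakk> \<Longrightarrow> Phi a s - Phi a r < Phi c s - Phi c r"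
  by (rule prim_less[OF spd_cont spd_cont]) auto

lemma Phi_incr_le: "\<lbrakk>0 \<le> r; r \<le> s; a \<le> c\<rbrakk> \<Longrightarrow> Phi a s - Phi a r \<le> Phi c s - Phi c r"
  by (rule prim_le[OF spd_cont spd_cont]) auto

lemma Phi_incr_inj: "\<lbrakk>0 \<le> r; r < s; Phi a s - Phi a r = Phi c s - Phi c r\<rbrakk> \<Longrightarrow> a = c"
  using Phi_incr_less[of r s a c] Phi_incr_less[of r s c a] by (cases a c rule: linorder_cases) auto

text \<open>Superlinearity makes \<open>g\<close> unbounded, and the bound on exp (- b \<theta>)
  over [0, T] makes the threshold uniform in \<theta>.\<close>

lemma spd_large:
  obtains a0 where "0 < a0" "\<And>a \<theta>. a0 \<le> a \<Longrightarrow> 0 \<le> \<theta> \<Longrightarrow> \<theta> \<le> T \<Longrightarrow> c \<le> spd a \<theta>"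
proof -
  obtain E where E: "1 \<le> E" "\<And>\<theta>. 0 \<le> \<theta> \<Longrightarrow> \<theta> \<le> T \<Longrightarrow> exp (b \<theta>) \<le> E \<and> exp (- b \<theta>) \<le> E"
    using exp_b_bound[of T] by blast
  obtain v where v: "v > 0" "g v \<ge> c" using g_unbounded by blast
  show ?thesis
  proof (rule that[of "v * E"])
    fix a \<theta> assume a: "v * E \<le> a" "0 \<le> \<theta>" "\<theta> \<le> T"
    have "v = v * exp (- b \<theta>) * exp (b \<theta>)" by (simp add: exp_minus)
    also have "\<dots> \<le> v * E * exp (b \<theta>)" using E(2) a v by (intro mult_right_mono mult_left_mono) auto
    also have "\<dots> \<le> a * exp (b \<theta>)" using a by (intro mult_right_mono) auto
    finally have "g v \<le> spd a \<theta>" by (simp add: spd_def)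
    then show "c \<le> spd a \<theta>" using v by simp
  qed (use v E in simp)
qed

lemma spd_small:
  obtains a0 where "a0 < 0" "\<And>a \<theta>. a \<le> a0 \<Longrightarrow> 0 \<le> \<theta> \<Longrightarrow> \<theta> \<le> T \<Longrightarrow> spd a \<theta> \<le> c"
proof -
  obtain E where E: "1 \<le> E" "\<And>\<theta>. 0 \<le> \<theta> \<Longrightarrow> \<theta> \<le> T \<Longrightarrow> exp (b \<theta>) \<le> E \<and> exp (- b \<theta>) \<le> E"
    using exp_b_bound[of T] by blast
  obtain v where v: "v < 0" "g v \<le> c" using g_unbounded by blast
  show ?thesis
  proof (rule that[of "v * E"])
    fix a \<theta> assume a: "a \<le> v * E" "0 \<le> \<theta>" "\<theta> \<le> T"
    have "a * exp (b \<theta>) \<le> v * E * exp (b \<theta>)" using a by (intro mult_right_mono) auto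
    also have "\<dots> \<le> v * exp (- b \<theta>) * exp (b \<theta>)" using E(2) a v by (intro mult_right_mono mult_left_mono_neg) auto
    also have "\<dots> = v" by (simp add: exp_minus)
    finally have "spd a \<theta> \<le> g v" by (simp add: spd_def)
    then show "spd a \<theta> \<le> c" using v by simp
  qed (use v E in \<open>simp add: mult_less_0_iff\<close>)
qed

lemma Phi_incr_ge:
  "\<lbrakk>0 \<le> r; r \<le> s; \<And>\<theta>. r \<le> \<theta> \<Longrightarrow> \<theta> \<le> s \<Longrightarrow> c \<le> spd a \<theta>\<rbrakk> \<Longrightarrow> c * (s - r) \<le> Phi a s - Phi a r"
  using prim_le[OF _ spd_cont, of "\<lambda>_. c" r s a] by (simp add: prim_const algebra_simps)

lemma Phi_incr_upper:
  "\<lbrakk>0 \<le> r; r \<le> s; \<And>\<theta>. r \<le> \<theta> \<Longrightarrow> \<theta> \<le> s \<Longrightarrow> spd a \<theta> \<le> c\<rbrakk> \<Longrightarrow> Phi a s - Phi a r \<le> c * (s - r)"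
  using prim_le[OF spd_cont, of "\<lambda>_. c" r s a] by (simp add: prim_const algebra_simps)

lemma Phi_cont_param: "0 \<le> s \<Longrightarrow> continuous_on UNIV (\<lambda>a. Phi a s)"
  unfolding continuous_on by (intro ballI Phi_tendsto tendsto_intros) auto

text \<open>With \<open>Phi_incr_inj\<close>, existence and uniqueness of the h-curve joining two
  points at different times: the displacement is continuous in the parameter, and large parameters
  of either sign push it past \<open>p\<close>.\<close>

lemma Phi_incr_surj:
  assumes "0 \<le> r" "r < s"
  obtains a where "Phi a s - Phi a r = p"
proof -
  obtain a1 where a1: "0 < a1" "\<And>a \<theta>. a1 \<le> a \<Longrightarrow> 0 \<le> \<theta> \<Longrightarrow> \<theta> \<le> s \<Longrightarrow> p / (s - r) \<le> spd a \<theta>"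
    using spd_large[of s "p / (s - r)"] by blast
  obtain a2 where a2: "a2 < 0" "\<And>a \<theta>. a \<le> a2 \<Longrightarrow> 0 \<le> \<theta> \<Longrightarrow> \<theta> \<le> s \<Longrightarrow> spd a \<theta> \<le> p / (s - r)"
    using spd_small[of s "p / (s - r)"] by blast
  have "p / (s - r) * (s - r) \<le> Phi a1 s - Phi a1 r" by (rule Phi_incr_ge) (use assms a1 in auto)
  moreover have "Phi a2 s - Phi a2 r \<le> p / (s - r) * (s - r)" by (rule Phi_incr_upper) (use assms a2 in auto)
  ultimately have "\<exists>a\<ge>a2. a \<le> a1 \<and> Phi a s - Phi a r = p"
    using assms a1(1) a2(1)
    by (intro IVT' continuous_intros continuous_on_subset[OF Phi_cont_param]) auto
  then show ?thesis using that by blast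
qed

text \<open>\<open>spd a \<theta>\<close> is the slope at \<open>a\<close> of the convex function
  \<open>\<lambda>c. eng c \<theta>\<close>; this is its tangent inequality at
  \<open>a\<close>.\<close>

lemma pointwise_duality: "c * spd a \<theta> - eng c \<theta> \<le> a * spd a \<theta> - eng a \<theta>"
  and pointwise_duality_less: "c \<noteq> a \<Longrightarrow> c * spd a \<theta> - eng c \<theta> < a * spd a \<theta> - eng a \<theta>"
proof -
  let ?e = "exp (b \<theta>)"
  have eq: "k * spd a \<theta> - eng k \<theta> = exp (- b \<theta>) * (g (a * ?e) * (k * ?e) - f (k * ?e))" for k
    by (simp add: spd_def eng_def exp_minus field_simps)
  have "g (a * ?e) * (c * ?e) - f (c * ?e) \<le> g (a * ?e) * (a * ?e) - f (a * ?e)"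
    using tangent_le[of "a * ?e" "c * ?e"] by (simp add: algebra_simps)
  then show "c * spd a \<theta> - eng c \<theta> \<le> a * spd a \<theta> - eng a \<theta>" unfolding eq by simp
  assume "c \<noteq> a"
  then have "g (a * ?e) * (c * ?e) - f (c * ?e) < g (a * ?e) * (a * ?e) - f (a * ?e)"
    using tangent_less[of "a * ?e" "c * ?e"] by (simp add: algebra_simps)
  then show "c * spd a \<theta> - eng c \<theta> < a * spd a \<theta> - eng a \<theta>" unfolding eq by simp
qed

lemma lin_cont: "continuous_on UNIV (\<lambda>\<theta>. c * spd a \<theta> - eng d \<theta>)"
  by (intro continuous_intros spd_cont eng_cont)

text \<open>For a fixed displacement, every test parameter \<open>c\<close> bounds the cost of the
  h-curve from below, and c = a attains it.\<close>

lemma duality: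
  assumes "0 \<le> r" "r \<le> s"
  shows "c * (Phi a s - Phi a r) - (F c s - F c r) \<le> cost a r s"
  using prim_le[OF lin_cont lin_cont assms pointwise_duality, of c a] assms
  by (simp add: prim_linear[OF spd_cont eng_cont] cost_def algebra_simps)

lemma duality_less:
  assumes "0 \<le> r" "r < s" "c \<noteq> a"
  shows "c * (Phi a s - Phi a r) - (F c s - F c r) < cost a r s"
  using prim_less[OF lin_cont lin_cont assms(1,2) pointwise_duality_less[OF assms(3)]] assms
  by (simp add: prim_linear[OF spd_cont eng_cont] cost_def algebra_simps)

lemma cost_split: "cost a r q + cost a q s = cost a r s"
  by (simp add: cost_def algebra_simps)

lemmas spd_bounded = continuous_bounded_on_rectangle[OF spd_cont2]

lemma F_lipschitz:
  obtains C where "0 < C"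
    "\<forall>c r s. \<bar>c\<bar> \<le> K \<longrightarrow> 0 \<le> r \<longrightarrow> r \<le> s \<longrightarrow> s \<le> T \<longrightarrow> \<bar>F c s - F c r\<bar> \<le> C * (s - r)"
proof -
  obtain C where C: "0 < C" "\<forall>c \<theta>. \<bar>c\<bar> \<le> K \<longrightarrow> 0 \<le> \<theta> \<longrightarrow> \<theta> \<le> T \<longrightarrow> \<bar>eng c \<theta>\<bar> \<le> C"
    by (rule continuous_bounded_on_rectangle[OF eng_cont2])
  have "\<bar>F c s - F c r\<bar> \<le> C * (s - r)" if rs: "\<bar>c\<bar> \<le> K" "0 \<le> r" "r \<le> s" "s \<le> T" for c r s
  proof -
    have 1: "eng c \<theta> \<le> C" "- C \<le> eng c \<theta>" if "r \<le> \<theta>" "\<theta> \<le> s" for \<theta>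
      using C(2)[rule_format, of c \<theta>] that rs by (auto simp: abs_le_iff)
    have "F c s - F c r \<le> prim (\<lambda>_. C) s - prim (\<lambda>_. C) r"
      "prim (\<lambda>_. - C) s - prim (\<lambda>_. - C) r \<le> F c s - F c r"
      using rs by (auto intro!: prim_le eng_cont 1)
    then show ?thesis using rs by (simp add: prim_const abs_le_iff algebra_simps)
  qed
  then show ?thesis using that[of C] C(1) by blast
qed

lemma F_lipschitz_fixed:
  obtains C where "0 \<le> C" "\<forall>r s. 0 \<le> r \<longrightarrow> r \<le> s \<longrightarrow> s \<le> T \<longrightarrow> \<bar>F c s - F c r\<bar> \<le> C * (s - r)"
  using F_lipschitz[of "\<bar>c\<bar>" T] by (metis less_imp_le order_refl)

text \<open>Inverse continuity of the displacement: for the fixed parameters a + e/2 and a - e/2 the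
  displacements have limits strictly on either side, and monotonicity in the parameter traps
  \<open>c n\<close> between them.\<close>

lemma Phi_incr_converges:
  assumes conv: "(\<lambda>n. Phi (c n) (s n) - Phi (c n) (r n)) \<longlonglongrightarrow> Phi a s0 - Phi a r0"
    and s: "s \<longlonglongrightarrow> s0" and r: "r \<longlonglongrightarrow> r0" and pos: "\<And>n. 0 \<le> r n" "\<And>n. r n \<le> s n" and 0: "0 \<le> r0" "r0 < s0"
  shows "c \<longlonglongrightarrow> a"
proof (rule LIMSEQ_I)
  fix e :: real assume e: "0 < e"
  have lim: "(\<lambda>n. Phi k (s n) - Phi k (r n)) \<longlonglongrightarrow> Phi k s0 - Phi k r0" for k
    using pos order_trans[OF pos(1) pos(2)] 0 by (intro tendsto_diff Phi_tendsto tendsto_const s r) auto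
  have l1: "(\<lambda>n. (Phi (c n) (s n) - Phi (c n) (r n)) - (Phi (a + e/2) (s n) - Phi (a + e/2) (r n)))
      \<longlonglongrightarrow> (Phi a s0 - Phi a r0) - (Phi (a + e/2) s0 - Phi (a + e/2) r0)" by (intro tendsto_diff conv lim)
  have l2: "(\<lambda>n. (Phi (c n) (s n) - Phi (c n) (r n)) - (Phi (a - e/2) (s n) - Phi (a - e/2) (r n)))
      \<longlonglongrightarrow> (Phi a s0 - Phi a r0) - (Phi (a - e/2) s0 - Phi (a - e/2) r0)" by (intro tendsto_diff conv lim)
  have "eventually (\<lambda>n. (Phi (c n) (s n) - Phi (c n) (r n)) - (Phi (a + e/2) (s n) - Phi (a + e/2) (r n)) < 0) sequentially"
    by (rule order_tendstoD[OF l1]) (use Phi_incr_less[OF 0, of a "a + e/2"] e in auto)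
  moreover have "eventually (\<lambda>n. 0 < (Phi (c n) (s n) - Phi (c n) (r n)) - (Phi (a - e/2) (s n) - Phi (a - e/2) (r n))) sequentially"
    by (rule order_tendstoD[OF l2]) (use Phi_incr_less[OF 0, of "a - e/2" a] e in auto)
  ultimately have "eventually (\<lambda>n. norm (c n - a) < e) sequentially"
  proof eventually_elim
    case (elim n)
    have "c n < a + e/2" using elim(1) Phi_incr_le[OF pos(1)[of n] pos(2)[of n], of "a + e/2" "c n"] by (cases "c n < a + e/2") auto
    moreover have "a - e/2 < c n" using elim(2) Phi_incr_le[OF pos(1)[of n] pos(2)[of n], of "c n" "a - e/2"] by (cases "a - e/2 < c n") auto
    ultimately show ?case using e by auto
  qed
  then show "\<exists>no. \<forall>n\<ge>no. norm (c n - a) < e" by (simp add: eventually_sequentially)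
qed

subsection \<open>The value function\<close>

text \<open>The two integrals of \<open>J\<close> as one integrand, which makes the cost additive in
  time.\<close>

definition run :: "(real \<Rightarrow> real) \<Rightarrow> real \<Rightarrow> real" where
  "run \<gamma> \<theta> = (if \<gamma> \<theta> = 0 then - f (ub_bar f ub \<theta>) else conjugate f (deriv \<gamma> \<theta>)) * exp (- b \<theta>)"

lemma ub_bar_bounded:
  obtains C where "0 \<le> C" "AE \<theta> in lebesgue. 0 \<le> \<theta> \<longrightarrow> \<bar>f (ub_bar f ub \<theta>)\<bar> \<le> C"
proof -
  obtain M k where "k \<in> borel_measurable lebesgue" and k: "\<forall>t. \<bar>k t\<bar> \<le> M" "AE t in lebesgue. 0 \<le> t \<longrightarrow> ub t = k t"
    by (rule BV_measurable_bounded[OF ub])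
  let ?I = "{- M..max M (sign_change f)}"
  have "compact (f ` ?I)" by (rule compact_continuous_image) (auto intro: continuous_on_subset[OF f_cont])
  then obtain B where B: "\<And>v. v \<in> ?I \<Longrightarrow> \<bar>f v\<bar> \<le> B" using compact_imp_bounded by (force simp: bounded_iff)
  have "AE \<theta> in lebesgue. 0 \<le> \<theta> \<longrightarrow> \<bar>f (ub_bar f ub \<theta>)\<bar> \<le> \<bar>B\<bar>"
    using k(2)
  proof eventually_elim
    case (elim t)
    show ?case
    proof
      assume "0 \<le> t"
      then have "ub_bar f ub t \<in> ?I" using elim k(1)[rule_format, of t] by (auto simp: ub_bar_def)
      then show "\<bar>f (ub_bar f ub t)\<bar> \<le> \<bar>B\<bar>" using B by fastforce
    qed
  qed
  then show ?thesis using that[of "\<bar>B\<bar>"] by simp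
qed

text \<open>Neither \<open>deriv \<gamma>\<close> nor \<open>ub\<close> need be measurable as given.
  \<open>\<psi>\<close> replaces them by the Borel derivative and the BV representative and agrees
  with \<open>run\<close> almost everywhere on {r..s}.\<close>

lemma run_abs_int:
  assumes lip: "L-lipschitz_on {r..s} \<gamma>" and r: "0 \<le> r"
  shows "run \<gamma> absolutely_integrable_on {r..s}"
proof -
  obtain \<phi> where \<phi>[measurable]: "\<phi> \<in> borel_measurable borel" and \<phi>L': "\<forall>x. \<bar>\<phi> x\<bar> \<le> L"
    and \<phi>d: "AE x in lebesgue. x \<in> {r<..<s} \<longrightarrow> (\<gamma> has_real_derivative \<phi> x) (at x)"
    and \<phi>I': "\<forall>t t'. r \<le> t \<longrightarrow> t \<le> t' \<longrightarrow> t' \<le> s \<longrightarrow> (LINT x:{t..t'}|lebesgue. \<phi> x) = \<gamma> t' - \<gamma> t"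
    by (rule lipschitz_AE_derivative[OF lip])
  note \<phi>L = \<phi>L'[rule_format]
  obtain M k where k: "k \<in> borel_measurable lebesgue" "\<forall>t. \<bar>k t\<bar> \<le> M" "AE t in lebesgue. 0 \<le> t \<longrightarrow> ub t = k t"
    by (rule BV_measurable_bounded[OF ub])
  obtain E where E: "1 \<le> E" "\<And>\<theta>. 0 \<le> \<theta> \<Longrightarrow> \<theta> \<le> s \<Longrightarrow> exp (b \<theta>) \<le> E \<and> exp (- b \<theta>) \<le> E"
    using exp_b_bound[of s] by blast
  obtain C where C: "0 \<le> C" "AE \<theta> in lebesgue. 0 \<le> \<theta> \<longrightarrow> \<bar>f (ub_bar f ub \<theta>)\<bar> \<le> C"
    using ub_bar_bounded by blast
  have "compact (conjugate f ` {-L..L})"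
    by (rule compact_continuous_image) (auto intro: continuous_on_subset[OF conjugate_cont])
  then obtain B where B: "\<And>v. v \<in> {-L..L} \<Longrightarrow> \<bar>conjugate f v\<bar> \<le> B"
    using compact_imp_bounded by (force simp: bounded_iff)
  have "\<phi> 0 \<in> {-L..L}" using \<phi>L[of 0] by (auto simp: abs_le_iff)
  from B[OF this] have B0: "0 \<le> B" by linarith
  have [measurable]: "conjugate f \<in> borel_measurable borel" "f \<in> borel_measurable borel"
    by (auto intro: borel_measurable_continuous_onI conjugate_cont f_cont)
  have gm: "(\<lambda>x. indicator {r..s} x * \<gamma> x) \<in> borel_measurable lebesgue"
    using borel_measurable_continuous_on_indicator[OF _ lipschitz_on_continuous_on[OF lip]]
    by (simp add: measurable_completion)
  note [measurable] = k(1) gm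
  have m1: "(\<lambda>x. conjugate f (\<phi> x) * exp (- b x)) \<in> borel_measurable lebesgue"
    by (rule measurable_completion) measurable
  have m2: "(\<lambda>x. exp (- b x)) \<in> borel_measurable lebesgue"
    by (rule measurable_completion) measurable
  note [measurable] = m1 m2
  define \<psi> where "\<psi> x = (if indicator {r..s} x * \<gamma> x = 0 then - f (max (k x) (sign_change f)) * exp (- b x)
      else conjugate f (\<phi> x) * exp (- b x))" for x
  have "\<psi> \<in> borel_measurable lebesgue" unfolding \<psi>_def by measurable
  then have "(\<lambda>x. indicator {r..s} x * \<psi> x) \<in> borel_measurable lebesgue"
    by (intro borel_measurable_times borel_measurable_indicator) auto
  moreover have "AE x in lebesgue. indicator {r..s} x * \<psi> x = indicator {r..s} x * run \<gamma> x"
    using \<phi>d k(3) LINT_ends_AE[of r s]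
  proof eventually_elim
    case (elim x)
    show ?case
    proof (cases "x \<in> {r..s}")
      case True
      then have "(\<gamma> has_real_derivative \<phi> x) (at x)" "ub x = k x" using elim r by auto
      then show ?thesis using True by (auto simp: \<psi>_def run_def ub_bar_def DERIV_imp_deriv)
    qed auto
  qed
  ultimately have 1: "(\<lambda>x. indicator {r..s} x * run \<gamma> x) \<in> borel_measurable lebesgue"
    by (rule borel_measurable_AE)
  have 2: "AE x in lebesgue. x \<in> {r..s} \<longrightarrow> \<bar>run \<gamma> x\<bar> \<le> max B C * E"
    using \<phi>d C(2) LINT_ends_AE[of r s]
  proof eventually_elim
    case (elim x)
    show ?case
    proof
      assume x: "x \<in> {r..s}"
      then have "(\<gamma> has_real_derivative \<phi> x) (at x)" using elim by auto
      then have d: "deriv \<gamma> x = \<phi> x" by (rule DERIV_imp_deriv)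
      have "\<bar>if \<gamma> x = 0 then - f (ub_bar f ub x) else conjugate f (deriv \<gamma> x)\<bar> \<le> max B C"
        unfolding d using B[of "\<phi> x"] \<phi>L[of x] elim x r by (auto simp: abs_le_iff max.coboundedI1 max.coboundedI2)
      then show "\<bar>run \<gamma> x\<bar> \<le> max B C * E"
        unfolding run_def abs_mult using E(2)[of x] x r B0 by (intro mult_mono) auto
    qed
  qed
  show ?thesis by (rule abs_int_bounded[OF 1 2])
qed

text \<open>The choice v = 0 in the supremum shows that the conjugate is at least - f 0 whatever the
  speed, and the boundary cost is bounded. The last bound is the price of waiting on the
  boundary.\<close>

lemma run_bound_below:
  obtains C where "0 \<le> C" "\<forall>\<gamma>. AE \<theta> in lebesgue. 0 \<le> \<theta> \<longrightarrow> \<theta> \<le> T \<longrightarrow> - C \<le> run \<gamma> \<theta>"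
    "AE \<theta> in lebesgue. 0 \<le> \<theta> \<longrightarrow> \<theta> \<le> T \<longrightarrow> run (\<lambda>_. 0) \<theta> \<le> C"
proof -
  obtain E where E: "1 \<le> E" "\<And>\<theta>. 0 \<le> \<theta> \<Longrightarrow> \<theta> \<le> T \<Longrightarrow> exp (b \<theta>) \<le> E \<and> exp (- b \<theta>) \<le> E"
    using exp_b_bound[of T] by blast
  obtain C where C: "0 \<le> C" "AE \<theta> in lebesgue. 0 \<le> \<theta> \<longrightarrow> \<bar>f (ub_bar f ub \<theta>)\<bar> \<le> C"
    using ub_bar_bounded by blast
  let ?D = "(C + \<bar>f 0\<bar>) * E"
  have low: "- ?D \<le> run \<gamma> \<theta>" if "0 \<le> \<theta>" "\<theta> \<le> T" "\<bar>f (ub_bar f ub \<theta>)\<bar> \<le> C" for \<gamma> \<theta>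
  proof -
    have "(C + \<bar>f 0\<bar>) * exp (- b \<theta>) \<le> ?D" using E(2)[OF that(1,2)] C(1) by (intro mult_left_mono) auto
    moreover have "- (C + \<bar>f 0\<bar>) * exp (- b \<theta>) \<le> run \<gamma> \<theta>"
      unfolding run_def using conjugate_ge[of "deriv \<gamma> \<theta>" 0] that C(1) by (intro mult_right_mono) auto
    ultimately show ?thesis unfolding mult_minus_left by linarith
  qed
  have up: "run (\<lambda>_. 0) \<theta> \<le> ?D" if "0 \<le> \<theta>" "\<theta> \<le> T" "\<bar>f (ub_bar f ub \<theta>)\<bar> \<le> C" for \<theta>
    unfolding run_def using that C(1) E(2)[OF that(1,2)] by (intro mult_mono) auto
  show ?thesis
  proof (rule that[of ?D])
    show "0 \<le> ?D" using C E by simp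
    show "\<forall>\<gamma>. AE \<theta> in lebesgue. 0 \<le> \<theta> \<longrightarrow> \<theta> \<le> T \<longrightarrow> - ?D \<le> run \<gamma> \<theta>"
      by (rule allI, use C(2) in eventually_elim) (use low in blast)
    show "AE \<theta> in lebesgue. 0 \<le> \<theta> \<longrightarrow> \<theta> \<le> T \<longrightarrow> run (\<lambda>_. 0) \<theta> \<le> ?D"
      using C(2) by eventually_elim (use up in blast)
  qed
qed

text \<open>\<open>deriv\<close> looks at a neighbourhood, so paths that agree on {r..s} have equal
  \<open>run\<close> only in the interior; the end points are a null set. This is what permits the
  concatenation of paths.\<close>

lemma run_cong:
  assumes "\<And>\<theta>. r \<le> \<theta> \<Longrightarrow> \<theta> \<le> s \<Longrightarrow> \<gamma> \<theta> = \<eta> \<theta>"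
  shows "(LINT \<theta>:{r..s}|lebesgue. run \<gamma> \<theta>) = (LINT \<theta>:{r..s}|lebesgue. run \<eta> \<theta>)"
proof -
  have eq: "run \<gamma> \<theta> = run \<eta> \<theta>" if "r < \<theta>" "\<theta> < s" for \<theta>
  proof -
    have "eventually (\<lambda>x. x \<in> {r<..<s}) (nhds \<theta>)" using that by (intro eventually_nhds_in_open) auto
    then have "eventually (\<lambda>x. \<gamma> x = \<eta> x) (nhds \<theta>)" by eventually_elim (auto intro: assms)
    then show ?thesis using assms[of \<theta>] that by (auto simp: run_def cong: deriv_cong_ev)
  qed
  have *: "(LINT \<theta>:{r..s}|lebesgue. k \<theta>) = (LINT \<theta>:{r<..<s}|lebesgue. k \<theta>)" for k :: "real \<Rightarrow> real"
    by (rule set_integral_discrete_difference[of "{r, s}"])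
      (auto simp: emeasure_lborel_countable)
  show ?thesis
    unfolding * by (rule set_lebesgue_integral_cong) (use eq in auto)
qed

text \<open>Young's inequality with v = c * exp (b \<theta>), chosen so that the weight exp (- b
  \<theta>) cancels and the speed integrates to the displacement. At contact times the cost is a
  different one, hence \<open>nz\<close>.\<close>

lemma run_fenchel:
  assumes lip: "L-lipschitz_on {r..s} \<gamma>" and r: "0 \<le> r" "r \<le> s"
    and nz: "\<And>\<theta>. r < \<theta> \<Longrightarrow> \<theta> < s \<Longrightarrow> \<gamma> \<theta> \<noteq> 0"
  shows "c * (\<gamma> s - \<gamma> r) - (F c s - F c r) \<le> (LINT \<theta>:{r..s}|lebesgue. run \<gamma> \<theta>)"
proof -
  obtain \<phi> where \<phi>[measurable]: "\<phi> \<in> borel_measurable borel" and \<phi>L': "\<forall>x. \<bar>\<phi> x\<bar> \<le> L"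
    and \<phi>d: "AE x in lebesgue. x \<in> {r<..<s} \<longrightarrow> (\<gamma> has_real_derivative \<phi> x) (at x)"
    and \<phi>I': "\<forall>t t'. r \<le> t \<longrightarrow> t \<le> t' \<longrightarrow> t' \<le> s \<longrightarrow> (LINT x:{t..t'}|lebesgue. \<phi> x) = \<gamma> t' - \<gamma> t"
    by (rule lipschitz_AE_derivative[OF lip])
  note \<phi>L = \<phi>L'[rule_format]
  note \<phi>I = \<phi>I'[rule_format]
  have \<phi>i: "\<phi> absolutely_integrable_on {r..s}"
  proof (rule abs_int_bounded)
    show "(\<lambda>x. indicator {r..s} x * \<phi> x) \<in> borel_measurable lebesgue"
      by (rule measurable_completion) measurable
  qed (use \<phi>L in auto)
  have ei: "eng c absolutely_integrable_on {r..s}" by (rule abs_int_continuous[OF eng_cont])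
  have li: "(\<lambda>\<theta>. c * \<phi> \<theta> - eng c \<theta>) absolutely_integrable_on {r..s}"
    by (intro set_integral_diff set_integrable_mult_right \<phi>i ei)
  have "c * (\<gamma> s - \<gamma> r) - (F c s - F c r) = (LINT \<theta>:{r..s}|lebesgue. c * \<phi> \<theta> - eng c \<theta>)"
    using \<phi>I[of r s] prim_diff[OF eng_cont r, of c] r \<phi>i ei
    by (subst set_integral_diff) auto
  also have "\<dots> \<le> (LINT \<theta>:{r..s}|lebesgue. run \<gamma> \<theta>)"
  proof (rule set_integral_mono_AE[OF li run_abs_int[OF lip r(1)]])
    show "AE \<theta>\<in>{r..s} in lebesgue. c * \<phi> \<theta> - eng c \<theta> \<le> run \<gamma> \<theta>"
      using \<phi>d LINT_ends_AE[of r s]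
    proof eventually_elim
      case (elim \<theta>)
      show ?case
      proof
        assume "\<theta> \<in> {r..s}"
        then have \<theta>: "r < \<theta>" "\<theta> < s" using elim by auto
        then have "deriv \<gamma> \<theta> = \<phi> \<theta>" using elim by (auto intro: DERIV_imp_deriv)
        then have "run \<gamma> \<theta> = conjugate f (\<phi> \<theta>) * exp (- b \<theta>)" using nz[OF \<theta>] by (simp add: run_def)
        also have "\<dots> \<ge> (\<phi> \<theta> * (c * exp (b \<theta>)) - f (c * exp (b \<theta>))) * exp (- b \<theta>)"
          by (intro mult_right_mono conjugate_ge) auto
        also have "(\<phi> \<theta> * (c * exp (b \<theta>)) - f (c * exp (b \<theta>))) * exp (- b \<theta>) = c * \<phi> \<theta> - eng c \<theta>"
          by (simp add: eng_def algebra_simps exp_minus_inverse flip: exp_add)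
        finally show "c * \<phi> \<theta> - eng c \<theta> \<le> run \<gamma> \<theta>" .
      qed
    qed
  qed
  finally show ?thesis .
qed

text \<open>Off the boundary Young's inequality is an equality. At an interior contact time the
  curve has a minimum, so its speed is 0, and the boundary cost is at most
  \<open>conjugate f 0\<close>.\<close>

lemma run_h_curve:
  assumes r: "0 \<le> r" "r \<le> s"
    and \<gamma>: "\<And>\<theta>. r \<le> \<theta> \<Longrightarrow> \<theta> \<le> s \<Longrightarrow> \<gamma> \<theta> = q + Phi a \<theta>"
    and nn: "\<And>\<theta>. r \<le> \<theta> \<Longrightarrow> \<theta> \<le> s \<Longrightarrow> 0 \<le> \<gamma> \<theta>"
  shows "(LINT \<theta>:{r..s}|lebesgue. run \<gamma> \<theta>) \<le> cost a r s"
proof -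
  let ?\<eta> = "\<lambda>\<theta>. q + Phi a \<theta>"
  obtain L where "L-lipschitz_on {r..s} (Phi a)" using Phi_lipschitz[OF r(1)] by blast
  then have lip: "L-lipschitz_on {r..s} ?\<eta>" by (auto simp: lipschitz_on_def)
  have "(LINT \<theta>:{r..s}|lebesgue. run \<gamma> \<theta>) = (LINT \<theta>:{r..s}|lebesgue. run ?\<eta> \<theta>)"
    by (rule run_cong[OF \<gamma>])
  also have "\<dots> \<le> (LINT \<theta>:{r..s}|lebesgue. a * spd a \<theta> - eng a \<theta>)"
  proof (rule set_integral_mono_AE[OF run_abs_int[OF lip r(1)] abs_int_continuous[OF lin_cont]])
    show "AE \<theta>\<in>{r..s} in lebesgue. run ?\<eta> \<theta> \<le> a * spd a \<theta> - eng a \<theta>"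
      using LINT_ends_AE[of r s]
    proof eventually_elim
      case (elim \<theta>)
      show ?case
      proof
        assume "\<theta> \<in> {r..s}"
        then have \<theta>: "r < \<theta>" "\<theta> < s" using elim by auto
        have D: "(?\<eta> has_real_derivative spd a \<theta>) (at \<theta>)"
          using Phi_has_derivative[of \<theta> a] \<theta> r by (auto intro!: derivative_eq_intros)
        have eq: "conjugate f (spd a \<theta>) * exp (- b \<theta>) = a * spd a \<theta> - eng a \<theta>"
          by (simp add: spd_def eng_def conjugate_eq algebra_simps exp_minus_inverse flip: exp_add)
        show "run ?\<eta> \<theta> \<le> a * spd a \<theta> - eng a \<theta>"
        proof (cases "?\<eta> \<theta> = 0")
          case False
          then show ?thesis using DERIV_imp_deriv[OF D] eq by (simp add: run_def)
        next
          case True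
          have "spd a \<theta> = 0"
          proof (rule DERIV_local_min[OF D])
            show "0 < min (\<theta> - r) (s - \<theta>)" using \<theta> by simp
            show "\<forall>y. \<bar>\<theta> - y\<bar> < min (\<theta> - r) (s - \<theta>) \<longrightarrow> ?\<eta> \<theta> \<le> ?\<eta> y"
            proof (intro allI impI)
              fix y assume "\<bar>\<theta> - y\<bar> < min (\<theta> - r) (s - \<theta>)"
              then have "r \<le> y" "y \<le> s" by auto
              then show "?\<eta> \<theta> \<le> ?\<eta> y" using nn[of y] \<gamma>[of y] True by simp
            qed
          qed
          have "run ?\<eta> \<theta> = - f (ub_bar f ub \<theta>) * exp (- b \<theta>)" using True by (simp add: run_def)
          also have "\<dots> \<le> conjugate f (spd a \<theta>) * exp (- b \<theta>)"
            using conjugate_ge[of 0 "ub_bar f ub \<theta>"] \<open>spd a \<theta> = 0\<close> by (intro mult_right_mono) auto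
          finally show ?thesis using eq by simp
        qed
      qed
    qed
  qed
  also have "\<dots> = cost a r s"
    using r by (subst prim_diff[OF lin_cont r]) (simp add: prim_linear[OF spd_cont eng_cont] cost_def algebra_simps)
  finally show ?thesis .
qed

lemma J_eq:
  assumes "\<gamma> \<in> Gamma x t" "0 \<le> t"
  shows "J f \<alpha> u0 ub \<gamma> t = (LINT \<theta>:{0..t}|lebesgue. run \<gamma> \<theta>) + U0 (\<gamma> 0)"
proof -
  obtain L where lip: "L-lipschitz_on {0..t} \<gamma>" using assms by (auto simp: Gamma_def)
  let ?S = "{\<theta> \<in> {0..t}. \<gamma> \<theta> \<noteq> 0}" and ?R = "{\<theta> \<in> {0..t}. \<gamma> \<theta> = 0}"
  have R: "?R \<in> sets lebesgue"
    using continuous_closed_preimage_constant[OF lipschitz_on_continuous_on[OF lip], of 0] by simp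
  then have "{0..t} - ?R \<in> sets lebesgue" by auto
  moreover have "{0..t} - ?R = ?S" by auto
  ultimately have S: "?S \<in> sets lebesgue" by simp
  have int: "run \<gamma> absolutely_integrable_on {0..t}" by (rule run_abs_int[OF lip]) simp
  have "(LINT \<theta>:{0..t}|lebesgue. run \<gamma> \<theta>) = (LINT \<theta>:?S \<union> ?R|lebesgue. run \<gamma> \<theta>)"
    by (rule arg_cong[where f = "\<lambda>A. set_lebesgue_integral lebesgue A (run \<gamma>)"]) auto
  also have "\<dots> = (LINT \<theta>:?S|lebesgue. run \<gamma> \<theta>) + (LINT \<theta>:?R|lebesgue. run \<gamma> \<theta>)"
    by (rule set_integral_Un) (use R S in \<open>auto intro: set_integrable_subset[OF int]\<close>)
  also have "(LINT \<theta>:?S|lebesgue. run \<gamma> \<theta>) = (LINT \<theta>:?S|lebesgue. conjugate f (deriv \<gamma> \<theta>) * exp (- b \<theta>))"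
    by (rule set_lebesgue_integral_cong) (use S in \<open>auto simp: run_def\<close>)
  also have "(LINT \<theta>:?R|lebesgue. run \<gamma> \<theta>) = (LINT \<theta>:?R|lebesgue. - (f (ub_bar f ub \<theta>) * exp (- b \<theta>)))"
    by (rule set_lebesgue_integral_cong) (use R in \<open>auto simp: run_def\<close>)
  also have "\<dots> = - (LINT \<theta>:?R|lebesgue. f (ub_bar f ub \<theta>) * exp (- b \<theta>))"
    by (simp add: set_lebesgue_integral_def)
  finally show ?thesis by (simp add: J_def prim_def)
qed

section \<open>Bounds, dynamic programming and boundary continuity of the value function\<close>

abbreviation V :: "real \<Rightarrow> real \<Rightarrow> real" where "V \<equiv> W f \<alpha> u0 ub"
abbreviation JJ :: "(real \<Rightarrow> real) \<Rightarrow> real \<Rightarrow> real" where "JJ \<equiv> J f \<alpha> u0 ub"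

lemma Gamma_restrict:
  assumes "\<gamma> \<in> Gamma x t" "0 \<le> s" "s \<le> t"
  shows "\<gamma> \<in> Gamma (\<gamma> s) s" "JJ \<gamma> t = JJ \<gamma> s + (LINT \<theta>:{s..t}|lebesgue. run \<gamma> \<theta>)"
    "\<exists>L. L-lipschitz_on {s..t} \<gamma>"
proof -
  obtain L where lip: "L-lipschitz_on {0..t} \<gamma>" using assms by (auto simp: Gamma_def)
  have "L-lipschitz_on {0..s} \<gamma>" "L-lipschitz_on {s..t} \<gamma>"
    using assms by (auto intro: lipschitz_on_subset[OF lip])
  then show G: "\<gamma> \<in> Gamma (\<gamma> s) s" "\<exists>L. L-lipschitz_on {s..t} \<gamma>" using assms by (auto simp: Gamma_def)
  show "JJ \<gamma> t = JJ \<gamma> s + (LINT \<theta>:{s..t}|lebesgue. run \<gamma> \<theta>)"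
    using LINT_combine[OF run_abs_int[OF lip order_refl] assms(2,3)] assms
    by (simp add: J_eq[OF assms(1)] J_eq[OF G(1)])
qed

lemma U0_lipschitz:
  obtains M where "0 \<le> M" "\<And>x y. 0 \<le> x \<Longrightarrow> 0 \<le> y \<Longrightarrow> \<bar>U0 x - U0 y\<bar> \<le> M * \<bar>x - y\<bar>"
  using L_infinity_prim_lipschitz[OF u0] by blast

lemma run_int_ge:
  assumes C: "\<forall>\<gamma>. AE \<theta> in lebesgue. 0 \<le> \<theta> \<longrightarrow> \<theta> \<le> T \<longrightarrow> - C \<le> run \<gamma> \<theta>"
    and lip: "L-lipschitz_on {r..s} \<gamma>" and "0 \<le> r" "r \<le> s" "s \<le> T"
  shows "- C * (s - r) \<le> (LINT \<theta>:{r..s}|lebesgue. run \<gamma> \<theta>)"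
proof -
  have "AE \<theta> in lebesgue. \<theta> \<in> {r..s} \<longrightarrow> - C \<le> run \<gamma> \<theta>"
    using C[rule_format, of \<gamma>] by eventually_elim (use assms(3-) in auto)
  then have "(LINT \<theta>:{r..s}|lebesgue. - C) \<le> (LINT \<theta>:{r..s}|lebesgue. run \<gamma> \<theta>)"
    using assms(3) by (intro set_integral_mono_AE[OF abs_int_continuous run_abs_int[OF lip]]) auto
  then show ?thesis using assms(3,4) by (simp add: prim_diff prim_const algebra_simps)
qed

text \<open>Up to the first contact, Young's inequality with c = - M contributes M * \<gamma> 0,
  which absorbs the loss in U0 (\<gamma> 0) \<ge> - M * \<gamma> 0 for arbitrarily distant starting
  points. Afterwards the running cost is bounded below.\<close>

lemma J_bound_below:
  assumes "0 \<le> T"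
  obtains M C where "0 \<le> M" "0 \<le> C"
    "\<forall>\<gamma> x t. 0 \<le> t \<longrightarrow> t \<le> T \<longrightarrow> \<gamma> \<in> Gamma x t \<longrightarrow> - M * x - C \<le> JJ \<gamma> t"
proof -
  obtain M where M: "0 \<le> M" "\<And>x y. 0 \<le> x \<Longrightarrow> 0 \<le> y \<Longrightarrow> \<bar>U0 x - U0 y\<bar> \<le> M * \<bar>x - y\<bar>"
    using U0_lipschitz by blast
  obtain C1 where C1: "0 \<le> C1" "\<forall>\<gamma>. AE \<theta> in lebesgue. 0 \<le> \<theta> \<longrightarrow> \<theta> \<le> T \<longrightarrow> - C1 \<le> run \<gamma> \<theta>"
    using run_bound_below[of T] by blast
  obtain C2 where C2: "0 \<le> C2" "\<forall>r s. 0 \<le> r \<longrightarrow> r \<le> s \<longrightarrow> s \<le> T \<longrightarrow> \<bar>F (-M) s - F (-M) r\<bar> \<le> C2 * (s - r)"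
    by (rule F_lipschitz_fixed[of T "- M"])
  show ?thesis
  proof (rule that[of M "(C1 + C2) * T"], rule M(1), simp add: C1 C2 assms, intro allI impI)
    fix \<gamma> x t assume t: "0 \<le> t" "t \<le> T" and \<gamma>: "\<gamma> \<in> Gamma x t"
    obtain L where lip: "L-lipschitz_on {0..t} \<gamma>" using \<gamma> by (auto simp: Gamma_def)
    have nn: "\<And>\<theta>. 0 \<le> \<theta> \<Longrightarrow> \<theta> \<le> t \<Longrightarrow> 0 \<le> \<gamma> \<theta>" and \<gamma>t: "\<gamma> t = x" using \<gamma> by (auto simp: Gamma_def)
    obtain \<rho> where \<rho>: "0 \<le> \<rho>" "\<rho> \<le> t" "\<rho> = t \<or> \<gamma> \<rho> = 0" "\<And>\<theta>. 0 \<le> \<theta> \<Longrightarrow> \<theta> < \<rho> \<Longrightarrow> \<gamma> \<theta> \<noteq> 0"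
      using first_zero[OF lipschitz_on_continuous_on[OF lip] t(1)] by blast
    have "JJ \<gamma> t = (LINT \<theta>:{0..\<rho>}|lebesgue. run \<gamma> \<theta>) + (LINT \<theta>:{\<rho>..t}|lebesgue. run \<gamma> \<theta>) + U0 (\<gamma> 0)"
      using LINT_combine[OF run_abs_int[OF lip order_refl] \<rho>(1,2)] by (simp add: J_eq[OF \<gamma> t(1)])
    moreover have "- M * (\<gamma> \<rho> - \<gamma> 0) - (F (-M) \<rho> - F (-M) 0) \<le> (LINT \<theta>:{0..\<rho>}|lebesgue. run \<gamma> \<theta>)"
      by (rule run_fenchel) (use \<rho> in \<open>auto intro: lipschitz_on_subset[OF lip]\<close>)
    moreover have "- C1 * (t - \<rho>) \<le> (LINT \<theta>:{\<rho>..t}|lebesgue. run \<gamma> \<theta>)"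
      by (rule run_int_ge[OF C1(2), where L = L]) (use \<rho> t in \<open>auto intro: lipschitz_on_subset[OF lip]\<close>)
    moreover have "- M * \<gamma> 0 \<le> U0 (\<gamma> 0)" using M(2)[of "\<gamma> 0" 0] nn[of 0] t by auto
    moreover have "F (-M) \<rho> - F (-M) 0 \<le> C2 * \<rho>" using C2(2)[rule_format, of 0 \<rho>] \<rho> t by auto
    moreover have "M * \<gamma> \<rho> \<le> M * x" using \<rho>(3) \<gamma>t nn[of t] t M(1) by (auto intro: mult_left_mono)
    moreover have "C1 * (t - \<rho>) \<le> C1 * T" "C2 * \<rho> \<le> C2 * T"
      using C1 C2 \<rho> t by (auto intro!: mult_left_mono)
    ultimately show "- M * x - (C1 + C2) * T \<le> JJ \<gamma> t" by (simp add: algebra_simps)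
  qed
qed

lemma Gamma_const: "0 \<le> x \<Longrightarrow> (\<lambda>_. x) \<in> Gamma x t"
  by (auto simp: Gamma_def intro!: exI[of _ 0] lipschitz_intros)

lemma V_le: "0 \<le> t \<Longrightarrow> \<gamma> \<in> Gamma x t \<Longrightarrow> V x t \<le> JJ \<gamma> t"
proof -
  assume t: "0 \<le> t" and \<gamma>: "\<gamma> \<in> Gamma x t"
  obtain M C where "0 \<le> M" "0 \<le> C"
    "\<forall>\<gamma> x s. 0 \<le> s \<longrightarrow> s \<le> t \<longrightarrow> \<gamma> \<in> Gamma x s \<longrightarrow> - M * x - C \<le> JJ \<gamma> s"
    by (rule J_bound_below[OF t])
  then have "bdd_below ((\<lambda>\<gamma>. JJ \<gamma> t) ` Gamma x t)" using t by (intro bdd_belowI2[of _ "- M * x - C"]) auto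
  then show ?thesis unfolding W_def by (rule cINF_lower) fact
qed

lemma V_ge:
  assumes "0 \<le> x" and B: "\<And>\<gamma>. \<gamma> \<in> Gamma x t \<Longrightarrow> B \<le> JJ \<gamma> t"
  shows "B \<le> V x t"
  unfolding W_def
proof (rule cINF_greatest)
  show "Gamma x t \<noteq> {}" using Gamma_const[OF assms(1)] by blast
qed (rule B)

lemma V_bound_below:
  assumes "0 \<le> T"
  obtains M C where "0 \<le> M" "0 \<le> C"
    "\<forall>x t. 0 \<le> t \<longrightarrow> t \<le> T \<longrightarrow> 0 \<le> x \<longrightarrow> - M * x - C \<le> V x t"
proof -
  obtain M C where MC: "0 \<le> M" "0 \<le> C"
    "\<forall>\<gamma> x t. 0 \<le> t \<longrightarrow> t \<le> T \<longrightarrow> \<gamma> \<in> Gamma x t \<longrightarrow> - M * x - C \<le> JJ \<gamma> t"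
    by (rule J_bound_below[OF assms])
  show ?thesis
  proof (rule that[OF MC(1,2)])
    have "- M * x - C \<le> V x t" if "0 \<le> t" "t \<le> T" "0 \<le> x" for x t
      by (rule V_ge[OF that(3) MC(3)[rule_format, OF that(1,2)]])
    then show "\<forall>x t. 0 \<le> t \<longrightarrow> t \<le> T \<longrightarrow> 0 \<le> x \<longrightarrow> - M * x - C \<le> V x t" by blast
  qed
qed

lemma V_initial: "0 \<le> x \<Longrightarrow> V x 0 = U0 x"
proof (rule antisym)
  assume x: "0 \<le> x"
  have J0: "JJ \<gamma> 0 = U0 x" if "\<gamma> \<in> Gamma x 0" for \<gamma>
    using that J_eq[OF that] prim_0[of "run \<gamma>"] by (simp add: Gamma_def prim_def)
  show "V x 0 \<le> U0 x" using V_le[OF _ Gamma_const[OF x], of 0] J0[OF Gamma_const[OF x]] by simp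
  show "U0 x \<le> V x 0" by (rule V_ge[OF x]) (simp add: J0)
qed

text \<open>One half of dynamic programming: competitors up to time \<open>s\<close> are prolonged
  by \<eta>.\<close>

lemma V_dp:
  assumes s: "0 \<le> s" "s \<le> t" and lip: "L-lipschitz_on {s..t} \<eta>"
    and nn: "\<And>\<theta>. s \<le> \<theta> \<Longrightarrow> \<theta> \<le> t \<Longrightarrow> 0 \<le> \<eta> \<theta>"
  shows "V (\<eta> t) t \<le> V (\<eta> s) s + (LINT \<theta>:{s..t}|lebesgue. run \<eta> \<theta>)"
proof -
  have "V (\<eta> t) t - (LINT \<theta>:{s..t}|lebesgue. run \<eta> \<theta>) \<le> V (\<eta> s) s"
  proof (rule V_ge)
    show "0 \<le> \<eta> s" using nn s by simp
    fix \<gamma> assume \<gamma>: "\<gamma> \<in> Gamma (\<eta> s) s"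
    obtain K where K: "K-lipschitz_on {0..s} \<gamma>" using \<gamma> by (auto simp: Gamma_def)
    define \<kappa> where "\<kappa> \<theta> = (if \<theta> \<le> s then \<gamma> \<theta> else \<eta> \<theta>)" for \<theta>
    have \<gamma>s: "\<gamma> s = \<eta> s" using \<gamma> by (simp add: Gamma_def)
    have "(max K L)-lipschitz_on {0..t} \<kappa>"
      unfolding \<kappa>_def by (rule lipschitz_on_concat)
        (use \<gamma>s in \<open>auto intro: lipschitz_on_mono[OF K] lipschitz_on_mono[OF lip]\<close>)
    then have \<kappa>: "\<kappa> \<in> Gamma (\<eta> t) t" using \<gamma> \<gamma>s nn s by (auto simp: Gamma_def \<kappa>_def)
    have "(LINT \<theta>:{0..s}|lebesgue. run \<kappa> \<theta>) = (LINT \<theta>:{0..s}|lebesgue. run \<gamma> \<theta>)"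
      by (rule run_cong) (auto simp: \<kappa>_def)
    then have "JJ \<kappa> s = JJ \<gamma> s"
      using J_eq[OF Gamma_restrict(1)[OF \<kappa> s] s(1)] J_eq[OF \<gamma> s(1)] s(1) by (simp add: \<kappa>_def)
    moreover have "(LINT \<theta>:{s..t}|lebesgue. run \<kappa> \<theta>) = (LINT \<theta>:{s..t}|lebesgue. run \<eta> \<theta>)"
      by (rule run_cong) (use \<gamma>s in \<open>auto simp: \<kappa>_def\<close>)
    ultimately have "JJ \<kappa> t = JJ \<gamma> s + (LINT \<theta>:{s..t}|lebesgue. run \<eta> \<theta>)"
      using Gamma_restrict(2)[OF \<kappa> s] by simp
    moreover have "V (\<eta> t) t \<le> JJ \<kappa> t" using V_le[OF _ \<kappa>] s by simp
    ultimately show "V (\<eta> t) t - (LINT \<theta>:{s..t}|lebesgue. run \<eta> \<theta>) \<le> JJ \<gamma> s" by simp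
  qed
  then show ?thesis by simp
qed

lemma V_h_curve:
  assumes s: "0 \<le> s" "s \<le> t" and nn: "\<And>\<theta>. s \<le> \<theta> \<Longrightarrow> \<theta> \<le> t \<Longrightarrow> 0 \<le> Z x t a \<theta>"
  shows "V x t \<le> V (Z x t a s) s + cost a s t"
proof -
  obtain L where lip: "L-lipschitz_on {s..t} (Z x t a)" using Z_lipschitz[OF s(1)] by blast
  have "V (Z x t a t) t \<le> V (Z x t a s) s + (LINT \<theta>:{s..t}|lebesgue. run (Z x t a) \<theta>)"
    by (rule V_dp[OF s lip nn])
  moreover have "(LINT \<theta>:{s..t}|lebesgue. run (Z x t a) \<theta>) \<le> cost a s t"
    by (rule run_h_curve[OF s _ nn, of _ "x - Phi a t"]) (auto simp: Z_def)
  ultimately show ?thesis by (simp add: Z_def)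
qed

lemma Z_apex [simp]: "Z x t a t = x"
  by (simp add: Z_def)

lemma Z_shift: "Z (Z x t a s) s a \<theta> = Z x t a \<theta>"
  by (simp add: Z_def)

lemma Phi_incr_Z: "Phi a t - Phi a \<theta> = x - Z x t a \<theta>"
  by (simp add: Z_def)

text \<open>Waiting at 0 from \<open>r\<close> to \<open>s\<close> is a competitor with bounded
  running cost.\<close>

lemma V_boundary_upper:
  obtains C where "0 \<le> C" "\<forall>r s. 0 \<le> r \<longrightarrow> r \<le> s \<longrightarrow> s \<le> T \<longrightarrow> V 0 s \<le> V 0 r + C * (s - r)"
proof -
  obtain C where C: "0 \<le> C" "\<forall>\<gamma>. AE \<theta> in lebesgue. 0 \<le> \<theta> \<longrightarrow> \<theta> \<le> T \<longrightarrow> - C \<le> run \<gamma> \<theta>"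
    "AE \<theta> in lebesgue. 0 \<le> \<theta> \<longrightarrow> \<theta> \<le> T \<longrightarrow> run (\<lambda>_. 0) \<theta> \<le> C"
    by (rule run_bound_below)
  have lip: "0-lipschitz_on S (\<lambda>_. 0::real)" for S :: "real set" by (intro lipschitz_intros)
  have "V 0 s \<le> V 0 r + C * (s - r)" if rs: "0 \<le> r" "r \<le> s" "s \<le> T" for r s
  proof -
    have ae: "AE \<theta> in lebesgue. \<theta> \<in> {r..s} \<longrightarrow> run (\<lambda>_. 0) \<theta> \<le> C"
      using C(3) by eventually_elim (use rs in auto)
    have "V 0 s \<le> V 0 r + (LINT \<theta>:{r..s}|lebesgue. run (\<lambda>_. 0) \<theta>)"
      using V_dp[OF rs(1,2) lip] by simp
    also have "(LINT \<theta>:{r..s}|lebesgue. run (\<lambda>_. 0) \<theta>) \<le> (LINT \<theta>:{r..s}|lebesgue. C)"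
      by (rule set_integral_mono_AE[OF run_abs_int[OF lip rs(1)] abs_int_continuous]) (use ae in auto)
    also have "(LINT \<theta>:{r..s}|lebesgue. C) = C * (s - r)"
      using rs by (simp add: prim_diff prim_const algebra_simps)
    finally show ?thesis by simp
  qed
  then show ?thesis using that[of C] C(1) by blast
qed

text \<open>A path to \<open>(0, s)\<close> is diverted to \<open>(0, r)\<close> with \<open>r < s\<close> where it last meets a steep \<open>h\<close>-curve
  descending to \<open>(0, r)\<close>; Young's inequality with the parameter of that \<open>h\<close>-curve shows that the
  diversion costs at most a multiple of \<open>s - r\<close>.\<close>

lemma V_boundary_lower:
  assumes T: "0 \<le> T"
  obtains C where "0 \<le> C" "\<forall>r s. 0 \<le> r \<longrightarrow> r \<le> s \<longrightarrow> s \<le> T \<longrightarrow> V 0 r \<le> V 0 s + C * (s - r)"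
proof -
  obtain M where M: "0 \<le> M" "\<And>x y. 0 \<le> x \<Longrightarrow> 0 \<le> y \<Longrightarrow> \<bar>U0 x - U0 y\<bar> \<le> M * \<bar>x - y\<bar>"
    using U0_lipschitz by blast
  obtain a0 where a0: "a0 < 0" "\<And>a \<theta>. a \<le> a0 \<Longrightarrow> 0 \<le> \<theta> \<Longrightarrow> \<theta> \<le> T \<Longrightarrow> spd a \<theta> \<le> 0"
    using spd_small[of T 0] by blast
  \<comment> \<open>c \<le> a0 keeps the descending curve in the quarter plane; c \<le> - M lets the
    parameter absorb the change of initial cost when the path and this curve do not meet.\<close>
  define c where "c = min a0 (- M)"
  have c: "c \<le> - M" "\<And>\<theta>. 0 \<le> \<theta> \<Longrightarrow> \<theta> \<le> T \<Longrightarrow> spd c \<theta> \<le> 0" using a0 by (auto simp: c_def)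
  obtain C1 where C1: "0 \<le> C1" "\<forall>\<gamma>. AE \<theta> in lebesgue. 0 \<le> \<theta> \<longrightarrow> \<theta> \<le> T \<longrightarrow> - C1 \<le> run \<gamma> \<theta>"
    "AE \<theta> in lebesgue. 0 \<le> \<theta> \<longrightarrow> \<theta> \<le> T \<longrightarrow> run (\<lambda>_. 0) \<theta> \<le> C1"
    by (rule run_bound_below)
  obtain C2 where C2: "0 \<le> C2" "\<forall>r s. 0 \<le> r \<longrightarrow> r \<le> s \<longrightarrow> s \<le> T \<longrightarrow> \<bar>F c s - F c r\<bar> \<le> C2 * (s - r)"
    by (rule F_lipschitz_fixed)
  have "V 0 r \<le> V 0 s + (C1 + C2) * (s - r)" if rs: "0 \<le> r" "r \<le> s" "s \<le> T" for r s
  proof -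
    have "V 0 r - (C1 + C2) * (s - r) \<le> V 0 s"
    proof (rule V_ge)
      fix \<gamma> assume \<gamma>: "\<gamma> \<in> Gamma 0 s"
      have s0: "0 \<le> s" using rs by simp
      obtain L where lip: "L-lipschitz_on {0..s} \<gamma>" using \<gamma> by (auto simp: Gamma_def)
      have nn: "\<And>\<theta>. 0 \<le> \<theta> \<Longrightarrow> \<theta> \<le> s \<Longrightarrow> 0 \<le> \<gamma> \<theta>" and \<gamma>s: "\<gamma> s = 0"
        using \<gamma> by (auto simp: Gamma_def)
      have cont: "continuous_on {0..s} \<gamma>" by (rule lipschitz_on_continuous_on[OF lip])
      obtain \<rho> where \<rho>: "r \<le> \<rho>" "\<rho> \<le> s" "\<rho> = s \<or> \<gamma> \<rho> = 0" "\<And>\<theta>. r \<le> \<theta> \<Longrightarrow> \<theta> < \<rho> \<Longrightarrow> \<gamma> \<theta> \<noteq> 0"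
        by (rule first_zero[of r s \<gamma>]) (use rs cont in \<open>auto intro: continuous_on_subset\<close>)
      have \<gamma>\<rho>: "\<gamma> \<rho> = 0" using \<rho>(3) \<gamma>s by auto
      let ?k = "\<lambda>\<theta>. \<gamma> \<theta> - Z 0 r c \<theta>"
      have kc: "continuous_on {0..r} ?k"
        using rs by (intro continuous_intros continuous_on_subset[OF cont] continuous_on_subset[OF Z_cont]) auto
      \<comment> \<open>The last meeting of the path with the steep curve up to time
        \<open>r\<close>, with default 0.\<close>
      obtain q where q: "0 \<le> q" "q \<le> r" "q = 0 \<or> ?k q = 0" "\<And>\<theta>. q < \<theta> \<Longrightarrow> \<theta> \<le> r \<Longrightarrow> ?k \<theta> \<noteq> 0"
        using last_zero[OF kc rs(1)] by blast
      have Znn: "0 \<le> Z 0 r c \<theta>" if "0 \<le> \<theta>" "\<theta> \<le> r" for \<theta>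
        using Phi_incr_upper[of \<theta> r c 0] c(2) that rs by (simp add: Z_def)
      have kpos: "0 < ?k \<theta>" if \<theta>: "0 \<le> \<theta>" "\<theta> \<le> r" "\<And>\<theta>'. \<theta> \<le> \<theta>' \<Longrightarrow> \<theta>' \<le> r \<Longrightarrow> ?k \<theta>' \<noteq> 0" for \<theta>
      proof (rule ccontr)
        assume "\<not> 0 < ?k \<theta>"
        moreover have "0 \<le> ?k r" using nn[of r] rs by simp
        ultimately have "\<exists>\<theta>'\<ge>\<theta>. \<theta>' \<le> r \<and> ?k \<theta>' = 0"
          using \<theta> by (intro IVT' continuous_on_subset[OF kc]) auto
        then show False using \<theta>(3) by blast
      qed
      \<comment> \<open>After \<open>q\<close> the path lies above the steep curve, which is
        nonnegative, and from \<open>r\<close> on its first contact is \<open>\<rho>\<close>. So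
        Young's inequality applies between \<open>q\<close> and \<open>\<rho>\<close>.\<close>
      have nz: "\<gamma> \<theta> \<noteq> 0" if "q < \<theta>" "\<theta> < \<rho>" for \<theta>
      proof (cases "\<theta> \<le> r")
        case True
        then have "0 < ?k \<theta>" using that q by (intro kpos) auto
        then show ?thesis using Znn[of \<theta>] True that q by auto
      qed (use \<rho>(4)[of \<theta>] that in auto)
      have q\<rho>: "q \<le> \<rho>" using q \<rho> by simp
      have J1: "JJ \<gamma> s = JJ \<gamma> \<rho> + (LINT \<theta>:{\<rho>..s}|lebesgue. run \<gamma> \<theta>)"
        by (rule Gamma_restrict(2)[OF \<gamma>]) (use \<rho> rs in auto)
      have J2: "JJ \<gamma> \<rho> = JJ \<gamma> q + (LINT \<theta>:{q..\<rho>}|lebesgue. run \<gamma> \<theta>)"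
        by (rule Gamma_restrict(2)[OF Gamma_restrict(1)[OF \<gamma>]]) (use \<rho> rs q in auto)
      have I1: "- C1 * (s - \<rho>) \<le> (LINT \<theta>:{\<rho>..s}|lebesgue. run \<gamma> \<theta>)"
        by (rule run_int_ge[OF C1(2), where L = L]) (use \<rho> rs in \<open>auto intro: lipschitz_on_subset[OF lip]\<close>)
      have I2: "c * (\<gamma> \<rho> - \<gamma> q) - (F c \<rho> - F c q) \<le> (LINT \<theta>:{q..\<rho>}|lebesgue. run \<gamma> \<theta>)"
        by (rule run_fenchel[where L = L, OF _ _ _ nz]) (use \<rho> q rs in \<open>auto intro: lipschitz_on_subset[OF lip]\<close>)
      have V1: "V 0 r \<le> V (Z 0 r c q) q + cost c q r"
        by (rule V_h_curve) (use q rs Znn in auto)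
      have cst: "cost c q r = - c * Z 0 r c q - (F c r - F c q)"
        unfolding cost_def Phi_incr_Z[of c r q 0] by simp
      \<comment> \<open>With the same parameter \<open>c\<close> for both curves all terms on {q..r}
        cancel; only the increment of \<open>F c\<close> from \<open>r\<close> to
        \<open>\<rho>\<close> is left.\<close>
      have "V 0 r \<le> JJ \<gamma> \<rho> + (F c \<rho> - F c r)"
      proof (cases "?k q = 0")
        case True
        then have "\<gamma> q = Z 0 r c q" by simp
        moreover have "V (\<gamma> q) q \<le> JJ \<gamma> q"
          by (rule V_le[OF q(1) Gamma_restrict(1)[OF \<gamma>]]) (use q rs in auto)
        ultimately show ?thesis using J2 I2 V1 cst \<gamma>\<rho> by simp
      next
        case False
        then have q0: "q = 0" using q by blast
        have "0 < ?k 0" using q(4) False q0 rs by (intro kpos) (auto simp: less_le)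
        moreover have "0 \<le> Z 0 r c 0" using Znn[of 0] rs by simp
        moreover have "\<bar>U0 (\<gamma> 0) - U0 (Z 0 r c 0)\<bar> \<le> M * \<bar>\<gamma> 0 - Z 0 r c 0\<bar>"
          using nn[of 0] s0 calculation by (intro M) auto
        moreover have "M * (\<gamma> 0 - Z 0 r c 0) \<le> - c * (\<gamma> 0 - Z 0 r c 0)"
          using c(1) calculation(1) by (intro mult_right_mono) auto
        moreover have "V (Z 0 r c 0) 0 = U0 (Z 0 r c 0)" using calculation by (intro V_initial) auto
        moreover have "JJ \<gamma> 0 = U0 (\<gamma> 0)"
          using J_eq[OF Gamma_restrict(1)[OF \<gamma>], of 0] s0 prim_0[of "run \<gamma>"] by (simp add: prim_def)
        ultimately show ?thesis using J2 I2 V1 cst \<gamma>\<rho> q0 by (simp add: algebra_simps)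
      qed
      moreover have "F c \<rho> - F c r \<le> C2 * (\<rho> - r)" using C2(2)[rule_format, of r \<rho>] rs \<rho> by auto
      moreover have "C2 * (\<rho> - r) \<le> C2 * (s - r)" "C1 * (s - \<rho>) \<le> C1 * (s - r)"
        using C1 C2 \<rho> by (auto intro: mult_left_mono)
      ultimately show "V 0 r - (C1 + C2) * (s - r) \<le> JJ \<gamma> s"
        using J1 I1 by (simp add: algebra_simps)
    qed simp
    then show ?thesis by simp
  qed
  then show ?thesis using that[of "C1 + C2"] C1(1) C2(1) by auto
qed

lemma V_boundary_tendsto:
  assumes s: "s \<longlonglongrightarrow> (s0::real)" and pos: "\<And>n. 0 \<le> s n"
  shows "(\<lambda>n. V 0 (s n)) \<longlonglongrightarrow> V 0 s0"
proof -
  have s00: "0 \<le> s0" using LIMSEQ_le_const[OF s] pos by blast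
  obtain T where T: "\<And>n. \<bar>s n\<bar> \<le> T"
    using convergent_imp_Bseq[of s] s by (force simp: convergent_def Bseq_def)
  have sT: "s n \<le> T + s0" "0 \<le> T" "s0 \<le> T + s0" for n using T[of n] s00 by auto
  then have T0: "0 \<le> T + s0" using s00 by auto
  obtain C where C: "0 \<le> C" "\<forall>r s. 0 \<le> r \<longrightarrow> r \<le> s \<longrightarrow> s \<le> T + s0 \<longrightarrow> V 0 s \<le> V 0 r + C * (s - r)"
    by (rule V_boundary_upper)
  obtain D where D: "0 \<le> D" "\<forall>r s. 0 \<le> r \<longrightarrow> r \<le> s \<longrightarrow> s \<le> T + s0 \<longrightarrow> V 0 r \<le> V 0 s + D * (s - r)"
    by (rule V_boundary_lower[OF T0])
  have "norm (V 0 (s n) - V 0 s0) \<le> norm (s n - s0) * (C + D)" for n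
  proof (cases "s n \<le> s0")
    case True
    have "V 0 s0 \<le> V 0 (s n) + C * (s0 - s n)" "V 0 (s n) \<le> V 0 s0 + D * (s0 - s n)"
      using C(2) D(2) True pos sT by blast+
    moreover have "0 \<le> C * (s0 - s n)" "0 \<le> D * (s0 - s n)" using True C D by auto
    ultimately show ?thesis using True by (simp add: abs_le_iff algebra_simps)
  next
    case False
    have "V 0 (s n) \<le> V 0 s0 + C * (s n - s0)" "V 0 s0 \<le> V 0 (s n) + D * (s n - s0)"
      using C(2) D(2) False s00 sT by (meson linear)+
    moreover have "0 \<le> C * (s n - s0)" "0 \<le> D * (s n - s0)" using False C D by auto
    ultimately show ?thesis using False by (simp add: abs_le_iff algebra_simps)
  qed
  then have "(\<lambda>n. V 0 (s n) - V 0 s0) \<longlonglongrightarrow> 0"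
    by (intro tendsto_0_le[where K = "C + D" and f = "\<lambda>n. s n - s0", OF LIM_zero[OF s]] always_eventually) auto
  then show ?thesis by (simp add: LIM_zero_iff)
qed

section \<open>Families of h-curves with a common apex\<close>

lemma Z_tendsto:
  assumes "x \<longlonglongrightarrow> x0" "t \<longlonglongrightarrow> t0" "a \<longlonglongrightarrow> a0" "\<theta> \<longlonglongrightarrow> \<theta>0" and "\<And>n. 0 \<le> t n" "\<And>n. 0 \<le> \<theta> n"
  shows "(\<lambda>n. Z (x n) (t n) (a n) (\<theta> n)) \<longlonglongrightarrow> Z x0 t0 a0 \<theta>0"
proof -
  have "0 \<le> t0" "0 \<le> \<theta>0" using assms LIMSEQ_le_const by blast+
  then show ?thesis unfolding Z_def using assms by (intro tendsto_intros Phi_tendsto) auto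
qed

text \<open>Curves are followed backwards from the apex, so the faster one lies further left:
  parameters and positions are ordered oppositely.\<close>

lemma Z_less: "\<lbrakk>0 \<le> \<theta>; \<theta> < t; a < c\<rbrakk> \<Longrightarrow> Z x t c \<theta> < Z x t a \<theta>"
  using Phi_incr_less[of \<theta> t a c] by (simp add: Z_def)

lemma Z_le: "\<lbrakk>0 \<le> \<theta>; \<theta> \<le> t; a \<le> c\<rbrakk> \<Longrightarrow> Z x t c \<theta> \<le> Z x t a \<theta>"
  using Phi_incr_le[of \<theta> t a c] by (simp add: Z_def)

lemma Z_le_iff: "\<lbrakk>0 \<le> \<theta>; \<theta> < t\<rbrakk> \<Longrightarrow> Z x t c \<theta> \<le> Z x t a \<theta> \<longleftrightarrow> a \<le> c"
  using Z_le[of \<theta> t a c x] Z_less[of \<theta> t c a x] by (cases "a \<le> c") auto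

text \<open>\<open>c\<close> is the largest parameter whose curve stays in the quarter plane on
  {s..t}. Curves with slightly larger parameters leave it at times \<open>\<theta> n\<close>, which
  accumulate at a zero of the limiting curve.\<close>

lemma touching_curve:
  assumes t: "0 \<le> s" "s < t" and x: "0 < x" and neg: "s \<le> \<theta>0" "\<theta>0 \<le> t" "Z x t a \<theta>0 < 0"
  obtains c \<theta> where "c < a" "s \<le> \<theta>" "\<theta> < t" "Z x t c \<theta> = 0" "\<forall>\<theta>. s \<le> \<theta> \<longrightarrow> \<theta> \<le> t \<longrightarrow> 0 \<le> Z x t c \<theta>"
proof -
  define S where "S = {c. \<forall>\<theta>. s \<le> \<theta> \<longrightarrow> \<theta> \<le> t \<longrightarrow> 0 \<le> Z x t c \<theta>}"
  obtain a0 where a0: "a0 < 0" "\<And>a \<theta>. a \<le> a0 \<Longrightarrow> 0 \<le> \<theta> \<Longrightarrow> \<theta> \<le> t \<Longrightarrow> spd a \<theta> \<le> 0"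
    using spd_small[of t 0] by blast
  have "a0 \<in> S" unfolding S_def
  proof (clarify)
    fix \<theta> assume "s \<le> \<theta>" "\<theta> \<le> t"
    then show "0 \<le> Z x t a0 \<theta>" using Phi_incr_upper[of \<theta> t a0 0] a0(2) t x by (simp add: Z_def)
  qed
  have ub: "c < a" if "c \<in> S" for c
  proof (rule ccontr)
    assume "\<not> c < a"
    then have "Z x t c \<theta>0 \<le> Z x t a \<theta>0" using neg t by (intro Z_le) auto
    moreover have "0 \<le> Z x t c \<theta>0" using that neg by (auto simp: S_def)
    ultimately show False using neg by simp
  qed
  then have bdd: "bdd_above S" by (intro bdd_aboveI[of _ a]) (auto intro: less_imp_le)
  have zc: "(\<lambda>n. Z x t (c n) \<theta>) \<longlonglongrightarrow> Z x t c' \<theta>" if "c \<longlonglongrightarrow> c'" "s \<le> \<theta>" for c c' \<theta>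
    by (rule Z_tendsto) (use t that in auto)
  have "closed S"
    unfolding closed_sequential_limits
  proof (intro allI impI, elim conjE)
    fix c l assume "\<forall>n. c n \<in> S" "c \<longlonglongrightarrow> l"
    then show "l \<in> S" unfolding S_def using zc[of c l] LIMSEQ_le_const[of _ _ 0] by blast
  qed
  define c where "c = Sup S"
  have cS: "c \<in> S" unfolding c_def using closed_contains_Sup[OF _ bdd \<open>closed S\<close>] \<open>a0 \<in> S\<close> by auto
  have "\<exists>\<theta>. s \<le> \<theta> \<and> \<theta> \<le> t \<and> Z x t (c + inverse (real (Suc n))) \<theta> < 0" for n
  proof (rule ccontr)
    assume "\<not> ?thesis"
    then have "c + inverse (real (Suc n)) \<in> S" by (auto simp: S_def not_less)
    then have "c + inverse (real (Suc n)) \<le> c" unfolding c_def using bdd by (rule cSup_upper)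
    then show False by simp
  qed
  then obtain \<theta> where \<theta>: "\<And>n. s \<le> \<theta> n" "\<And>n. \<theta> n \<le> t" "\<And>n. Z x t (c + inverse (real (Suc n))) (\<theta> n) < 0" by metis
  have "compact {s..t}" by simp
  then obtain l r where l: "l \<in> {s..t}" "strict_mono r" "(\<theta> \<circ> r) \<longlonglongrightarrow> l"
    using \<theta>(1,2) unfolding compact_def by (metis atLeastAtMost_iff)
  have "(\<lambda>n. c + inverse (real (Suc n))) \<longlonglongrightarrow> c + 0" by (intro tendsto_intros LIMSEQ_inverse_real_of_nat)
  then have "(\<lambda>n. c + inverse (real (Suc (r n)))) \<longlonglongrightarrow> c"
    using LIMSEQ_subseq_LIMSEQ[OF _ l(2)] by (fastforce simp: o_def)
  then have "(\<lambda>n. Z x t (c + inverse (real (Suc (r n)))) ((\<theta> \<circ> r) n)) \<longlonglongrightarrow> Z x t c l"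
    using t l(3) \<theta>(1) order_trans[OF t(1)] by (intro Z_tendsto) (auto simp: o_def)
  then have "Z x t c l \<le> 0" by (rule LIMSEQ_le_const2) (use \<theta>(3) in \<open>auto intro: less_imp_le\<close>)
  then have "Z x t c l = 0" using cS l(1) by (auto simp: S_def intro: antisym)
  moreover from this have "l \<noteq> t" using x by auto
  ultimately show ?thesis using that[of c l] ub[OF cS] l(1) cS by (auto simp: S_def)
qed

subsection \<open>Minimizing \<open>h\<close>-curves\<close>

text \<open>The candidates for \<open>A(x,t)\<close> (with \<open>\<tau> = 0\<close>) and for \<open>B(x,t)\<close> (with foot \<open>(0, \<tau>)\<close>) are treated
  uniformly: \<open>val x t a \<tau>\<close> is the value of the \<open>h\<close>-curve \<open>Z x t a\<close> followed back to time \<open>\<tau>\<close>. In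
  \<open>opt\<close> the foot may be an interior point.\<close>

definition adm :: "real \<Rightarrow> real \<Rightarrow> real \<Rightarrow> real \<Rightarrow> bool" where
  "adm x t a \<tau> \<longleftrightarrow> 0 \<le> \<tau> \<and> \<tau> < t \<and> (\<forall>\<theta>. \<tau> \<le> \<theta> \<longrightarrow> \<theta> \<le> t \<longrightarrow> 0 \<le> Z x t a \<theta>) \<and> (\<tau> = 0 \<or> Z x t a \<tau> = 0)"

definition val :: "real \<Rightarrow> real \<Rightarrow> real \<Rightarrow> real \<Rightarrow> real" where
  "val x t a \<tau> = V (Z x t a \<tau>) \<tau> + cost a \<tau> t"

definition opt :: "real \<Rightarrow> real \<Rightarrow> real \<Rightarrow> real \<Rightarrow> bool" where
  "opt x t a \<tau> \<longleftrightarrow> 0 \<le> \<tau> \<and> \<tau> < t \<and> (\<forall>\<theta>. \<tau> \<le> \<theta> \<longrightarrow> \<theta> \<le> t \<longrightarrow> 0 \<le> Z x t a \<theta>) \<and> val x t a \<tau> = V x t"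

definition mini :: "real \<Rightarrow> real \<Rightarrow> real \<Rightarrow> bool" where
  "mini x t a \<longleftrightarrow> (\<exists>\<tau>. adm x t a \<tau> \<and> val x t a \<tau> = V x t)"

lemma V_le_val:
  assumes "0 \<le> \<tau>" "\<tau> \<le> t" "\<forall>\<theta>. \<tau> \<le> \<theta> \<longrightarrow> \<theta> \<le> t \<longrightarrow> 0 \<le> Z x t a \<theta>"
  shows "V x t \<le> val x t a \<tau>"
  unfolding val_def using assms by (intro V_h_curve) simp_all

text \<open>Cutting the curve off at the later time \<open>s\<close> replaces its initial part by
  the infimum over all paths to the same point.\<close>

lemma val_antimono:
  assumes "0 \<le> \<tau>" "\<tau> \<le> s" "s \<le> t" "\<forall>\<theta>. \<tau> \<le> \<theta> \<longrightarrow> \<theta> \<le> t \<longrightarrow> 0 \<le> Z x t a \<theta>"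
  shows "val x t a s \<le> val x t a \<tau>"
proof -
  have "V (Z x t a s) s \<le> V (Z (Z x t a s) s a \<tau>) \<tau> + cost a \<tau> s"
    by (rule V_h_curve) (use assms in \<open>auto simp: Z_shift\<close>)
  then show ?thesis by (simp add: val_def Z_shift flip: cost_split[of a \<tau> s t])
qed

lemma opt_later: "\<lbrakk>opt x t a \<tau>; \<tau> \<le> s; s < t\<rbrakk> \<Longrightarrow> opt x t a s"
  using val_antimono[of \<tau> s t x a] V_le_val[of s t x a] by (auto simp: opt_def intro!: antisym)

text \<open>Principle of optimality: a cheaper way to the intermediate point would improve the whole
  curve.\<close>

lemma opt_initial_part:
  assumes o: "opt x t a \<tau>" and s: "\<tau> < s" "s \<le> t"
  shows "opt (Z x t a s) s a \<tau>"
proof -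
  have "V x t \<le> val x t a s" using o s by (intro V_le_val) (auto simp: opt_def)
  moreover have "V (Z x t a s) s \<le> val (Z x t a s) s a \<tau>"
    using o s by (intro V_le_val) (auto simp: opt_def Z_shift)
  ultimately show ?thesis using o s
    by (auto simp: opt_def Z_shift val_def simp flip: cost_split[of a \<tau> s t])
qed

lemma mini_opt: "mini x t a \<Longrightarrow> \<exists>\<tau>. opt x t a \<tau> \<and> (\<tau> = 0 \<or> Z x t a \<tau> = 0)"
  unfolding mini_def adm_def opt_def by blast

text \<open>If the direct \<open>h\<close>-curve from the last boundary contact of \<open>\<gamma>\<close> leaves the quarter plane, its
  parameter is lowered until the curve just touches the boundary. This curve meets \<open>\<gamma>\<close> before the
  contact, so \<open>\<gamma>\<close> may be replaced by it from there on.\<close>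

lemma adm_below_J:
  assumes x: "0 < x" and t: "0 < t" and \<gamma>: "\<gamma> \<in> Gamma x t"
  shows "\<exists>a \<tau>. adm x t a \<tau> \<and> val x t a \<tau> \<le> JJ \<gamma> t"
proof -
  obtain L where lip: "L-lipschitz_on {0..t} \<gamma>" using \<gamma> by (auto simp: Gamma_def)
  have nn: "\<And>\<theta>. 0 \<le> \<theta> \<Longrightarrow> \<theta> \<le> t \<Longrightarrow> 0 \<le> \<gamma> \<theta>" and \<gamma>t: "\<gamma> t = x" using \<gamma> by (auto simp: Gamma_def)
  have cont: "continuous_on {0..t} \<gamma>" by (rule lipschitz_on_continuous_on[OF lip])
  obtain s where s: "0 \<le> s" "s \<le> t" "s = 0 \<or> \<gamma> s = 0" "\<And>\<theta>. s < \<theta> \<Longrightarrow> \<theta> \<le> t \<Longrightarrow> \<gamma> \<theta> \<noteq> 0"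
    using last_zero[OF cont] t by (metis less_imp_le)
  have st: "s < t" using s \<gamma>t x t by (cases "s = t") auto
  \<comment> \<open>In Young's inequality with the parameter of the h-curve that has the same end
    points, the lower bound is exactly the cost of that h-curve.\<close>
  have replace: "V (\<gamma> q) q + cost a q t \<le> JJ \<gamma> t" if q: "s \<le> q" "q < t" "\<gamma> q = Z x t a q" for q a
  proof -
    have "JJ \<gamma> t = JJ \<gamma> q + (LINT \<theta>:{q..t}|lebesgue. run \<gamma> \<theta>)"
      by (rule Gamma_restrict(2)[OF \<gamma>]) (use q s in auto)
    moreover have "V (\<gamma> q) q \<le> JJ \<gamma> q" by (rule V_le[OF _ Gamma_restrict(1)[OF \<gamma>]]) (use q s in auto)
    moreover have "a * (\<gamma> t - \<gamma> q) - (F a t - F a q) \<le> (LINT \<theta>:{q..t}|lebesgue. run \<gamma> \<theta>)"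
      by (rule run_fenchel[where L = L]) (use q s in \<open>auto intro: lipschitz_on_subset[OF lip]\<close>)
    moreover have "a * (\<gamma> t - \<gamma> q) - (F a t - F a q) = cost a q t"
      unfolding cost_def Phi_incr_Z[of a t q x] by (simp add: q \<gamma>t)
    ultimately show ?thesis by simp
  qed
  obtain a where "Phi a t - Phi a s = x - \<gamma> s" using Phi_incr_surj[OF s(1) st] by blast
  then have a: "Z x t a s = \<gamma> s" by (simp add: Z_def)
  show ?thesis
  proof (cases "\<forall>\<theta>. s \<le> \<theta> \<longrightarrow> \<theta> \<le> t \<longrightarrow> 0 \<le> Z x t a \<theta>")
    case True
    then have "adm x t a s" using s st a by (auto simp: adm_def)
    moreover have "val x t a s \<le> JJ \<gamma> t" using replace[of s a] a st by (simp add: val_def)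
    ultimately show ?thesis by blast
  next
    case False
    then obtain \<theta>0 where "s \<le> \<theta>0" "\<theta>0 \<le> t" "Z x t a \<theta>0 < 0" by (auto simp: not_le)
    then obtain c \<tau> where c: "c < a" "s \<le> \<tau>" "\<tau> < t" "Z x t c \<tau> = 0"
      "\<forall>\<theta>. s \<le> \<theta> \<longrightarrow> \<theta> \<le> t \<longrightarrow> 0 \<le> Z x t c \<theta>"
      using touching_curve[OF s(1) st x] by metis
    have less: "\<gamma> s < Z x t c s" using Z_less[OF s(1) st c(1), of x] a by simp
    have "s \<noteq> \<tau>" using less c nn[of s] s st by auto
    then have "s < \<tau>" using c by simp
    have "0 < \<gamma> \<tau>" using s(4)[of \<tau>] nn[of \<tau>] \<open>s < \<tau>\<close> c s by (auto simp: less_le)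
    \<comment> \<open>Lowering the parameter moved the curve to the right of \<gamma> at
      \<open>s\<close>, while at \<open>\<tau>\<close> it is at 0 and \<gamma> is positive; so they
      meet in between.\<close>
    let ?k = "\<lambda>\<theta>. \<gamma> \<theta> - Z x t c \<theta>"
    have "continuous_on {s..\<tau>} ?k"
      using s c by (intro continuous_intros continuous_on_subset[OF cont] continuous_on_subset[OF Z_cont]) auto
    then obtain q where q: "s \<le> q" "q \<le> \<tau>" "?k q = 0"
      using IVT'[of ?k s 0 \<tau>] less \<open>0 < \<gamma> \<tau>\<close> c by auto
    have "adm x t c \<tau>" using c s by (auto simp: adm_def)
    moreover have "val x t c \<tau> \<le> val x t c q"
      by (rule val_antimono) (use q c s in auto)
    moreover have "val x t c q \<le> JJ \<gamma> t" using replace[of q c] q c by (simp add: val_def)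
    ultimately show ?thesis by fastforce
  qed
qed

lemma near_minimizer:
  assumes "0 < x" "0 < t" "0 < e"
  shows "\<exists>a \<tau>. adm x t a \<tau> \<and> val x t a \<tau> < V x t + e"
proof -
  have "(INF \<gamma>\<in>Gamma x t. JJ \<gamma> t) < V x t + e" using assms(3) by (simp add: W_def)
  then obtain \<gamma> where "\<gamma> \<in> Gamma x t" "JJ \<gamma> t < V x t + e"
    using cInf_lessD[of "(\<lambda>\<gamma>. JJ \<gamma> t) ` Gamma x t"] Gamma_const[of x t] assms(1) by fastforce
  then show ?thesis using adm_below_J[OF assms(1,2)] by fastforce
qed

section \<open>Semicontinuity of the value function and compactness of near-minimizers\<close>

lemma Z_lower:
  assumes G: "\<forall>a \<theta>. \<bar>a\<bar> \<le> K \<longrightarrow> 0 \<le> \<theta> \<longrightarrow> \<theta> \<le> T \<longrightarrow> \<bar>spd a \<theta>\<bar> \<le> G"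
    and "\<bar>a\<bar> \<le> K" "0 \<le> \<theta>" "\<theta> \<le> t" "t \<le> T"
  shows "x - G * (t - \<theta>) \<le> Z x t a \<theta>"
proof -
  have "spd a \<theta>' \<le> G" if "\<theta> \<le> \<theta>'" "\<theta>' \<le> t" for \<theta>'
    using G[rule_format, of a \<theta>'] that assms by (auto simp: abs_le_iff)
  then show ?thesis using Phi_incr_upper[of \<theta> t a G] assms by (simp add: Z_def)
qed

lemma positive_near_apex:
  assumes x: "0 < x" and t: "0 < t"
  obtains \<delta> where "0 < \<delta>" "3 * \<delta> < t"
    "\<forall>x' t' a \<theta>. \<bar>x' - x\<bar> < \<delta> \<longrightarrow> \<bar>t' - t\<bar> < \<delta> \<longrightarrow> \<bar>a\<bar> \<le> K \<longrightarrow> t - 2 * \<delta> \<le> \<theta> \<longrightarrow> \<theta> \<le> t' \<longrightarrow> 0 < Z x' t' a \<theta>"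
proof -
  obtain G where G: "0 < G" "\<forall>a \<theta>. \<bar>a\<bar> \<le> K \<longrightarrow> 0 \<le> \<theta> \<longrightarrow> \<theta> \<le> t + 1 \<longrightarrow> \<bar>spd a \<theta>\<bar> \<le> G"
    by (rule spd_bounded)
  \<comment> \<open>In a window shorter than 3 * \<delta> a curve with speed bound \<open>G\<close>
    descends at most 3 * x / 8, less than the x / 2 that \<open>x'\<close> exceeds. The terms t / 4
    and 1 keep the times in [0, t + 1].\<close>
  define \<delta> where "\<delta> = min (min (x / 2) (t / 4)) (min 1 (x / (8 * G)))"
  have \<delta>: "0 < \<delta>" "\<delta> \<le> x / 2" "\<delta> \<le> t / 4" "\<delta> \<le> 1" "\<delta> \<le> x / (8 * G)"
    using x t G by (auto simp: \<delta>_def)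
  have G\<delta>: "8 * (G * \<delta>) \<le> x" using \<delta>(5) G by (simp add: field_simps)
  have pos: "0 < Z x' t' a \<theta>"
    if h: "\<bar>x' - x\<bar> < \<delta>" "\<bar>t' - t\<bar> < \<delta>" "\<bar>a\<bar> \<le> K" "t - 2 * \<delta> \<le> \<theta>" "\<theta> \<le> t'" for x' t' a \<theta>
  proof -
    have "x' - G * (t' - \<theta>) \<le> Z x' t' a \<theta>"
      by (rule Z_lower[OF G(2)]) (use h \<delta> t in auto)
    moreover have "G * (t' - \<theta>) \<le> G * (3 * \<delta>)" using h G by (intro mult_left_mono) auto
    moreover have "x' > x / 2" using h \<delta> by auto
    ultimately show ?thesis using G\<delta> x by auto
  qed
  have "3 * \<delta> < t" using \<delta> t by linarith
  then show ?thesis using that[of \<delta>] \<delta>(1) pos by blast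
qed

text \<open>A local form of \<open>Phi_incr_converges\<close> with movable end time: half of the gap
  to the displacements of a + e and a - e is left for the displacement, the other half for the shift
  of the end time.\<close>

lemma direct_parameter_near:
  assumes \<theta>: "0 \<le> \<theta>" "\<theta> < t" and e: "0 < e"
  obtains \<delta> where "0 < \<delta>"
    "\<forall>t' c. \<bar>t' - t\<bar> < \<delta> \<longrightarrow> \<theta> < t' \<longrightarrow> \<bar>(Phi c t' - Phi c \<theta>) - (Phi a t - Phi a \<theta>)\<bar> < \<delta> \<longrightarrow> \<bar>c - a\<bar> < e"
proof -
  have c: "\<exists>d>0. \<forall>t'. 0 \<le> t' \<longrightarrow> \<bar>t' - t\<bar> < d \<longrightarrow> \<bar>Phi k t' - Phi k t\<bar> < r" if "0 < r" for k r
    using Phi_cont[of k, unfolded continuous_on_iff, rule_format, of t r] \<theta> that by (auto simp: dist_real_def)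
  define r1 where "r1 = (Phi (a + e) t - Phi (a + e) \<theta>) - (Phi a t - Phi a \<theta>)"
  define r2 where "r2 = (Phi a t - Phi a \<theta>) - (Phi (a - e) t - Phi (a - e) \<theta>)"
  have r: "0 < r1" "0 < r2" using Phi_incr_less[OF \<theta>, of a "a + e"] Phi_incr_less[OF \<theta>, of "a - e" a] e
    by (auto simp: r1_def r2_def)
  obtain d1 where d1: "0 < d1" "\<And>t'. 0 \<le> t' \<Longrightarrow> \<bar>t' - t\<bar> < d1 \<Longrightarrow> \<bar>Phi (a + e) t' - Phi (a + e) t\<bar> < r1 / 2"
    using c[of "r1 / 2" "a + e"] r by auto
  obtain d2 where d2: "0 < d2" "\<And>t'. 0 \<le> t' \<Longrightarrow> \<bar>t' - t\<bar> < d2 \<Longrightarrow> \<bar>Phi (a - e) t' - Phi (a - e) t\<bar> < r2 / 2"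
    using c[of "r2 / 2" "a - e"] r by auto
  define \<delta> where "\<delta> = min (min d1 d2) (min (r1 / 2) (r2 / 2))"
  have "\<bar>k - a\<bar> < e" if h: "\<bar>t' - t\<bar> < \<delta>" "\<theta> < t'" "\<bar>(Phi k t' - Phi k \<theta>) - (Phi a t - Phi a \<theta>)\<bar> < \<delta>" for t' k
  proof -
    have "\<bar>Phi (a + e) t' - Phi (a + e) t\<bar> < r1 / 2" by (rule d1(2)) (use h \<theta> in \<open>auto simp: \<delta>_def\<close>)
    then have A: "Phi (a + e) t - r1 / 2 < Phi (a + e) t'" by linarith
    have "\<bar>Phi (a - e) t' - Phi (a - e) t\<bar> < r2 / 2" by (rule d2(2)) (use h \<theta> in \<open>auto simp: \<delta>_def\<close>)
    then have B: "Phi (a - e) t' < Phi (a - e) t + r2 / 2" by linarith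
    have "\<bar>(Phi k t' - Phi k \<theta>) - (Phi a t - Phi a \<theta>)\<bar> < r1 / 2"
      "\<bar>(Phi k t' - Phi k \<theta>) - (Phi a t - Phi a \<theta>)\<bar> < r2 / 2" using h(3) by (auto simp: \<delta>_def)
    then have "Phi k t' - Phi k \<theta> < Phi a t - Phi a \<theta> + r1 / 2"
      "Phi a t - Phi a \<theta> - r2 / 2 < Phi k t' - Phi k \<theta>" by linarith+
    then have 1: "Phi k t' - Phi k \<theta> < Phi (a + e) t' - Phi (a + e) \<theta>"
      and 2: "Phi (a - e) t' - Phi (a - e) \<theta> < Phi k t' - Phi k \<theta>"
      using A B r1_def r2_def by linarith+
    have "k < a + e" using Phi_incr_le[of \<theta> t' "a + e" k] 1 h \<theta> by (cases "k < a + e") auto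
    moreover have "a - e < k" using Phi_incr_le[of \<theta> t' k "a - e"] 2 h \<theta> by (cases "a - e < k") auto
    ultimately show ?thesis by auto
  qed
  moreover have "0 < \<delta>" using d1 d2 r by (simp add: \<delta>_def)
  ultimately show ?thesis using that[of \<delta>] by blast
qed

text \<open>The direct curve to the point \<open>Z x t a \<theta>\<close> competes at (x', t'), and
  its parameter \<open>c\<close> also serves as test parameter for the curve from (x, t). What
  remains is the contribution of the step from (x, t) to (x', t'). Exchanging the two apices yields
  the opposite estimate.\<close>

lemma V_increment_le:
  assumes \<theta>: "0 \<le> \<theta>" "\<theta> < t" "\<theta> < t'" and val: "val x t a \<theta> \<le> V x t + e"
    and direct: "Z x' t' c \<theta> = Z x t a \<theta>"
    and nn: "\<forall>s. \<theta> \<le> s \<longrightarrow> s \<le> t' \<longrightarrow> 0 \<le> Z x' t' c s"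
  shows "V x' t' \<le> V x t + e + c * (x' - x) - (F c t' - F c t)"
proof -
  have "V x' t' \<le> val x' t' c \<theta>" by (rule V_le_val) (use \<theta> nn in auto)
  moreover have "cost c \<theta> t' = c * (x' - Z x t a \<theta>) - (F c t' - F c \<theta>)"
    unfolding cost_def Phi_incr_Z[of c t' \<theta> x'] by (simp add: direct)
  moreover have "c * (x - Z x t a \<theta>) - (F c t - F c \<theta>) \<le> cost a \<theta> t"
    using duality[of \<theta> t c a] \<theta> unfolding Phi_incr_Z[of a t \<theta> x] by simp
  ultimately show ?thesis using val by (simp add: val_def direct algebra_simps)
qed

lemma V_upper_semicontinuous:
  assumes x: "0 < x" and t: "0 < t" and e: "0 < e"
  obtains \<delta> where "0 < \<delta>" "\<forall>x' t'. \<bar>x' - x\<bar> < \<delta> \<longrightarrow> \<bar>t' - t\<bar> < \<delta> \<longrightarrow> V x' t' < V x t + e"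
proof -
  obtain a \<tau> where a: "adm x t a \<tau>" "val x t a \<tau> < V x t + e / 2"
    using near_minimizer[OF x t, of "e / 2"] e by auto
  define K where "K = \<bar>a\<bar> + 1"
  obtain d where d: "0 < d" "3 * d < t"
    "\<forall>x' t' k \<theta>. \<bar>x' - x\<bar> < d \<longrightarrow> \<bar>t' - t\<bar> < d \<longrightarrow> \<bar>k\<bar> \<le> K \<longrightarrow> t - 2 * d \<le> \<theta> \<longrightarrow> \<theta> \<le> t' \<longrightarrow> 0 < Z x' t' k \<theta>"
    by (rule positive_near_apex[OF x t])
  \<comment> \<open>A cut-off time after the foot \<open>\<tau>\<close> and inside the window in
    which curves with bounded parameters stay positive.\<close>
  define \<theta> where "\<theta> = max (t - 2 * d) ((\<tau> + t) / 2)"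
  have \<tau>: "0 \<le> \<tau>" "\<tau> < t" "\<forall>\<theta>. \<tau> \<le> \<theta> \<longrightarrow> \<theta> \<le> t \<longrightarrow> 0 \<le> Z x t a \<theta>" using a by (auto simp: adm_def)
  have \<theta>: "0 \<le> \<theta>" "\<theta> < t" "\<tau> \<le> \<theta>" "t - 2 * d \<le> \<theta>"
  proof -
    have "\<tau> \<le> (\<tau> + t) / 2" "(\<tau> + t) / 2 < t" "t - 2 * d < t" using \<tau>(2) d(1) by auto
    then show "0 \<le> \<theta>" "\<theta> < t" "\<tau> \<le> \<theta>" "t - 2 * d \<le> \<theta>"
      using \<tau>(1) unfolding \<theta>_def by (simp_all add: le_max_iff_disj del: max_less_iff_conj) (simp add: max_def)
  qed
  have val: "val x t a \<theta> \<le> V x t + e / 2"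
    using val_antimono[of \<tau> \<theta> t x a] \<tau> \<theta> a(2) by auto
  obtain d1 where d1: "0 < d1"
    "\<forall>t' c. \<bar>t' - t\<bar> < d1 \<longrightarrow> \<theta> < t' \<longrightarrow> \<bar>(Phi c t' - Phi c \<theta>) - (Phi a t - Phi a \<theta>)\<bar> < d1 \<longrightarrow> \<bar>c - a\<bar> < 1"
    by (rule direct_parameter_near[OF \<theta>(1,2), of 1]) simp
  obtain C where C: "0 < C"
    "\<forall>c r s. \<bar>c\<bar> \<le> K \<longrightarrow> 0 \<le> r \<longrightarrow> r \<le> s \<longrightarrow> s \<le> t + 1 \<longrightarrow> \<bar>F c s - F c r\<bar> \<le> C * (s - r)"
    by (rule F_lipschitz)
  have FC: "\<bar>F c t' - F c t\<bar> \<le> C * \<bar>t' - t\<bar>" if "\<bar>c\<bar> \<le> K" "0 \<le> t'" "t' \<le> t + 1" for c t'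
    using C(2)[rule_format, of c t t'] C(2)[rule_format, of c t' t] that t
    by (cases "t \<le> t'") (auto simp: abs_minus_commute)
  \<comment> \<open>The last term makes the increments in space and time cost at most e / 4
    together.\<close>
  define \<delta> where "\<delta> = min (min d (d1 / 2)) (min (min 1 (t - \<theta>)) (e / (4 * (K + C))))"
  have KC: "0 < K + C" using C by (simp add: K_def)
  have \<delta>: "0 < \<delta>" "\<delta> \<le> d" "\<delta> \<le> d1 / 2" "\<delta> \<le> 1" "\<delta> \<le> t - \<theta>" "\<delta> \<le> e / (4 * (K + C))"
  proof -
    show "0 < \<delta>" using d(1) d1(1) \<theta>(2) e KC by (simp add: \<delta>_def)
  qed (simp_all only: \<delta>_def min_le_iff_disj order_refl, simp_all)
  have "V x' t' < V x t + e" if h: "\<bar>x' - x\<bar> < \<delta>" "\<bar>t' - t\<bar> < \<delta>" for x' t'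
  proof -
    have \<theta>t': "\<theta> < t'" using h \<delta> by auto
    obtain c where c: "Phi c t' - Phi c \<theta> = x' - Z x t a \<theta>" using Phi_incr_surj[OF \<theta>(1) \<theta>t'] by blast
    have "(Phi c t' - Phi c \<theta>) - (Phi a t - Phi a \<theta>) = x' - x" unfolding c by (simp add: Z_def)
    then have "\<bar>(Phi c t' - Phi c \<theta>) - (Phi a t - Phi a \<theta>)\<bar> < d1" "\<bar>t' - t\<bar> < d1"
      using h \<delta>(3) d1(1) by linarith+
    then have "\<bar>c - a\<bar> < 1" using d1(2) \<theta>t' by blast
    then have cK: "\<bar>c\<bar> \<le> K" by (auto simp: K_def)
    have "Z x' t' c \<theta> = Z x t a \<theta>" using c by (simp add: Z_def)
    then have "V x' t' \<le> V x t + e / 2 + c * (x' - x) - (F c t' - F c t)"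
      by (rule V_increment_le[OF \<theta>(1,2) \<theta>t' val])
        (use d(3) h \<delta> cK \<theta> in \<open>auto intro!: less_imp_le\<close>)
    moreover have "c * (x' - x) \<le> K * \<delta>"
    proof -
      have "c * (x' - x) \<le> \<bar>c\<bar> * \<bar>x' - x\<bar>" by (simp flip: abs_mult)
      also have "\<dots> \<le> K * \<delta>" using cK h by (intro mult_mono) auto
      finally show ?thesis .
    qed
    moreover have "- (F c t' - F c t) \<le> C * \<delta>"
    proof -
      have "\<bar>F c t' - F c t\<bar> \<le> C * \<bar>t' - t\<bar>" by (rule FC[OF cK]) (use h \<delta> \<theta>t' \<theta> in auto)
      also have "\<dots> \<le> C * \<delta>" using C h by (intro mult_left_mono) auto
      finally show ?thesis by simp
    qed
    moreover have "K * \<delta> + C * \<delta> < e / 2"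
      using \<delta>(6) KC e by (simp add: field_simps)
    ultimately show ?thesis by simp
  qed
  then show ?thesis using that[of \<delta>] \<delta>(1) by blast
qed

text \<open>With a very large parameter the curve is so short in time that its foot lies on the
  t-axis, and covering the distance to \<open>x'\<close> in that time is too expensive. With a very
  negative one the foot lies far out on the x-axis, where the initial cost falls at most with slope
  \<open>M\<close> and travelling costs more.\<close>

lemma near_minimizers_bounded:
  assumes x: "0 < x" and t: "0 < t"
  obtains K \<delta> where "0 < \<delta>"
    "\<forall>x' t' a \<tau>. \<bar>x' - x\<bar> < \<delta> \<longrightarrow> \<bar>t' - t\<bar> < \<delta> \<longrightarrow> adm x' t' a \<tau> \<longrightarrow> val x' t' a \<tau> \<le> V x' t' + 1 \<longrightarrow> \<bar>a\<bar> \<le> K"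
proof -
  obtain d where d: "0 < d" "\<forall>x' t'. \<bar>x' - x\<bar> < d \<longrightarrow> \<bar>t' - t\<bar> < d \<longrightarrow> V x' t' < V x t + 1"
    by (rule V_upper_semicontinuous[OF x t, of 1]) auto
  define T where "T = 2 * t"
  have T: "0 \<le> T" using t by (simp add: T_def)
  obtain M C where MC: "0 \<le> M" "0 \<le> C" "\<forall>x s. 0 \<le> s \<longrightarrow> s \<le> T \<longrightarrow> 0 \<le> x \<longrightarrow> - M * x - C \<le> V x s"
    by (rule V_bound_below[OF T])
  define K2 where "K2 = \<bar>V x t\<bar> + 2 + C"
  have K2: "0 < K2" using MC by (simp add: K2_def)
  \<comment> \<open>Test parameter for large \<open>a\<close>: the distance x / 2 yields K2 + 2,
    which exceeds the budget \<open>K2\<close> even after a loss of less than 1 through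
    \<open>F N\<close>.\<close>
  define N where "N = 2 * (K2 + 2) / x"
  have N: "0 < N" "N * (x / 2) = K2 + 2" using K2 x by (auto simp: N_def)
  obtain CN where CN: "0 \<le> CN" "\<forall>r s. 0 \<le> r \<longrightarrow> r \<le> s \<longrightarrow> s \<le> T \<longrightarrow> \<bar>F N s - F N r\<bar> \<le> CN * (s - r)"
    by (rule F_lipschitz_fixed)
  obtain CM where CM: "0 \<le> CM" "\<forall>r s. 0 \<le> r \<longrightarrow> r \<le> s \<longrightarrow> s \<le> T \<longrightarrow> \<bar>F (- M - 1) s - F (- M - 1) r\<bar> \<le> CM * (s - r)"
    by (rule F_lipschitz_fixed)
  \<comment> \<open>Speed at least \<open>G1\<close> over a distance below 2 * x forces both CN *
    (t' - \<tau>) < 1 and t' - \<tau> < t / 2.\<close>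
  define G1 where "G1 = 2 * x * CN + 4 * x / t + 1"
  have G1: "0 < G1" using x t CN by (simp add: G1_def add_nonneg_pos)
  obtain a1 where a1: "0 < a1" "\<And>a \<theta>. a1 \<le> a \<Longrightarrow> 0 \<le> \<theta> \<Longrightarrow> \<theta> \<le> T \<Longrightarrow> G1 \<le> spd a \<theta>"
    using spd_large[of T G1] by blast
  \<comment> \<open>With test parameter - M - 1 the cost grows like (M + 1) * y against a budget
    growing like M * y, which bounds the foot \<open>y\<close> by \<open>Y\<close>. A speed of at
    most - G2 would carry it beyond \<open>Y\<close>.\<close>
  define Y where "Y = K2 + CM * T + (M + 1) * (2 * x)"
  have Y: "0 < Y" using K2 CM T MC x by (simp add: Y_def add_pos_nonneg)
  define G2 where "G2 = 2 * Y / t"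
  have G2: "0 < G2" using Y t by (simp add: G2_def)
  obtain a2 where a2: "a2 < 0" "\<And>a \<theta>. a \<le> a2 \<Longrightarrow> 0 \<le> \<theta> \<Longrightarrow> \<theta> \<le> T \<Longrightarrow> spd a \<theta> \<le> - G2"
    using spd_small[of T "- G2"] by blast
  define \<delta> where "\<delta> = min d (min (x / 2) (t / 2))"
  have "\<bar>a\<bar> \<le> max a1 (- a2)"
    if h: "\<bar>x' - x\<bar> < \<delta>" "\<bar>t' - t\<bar> < \<delta>" "adm x' t' a \<tau>" "val x' t' a \<tau> \<le> V x' t' + 1" for x' t' a \<tau>
  proof -
    have x': "x / 2 < x'" "x' < 2 * x" and t': "t / 2 < t'" "t' < T"
    proof -
      have "\<bar>x' - x\<bar> < x / 2" "\<bar>t' - t\<bar> < t / 2" using h(1,2) by (auto simp: \<delta>_def)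
      then show "x / 2 < x'" "x' < 2 * x" "t / 2 < t'" "t' < T" using x t unfolding T_def by linarith+
    qed
    define y where "y = Z x' t' a \<tau>"
    have \<tau>: "0 \<le> \<tau>" "\<tau> < t'" "0 \<le> y" "\<tau> = 0 \<or> y = 0" using h(3) by (auto simp: adm_def y_def)
    have incr: "Phi a t' - Phi a \<tau> = x' - y" by (simp add: y_def Z_def)
    have "V x' t' < V x t + 1" using d(2) h by (auto simp: \<delta>_def)
    moreover have "- M * y - C \<le> V y \<tau>" using MC(3) \<tau> t' by auto
    ultimately have cost: "cost a \<tau> t' \<le> K2 + M * y" using h(4) by (simp add: val_def y_def[symmetric] K2_def)
    have low: "c * (x' - y) - (F c t' - F c \<tau>) \<le> cost a \<tau> t'" for c
      using duality[of \<tau> t' c a] \<tau> incr by simp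
    have "a < a1"
    proof (rule ccontr)
      assume "\<not> a < a1"
      then have "G1 * (t' - \<tau>) \<le> x' - y"
        unfolding incr[symmetric] by (intro Phi_incr_ge a1(2)) (use \<tau> t' in auto)
      then have G: "G1 * (t' - \<tau>) < 2 * x" using \<tau> x' by simp
      have len: "(2 * x * CN) * (t' - \<tau>) + (4 * x / t) * (t' - \<tau>) + (t' - \<tau>) < 2 * x"
        using G by (simp add: G1_def algebra_simps)
      have p: "0 \<le> (2 * x * CN) * (t' - \<tau>)" "0 \<le> (4 * x / t) * (t' - \<tau>)" using x t CN \<tau> by auto
      have "(4 * x / t) * (t' - \<tau>) < 2 * x" using len p \<tau> by linarith
      then have "(4 * x / t) * (t' - \<tau>) < (4 * x / t) * (t / 2)" using t by simp
      then have "t' - \<tau> < t / 2" by (rule mult_left_less_imp_less) (use x t in simp)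
      then have "y = 0" using \<tau> t' by auto
      have "(2 * x) * (CN * (t' - \<tau>)) < (2 * x) * 1" using len p \<tau> by (simp add: algebra_simps)
      then have "CN * (t' - \<tau>) < 1" using x by (simp only: mult_less_cancel_left_pos)
      moreover have "F N t' - F N \<tau> \<le> CN * (t' - \<tau>)" using CN(2)[rule_format, of \<tau> t'] \<tau> t' by auto
      moreover have "N * (x / 2) \<le> N * x'" using N x' by (intro mult_left_mono) auto
      moreover have "N * x' - (F N t' - F N \<tau>) \<le> K2" using low[of N] cost \<open>y = 0\<close> by simp
      ultimately show False using N(2) by linarith
    qed
    moreover have "a2 < a"
    proof (rule ccontr)
      assume "\<not> a2 < a"
      then have "x' - y \<le> - G2 * (t' - \<tau>)"
        unfolding incr[symmetric] by (intro Phi_incr_upper a2(2)) (use \<tau> t' in auto)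
      then have y: "x' + G2 * (t' - \<tau>) \<le> y" by simp
      moreover have "0 \<le> G2 * (t' - \<tau>)" using G2 \<tau> by simp
      ultimately have "0 < y" using x' x by linarith
      then have "\<tau> = 0" using \<tau> by auto
      have "G2 * (t / 2) \<le> G2 * t'" using G2 t' by (intro mult_left_mono) auto
      moreover have "G2 * (t / 2) = Y" using t by (simp add: G2_def)
      ultimately have "Y < y" using y \<open>\<tau> = 0\<close> x' x by auto
      have "F (- M - 1) t' - F (- M - 1) \<tau> \<le> CM * (t' - \<tau>)" using CM(2)[rule_format, of \<tau> t'] \<tau> t' by auto
      moreover have "CM * (t' - \<tau>) \<le> CM * T" using CM \<tau> t' by (intro mult_left_mono) auto
      moreover have "(M + 1) * x' \<le> (M + 1) * (2 * x)" using MC x' by (intro mult_left_mono) auto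
      moreover have "(- M - 1) * (x' - y) = M * y + y - (M + 1) * x'" by (simp add: algebra_simps)
      ultimately have "y \<le> Y" using low[of "- M - 1"] cost by (simp add: Y_def)
      then show False using \<open>Y < y\<close> by simp
    qed
    ultimately show ?thesis by auto
  qed
  moreover have "0 < \<delta>" using d x t by (simp add: \<delta>_def)
  ultimately show ?thesis using that[of \<delta> "max a1 (- a2)"] by blast
qed

text \<open>One of the two summands vanishes at an admissible foot, so limits of feet near the
  corner need no distinction between the axes.\<close>

lemma val_boundary: "adm x t a \<tau> \<Longrightarrow> V (Z x t a \<tau>) \<tau> = U0 (Z x t a \<tau>) + V 0 \<tau>"
  using V_initial[of 0] V_initial[of "Z x t a \<tau>"] by (auto simp: adm_def)

lemma near_minimizers_converge:
  assumes x: "0 < x" and t: "0 < t" and xs: "xs \<longlonglongrightarrow> x" and ts: "ts \<longlonglongrightarrow> t"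
    and adm: "\<And>n. adm (xs n) (ts n) (as n) (\<tau>s n)"
    and near: "\<And>n. val (xs n) (ts n) (as n) (\<tau>s n) \<le> V (xs n) (ts n) + es n" and es: "es \<longlonglongrightarrow> 0"
  obtains r a \<tau> where "strict_mono (r :: nat \<Rightarrow> nat)" "(as \<circ> r) \<longlonglongrightarrow> a" "(\<tau>s \<circ> r) \<longlonglongrightarrow> \<tau>"
    "adm x t a \<tau>" "val x t a \<tau> = V x t"
proof -
  obtain K \<delta> where K: "0 < \<delta>" "\<forall>x' t' a \<tau>. \<bar>x' - x\<bar> < \<delta> \<longrightarrow> \<bar>t' - t\<bar> < \<delta> \<longrightarrow> adm x' t' a \<tau> \<longrightarrow>
      val x' t' a \<tau> \<le> V x' t' + 1 \<longrightarrow> \<bar>a\<bar> \<le> K"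
    by (rule near_minimizers_bounded[OF x t])
  have "eventually (\<lambda>n. \<bar>xs n - x\<bar> < \<delta>) sequentially" "eventually (\<lambda>n. \<bar>ts n - t\<bar> < min 1 \<delta>) sequentially"
    "eventually (\<lambda>n. \<bar>es n\<bar> < 1) sequentially"
    using tendstoD[OF xs K(1)] tendstoD[OF ts, of "min 1 \<delta>"] tendstoD[OF es, of 1] K(1) by (auto simp: dist_real_def)
  then have "eventually (\<lambda>n. \<bar>as n\<bar> \<le> K \<and> 0 \<le> \<tau>s n \<and> \<tau>s n \<le> t + 1) sequentially"
  proof eventually_elim
    case (elim n)
    have "val (xs n) (ts n) (as n) (\<tau>s n) \<le> V (xs n) (ts n) + 1" using near[of n] elim by linarith
    then show ?case using K(2) elim adm[of n] by (auto simp: adm_def)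
  qed
  then obtain N where N: "\<And>n. N \<le> n \<Longrightarrow> \<bar>as n\<bar> \<le> K \<and> 0 \<le> \<tau>s n \<and> \<tau>s n \<le> t + 1"
    by (auto simp: eventually_sequentially)
  have "compact ({-K..K} \<times> {0..t+1})" by (intro compact_Times) auto
  moreover have "\<forall>n. (as (n + N), \<tau>s (n + N)) \<in> {-K..K} \<times> {0..t+1}"
  proof
    fix n show "(as (n + N), \<tau>s (n + N)) \<in> {-K..K} \<times> {0..t+1}"
      using N[of "n + N"] by (simp add: abs_le_iff)
  qed
  ultimately obtain l r0 where l: "strict_mono r0" "((\<lambda>n. (as (n + N), \<tau>s (n + N))) \<circ> r0) \<longlonglongrightarrow> l"
    unfolding compact_def by meson
  define r where "r n = r0 n + N" for n
  have r: "strict_mono r" using l(1) by (auto simp: r_def strict_mono_def)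
  obtain a \<tau> where l_eq: "l = (a, \<tau>)" by (cases l)
  have a: "(\<lambda>n. as (r n)) \<longlonglongrightarrow> a" and \<tau>: "(\<lambda>n. \<tau>s (r n)) \<longlonglongrightarrow> \<tau>"
    using tendsto_fst[OF l(2)] tendsto_snd[OF l(2)] by (simp_all add: o_def r_def l_eq)
  have x': "(\<lambda>n. xs (r n)) \<longlonglongrightarrow> x" and t': "(\<lambda>n. ts (r n)) \<longlonglongrightarrow> t" and e': "(\<lambda>n. es (r n)) \<longlonglongrightarrow> 0"
    using LIMSEQ_subseq_LIMSEQ[OF xs r] LIMSEQ_subseq_LIMSEQ[OF ts r] LIMSEQ_subseq_LIMSEQ[OF es r] by (simp_all add: o_def)
  have A: "0 \<le> \<tau>s n" "\<tau>s n < ts n" "\<And>\<theta>. \<tau>s n \<le> \<theta> \<Longrightarrow> \<theta> \<le> ts n \<Longrightarrow> 0 \<le> Z (xs n) (ts n) (as n) \<theta>"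
    "\<tau>s n = 0 \<or> Z (xs n) (ts n) (as n) (\<tau>s n) = 0" for n using adm[of n] by (auto simp: adm_def)
  have A': "0 \<le> ts n" for n using A[of n] by simp
  have \<tau>0: "0 \<le> \<tau>" "\<tau> \<le> t"
    using LIMSEQ_le_const[OF \<tau>, of 0] LIMSEQ_le[OF \<tau> t'] A by (auto intro: less_imp_le)
  have Zl: "(\<lambda>n. Z (xs (r n)) (ts (r n)) (as (r n)) (\<tau>s (r n))) \<longlonglongrightarrow> Z x t a \<tau>"
    by (intro Z_tendsto x' t' a \<tau> A A')
  \<comment> \<open>The alternative in \<open>adm\<close> as a single closed condition, which
    survives the limit.\<close>
  have prod: "\<tau> * Z x t a \<tau> = 0"
  proof -
    have "(\<lambda>n. \<tau>s (r n) * Z (xs (r n)) (ts (r n)) (as (r n)) (\<tau>s (r n))) \<longlonglongrightarrow> \<tau> * Z x t a \<tau>"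
      by (intro tendsto_mult \<tau> Zl)
    moreover have "\<tau>s (r n) * Z (xs (r n)) (ts (r n)) (as (r n)) (\<tau>s (r n)) = 0" for n using A(4)[of "r n"] by auto
    ultimately show ?thesis by (simp add: LIMSEQ_const_iff)
  qed
  \<comment> \<open>At time \<open>t\<close> the curve is at x > 0, and t > 0, so the product would
    not vanish.\<close>
  have "\<tau> \<noteq> t" using prod x t by auto
  then have \<tau>t: "\<tau> < t" using \<tau>0 by simp
  have nn: "0 \<le> Z x t a \<theta>" if \<theta>: "\<tau> \<le> \<theta>" "\<theta> \<le> t" for \<theta>
  proof -
    \<comment> \<open>\<theta> is clamped between the foot and apex times of the n-th curve, where
      nonnegativity is known.\<close>
    define \<theta>s where "\<theta>s n = max (\<tau>s (r n)) (min \<theta> (ts (r n)))" for n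
    have "\<theta>s \<longlonglongrightarrow> max \<tau> (min \<theta> t)" unfolding \<theta>s_def by (intro tendsto_max tendsto_min \<tau> t' tendsto_const)
    moreover have "max \<tau> (min \<theta> t) = \<theta>" using \<theta> by auto
    moreover have pos: "0 \<le> \<theta>s n" for n using A(1)[of "r n"] by (simp add: \<theta>s_def le_max_iff_disj)
    ultimately have "(\<lambda>n. Z (xs (r n)) (ts (r n)) (as (r n)) (\<theta>s n)) \<longlonglongrightarrow> Z x t a \<theta>"
      by (intro Z_tendsto x' t' a A A') auto
    moreover have "0 \<le> Z (xs (r n)) (ts (r n)) (as (r n)) (\<theta>s n)" for n
      by (rule A(3)) (use A(2)[of "r n"] in \<open>auto simp: \<theta>s_def\<close>)
    ultimately show ?thesis by (intro LIMSEQ_le_const) auto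
  qed
  have admL: "adm x t a \<tau>" using \<tau>0 \<tau>t nn prod by (auto simp: adm_def)
  have "(\<lambda>n. val (xs (r n)) (ts (r n)) (as (r n)) (\<tau>s (r n))) \<longlonglongrightarrow> val x t a \<tau>"
  proof -
    obtain M where M: "0 \<le> M" "\<And>x y. 0 \<le> x \<Longrightarrow> 0 \<le> y \<Longrightarrow> \<bar>U0 x - U0 y\<bar> \<le> M * \<bar>x - y\<bar>"
      using U0_lipschitz by blast
    let ?z = "\<lambda>n. Z (xs (r n)) (ts (r n)) (as (r n)) (\<tau>s (r n))"
    have z0: "0 \<le> ?z n" for n using A(2,3)[of "r n"] by auto
    have "(\<lambda>n. U0 (?z n) - U0 (Z x t a \<tau>)) \<longlonglongrightarrow> 0"
      by (rule tendsto_0_le[where K = M, OF LIM_zero[OF Zl]])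
        (use M(2)[OF z0 nn] \<tau>t in \<open>auto intro!: always_eventually simp: mult.commute\<close>)
    then have "(\<lambda>n. U0 (?z n) + V 0 (\<tau>s (r n))) \<longlonglongrightarrow> U0 (Z x t a \<tau>) + V 0 \<tau>"
      by (intro tendsto_add V_boundary_tendsto \<tau> A) (simp add: LIM_zero_iff)
    moreover have "(\<lambda>n. cost (as (r n)) (\<tau>s (r n)) (ts (r n))) \<longlonglongrightarrow> cost a \<tau> t"
      unfolding cost_def by (intro tendsto_intros Phi_tendsto F_tendsto a \<tau> t') (use A A' \<tau>0 t in auto)
    ultimately show ?thesis
      unfolding val_def val_boundary[OF adm] val_boundary[OF admL] by (rule tendsto_add)
  qed
  then have lim: "(\<lambda>n. val (xs (r n)) (ts (r n)) (as (r n)) (\<tau>s (r n)) - es (r n)) \<longlonglongrightarrow> val x t a \<tau> - 0"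
    by (intro tendsto_diff e')
  \<comment> \<open>By upper semicontinuity the near-minimal values cannot exceed
    \<open>V x t\<close> in the limit.\<close>
  have "val x t a \<tau> \<le> V x t"
  proof (rule field_le_epsilon)
    fix e :: real assume "0 < e"
    then obtain d where d: "0 < d" "\<forall>x' t'. \<bar>x' - x\<bar> < d \<longrightarrow> \<bar>t' - t\<bar> < d \<longrightarrow> V x' t' < V x t + e"
      using V_upper_semicontinuous[OF x t] by metis
    have "eventually (\<lambda>n. \<bar>xs (r n) - x\<bar> < d) sequentially" "eventually (\<lambda>n. \<bar>ts (r n) - t\<bar> < d) sequentially"
      using tendstoD[OF x' d(1)] tendstoD[OF t' d(1)] by (auto simp: dist_real_def)
    then have "eventually (\<lambda>n. val (xs (r n)) (ts (r n)) (as (r n)) (\<tau>s (r n)) - es (r n) \<le> V x t + e) sequentially"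
    proof eventually_elim
      case (elim n)
      then have "V (xs (r n)) (ts (r n)) < V x t + e" using d(2) by blast
      then show ?case using near[of "r n"] by linarith
    qed
    then show "val x t a \<tau> \<le> V x t + e" using tendsto_upperbound[OF lim] by simp
  qed
  moreover have "V x t \<le> val x t a \<tau>" by (rule V_le_val) (use admL in \<open>auto simp: adm_def\<close>)
  ultimately show ?thesis using that[OF r _ _ admL] a \<tau> by (auto simp: o_def)
qed

text \<open>Two optimal curves with different speeds at an interior point could be shortcut by a single
  \<open>h\<close>-curve around that point, which is strictly cheaper by strict convexity.\<close>

lemma opt_unique:
  assumes o1: "opt x t a \<tau>" and s: "\<tau> < s" "s < t" and pos: "0 < Z x t a s"
    and o2: "opt (Z x t a s) s c \<tau>'"
  shows "c = a"
proof (rule ccontr)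
  assume ca: "c \<noteq> a"
  define p where "p = Z x t a s"
  define K where "K = max \<bar>a\<bar> \<bar>c\<bar>"
  have \<tau>: "0 \<le> \<tau>" "0 \<le> \<tau>'" "\<tau>' < s" using o1 o2 by (auto simp: opt_def)
  obtain G where G: "0 < G" "\<forall>a \<theta>. \<bar>a\<bar> \<le> K \<longrightarrow> 0 \<le> \<theta> \<longrightarrow> \<theta> \<le> t \<longrightarrow> \<bar>spd a \<theta>\<bar> \<le> G"
    by (rule spd_bounded)
  \<comment> \<open>p / (4 * G) keeps the shortcut off the boundary: its apex is at least at p - G *
    \<delta>, and over the time 2 * \<delta> it descends at most 2 * G * \<delta>.\<close>
  define \<delta> where "\<delta> = min (min ((s - \<tau>) / 2) ((s - \<tau>') / 2)) (min ((t - s) / 2) (p / (4 * G)))"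
  have p0: "0 < p" using pos by (simp add: p_def)
  have \<delta>: "0 < \<delta>" "\<delta> \<le> (s - \<tau>) / 2" "\<delta> \<le> (s - \<tau>') / 2" "\<delta> \<le> (t - s) / 2" "\<delta> \<le> p / (4 * G)"
  proof -
    show "0 < \<delta>" using s \<tau> p0 G(1) by (simp add: \<delta>_def)
  qed (simp_all only: \<delta>_def min_le_iff_disj order_refl, simp_all)
  have ord: "\<tau> < s - \<delta>" "\<tau>' < s - \<delta>" "s + \<delta> < t" "0 \<le> s - \<delta>"
  proof -
    have "2 * \<delta> \<le> s - \<tau>" "2 * \<delta> \<le> s - \<tau>'" "2 * \<delta> \<le> t - s" using \<delta>(2-4) by simp_all
    then show "\<tau> < s - \<delta>" "\<tau>' < s - \<delta>" "s + \<delta> < t" "0 \<le> s - \<delta>"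
      using \<delta>(1) s \<tau> by linarith+
  qed
  have G\<delta>: "4 * (G * \<delta>) \<le> p" using \<delta>(5) G(1) by (simp add: field_simps)
  define q1 q2 where "q1 = Z p s c (s - \<delta>)" and "q2 = Z x t a (s + \<delta>)"
  obtain e where e: "Phi e (s + \<delta>) - Phi e (s - \<delta>) = q2 - q1"
    using Phi_incr_surj[of "s - \<delta>" "s + \<delta>" "q2 - q1"] ord \<delta>(1) by auto
  have d1: "Phi c s - Phi c (s - \<delta>) = p - q1" by (simp add: q1_def Z_def)
  have d2: "Phi a (s + \<delta>) - Phi a s = q2 - p" by (simp add: q2_def p_def Z_def)
  \<comment> \<open>The displacement of the shortcut is the sum of those of the two pieces, so its
    parameter lies between \<open>a\<close> and \<open>c\<close> and the speed bound
    \<open>G\<close> applies to it.\<close>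
  have "e \<le> max a c"
  proof (rule ccontr)
    assume "\<not> e \<le> max a c"
    then have "a < e" "c < e" by auto
    then show False using Phi_incr_less[of "s - \<delta>" s c e] Phi_incr_less[of s "s + \<delta>" a e] d1 d2 e ord \<delta>(1) by auto
  qed
  moreover have "min a c \<le> e"
  proof (rule ccontr)
    assume "\<not> min a c \<le> e"
    then have "e < a" "e < c" by auto
    then show False using Phi_incr_less[of "s - \<delta>" s e c] Phi_incr_less[of s "s + \<delta>" e a] d1 d2 e ord \<delta>(1) by auto
  qed
  ultimately have eK: "\<bar>e\<bar> \<le> K" by (auto simp: K_def)
  have aK: "\<bar>a\<bar> \<le> K" by (simp add: K_def)
  have Ze: "Z q2 (s + \<delta>) e (s - \<delta>) = q1" using e by (simp add: Z_def)
  have "- G * \<delta> \<le> q2 - p"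
  proof -
    have "- G \<le> spd a \<theta>" if "s \<le> \<theta>" "\<theta> \<le> s + \<delta>" for \<theta>
      using G(2)[rule_format, of a \<theta>] aK that ord \<delta>(1) by (auto simp: abs_le_iff)
    then show ?thesis using Phi_incr_ge[of s "s + \<delta>" "- G" a] ord \<delta>(1) d2 by auto
  qed
  then have q2: "p - G * \<delta> \<le> q2" by simp
  have nn: "0 \<le> Z q2 (s + \<delta>) e \<theta>" if \<theta>: "s - \<delta> \<le> \<theta>" "\<theta> \<le> s + \<delta>" for \<theta>
  proof -
    have "q2 - G * (s + \<delta> - \<theta>) \<le> Z q2 (s + \<delta>) e \<theta>"
      by (rule Z_lower[OF G(2) eK]) (use \<theta> ord in auto)
    moreover have "G * (s + \<delta> - \<theta>) \<le> G * (2 * \<delta>)" using \<theta> G(1) by (intro mult_left_mono) auto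
    ultimately show ?thesis using q2 G\<delta> p0 by linarith
  qed
  have "V q2 (s + \<delta>) \<le> val q2 (s + \<delta>) e (s - \<delta>)"
    by (rule V_le_val) (use nn ord \<delta>(1) in auto)
  then have le: "V q2 (s + \<delta>) \<le> V q1 (s - \<delta>) + cost e (s - \<delta>) (s + \<delta>)" by (simp add: val_def Ze)
  have "opt x t a s" "opt x t a (s + \<delta>)"
    by (rule opt_later[OF o1]; use ord s \<delta>(1) in auto)+
  then have "V q2 (s + \<delta>) = V p s + cost a s (s + \<delta>)"
    by (simp add: opt_def val_def q2_def p_def flip: cost_split[of a s "s + \<delta>" t])
  moreover have "opt p s c (s - \<delta>)" unfolding p_def by (rule opt_later[OF o2]) (use ord \<delta>(1) in auto)
  then have "V p s = V q1 (s - \<delta>) + cost c (s - \<delta>) s" by (simp add: opt_def val_def q1_def)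
  ultimately have "cost c (s - \<delta>) s + cost a s (s + \<delta>) \<le> cost e (s - \<delta>) (s + \<delta>)" using le by simp
  moreover have "cost e (s - \<delta>) (s + \<delta>) =
      (e * (Phi c s - Phi c (s - \<delta>)) - (F e s - F e (s - \<delta>))) + (e * (Phi a (s + \<delta>) - Phi a s) - (F e (s + \<delta>) - F e s))"
    unfolding cost_def d1 d2 e by (simp add: algebra_simps)
  moreover have "e * (Phi c s - Phi c (s - \<delta>)) - (F e s - F e (s - \<delta>)) \<le> cost c (s - \<delta>) s"
    "e * (Phi a (s + \<delta>) - Phi a s) - (F e (s + \<delta>) - F e s) \<le> cost a s (s + \<delta>)"
    by (intro duality; use ord \<delta>(1) in auto)+
  \<comment> \<open>\<open>e\<close> differs from at least one of \<open>a\<close> and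
    \<open>c\<close>, so one of the two lower bounds is strict.\<close>
  moreover have "e \<noteq> c \<Longrightarrow> e * (Phi c s - Phi c (s - \<delta>)) - (F e s - F e (s - \<delta>)) < cost c (s - \<delta>) s"
    by (intro duality_less) (use ord \<delta>(1) in auto)
  moreover have "e \<noteq> a \<Longrightarrow> e * (Phi a (s + \<delta>) - Phi a s) - (F e (s + \<delta>) - F e s) < cost a s (s + \<delta>)"
    by (intro duality_less) (use ord \<delta>(1) in auto)
  ultimately show False using ca by (cases "e = c") auto
qed

section \<open>Non-crossing, extreme parameters and limits of minimizers\<close>

lemma mini_opt_from:
  assumes "mini x t a" "0 < \<theta>" "\<theta> < t" and pos: "\<And>\<theta>'. \<theta> \<le> \<theta>' \<Longrightarrow> \<theta>' \<le> t \<Longrightarrow> 0 < Z x t a \<theta>'"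
  obtains \<tau> where "opt x t a \<tau>" "\<tau> < \<theta>" "opt x t a \<theta>"
proof -
  obtain \<tau> where \<tau>: "opt x t a \<tau>" "\<tau> = 0 \<or> Z x t a \<tau> = 0" using mini_opt[OF assms(1)] by blast
  have "\<tau> < t" using \<tau>(1) by (simp add: opt_def)
  then have "\<tau> < \<theta>" using \<tau>(2) assms(2) pos[of \<tau>] by (cases "\<theta> \<le> \<tau>") auto
  then show ?thesis using that[OF \<tau>(1)] opt_later[OF \<tau>(1), of \<theta>] assms(3) by simp
qed

text \<open>At a crossing the initial part of the second curve is optimal for the crossing point, so
  \<open>opt_unique\<close> makes the parameters equal. Curves with equal parameters are translates
  and do not meet when their apices differ.\<close>

lemma no_crossing:
  assumes m: "mini z1 t a1" "mini z2 t a2" and z: "z1 < z2" and \<theta>: "0 < \<theta>" "\<theta> < t"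
    and pos: "\<And>s. \<theta> \<le> s \<Longrightarrow> s \<le> t \<Longrightarrow> 0 < Z z1 t a1 s" "\<And>s. \<theta> \<le> s \<Longrightarrow> s \<le> t \<Longrightarrow> 0 < Z z2 t a2 s"
  shows "Z z1 t a1 \<theta> \<le> Z z2 t a2 \<theta>"
proof (rule ccontr)
  assume "\<not> ?thesis"
  then have gt: "Z z2 t a2 \<theta> < Z z1 t a1 \<theta>" by simp
  obtain \<tau>1 where o1: "opt z1 t a1 \<tau>1" "\<tau>1 < \<theta>" using mini_opt_from[OF m(1) \<theta> pos(1)] by blast
  obtain \<tau>2 where o2: "opt z2 t a2 \<tau>2" "\<tau>2 < \<theta>" using mini_opt_from[OF m(2) \<theta> pos(2)] by blast
  let ?k = "\<lambda>s. Z z2 t a2 s - Z z1 t a1 s"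
  have "continuous_on {\<theta>..t} ?k"
    using \<theta> by (intro continuous_intros continuous_on_subset[OF Z_cont]) auto
  then obtain s where s: "\<theta> \<le> s" "s \<le> t" "?k s = 0"
    using IVT'[of ?k \<theta> 0 t] gt z \<theta> by auto
  have st: "s < t" using s z by (cases "s = t") auto
  have eq: "Z z1 t a1 s = Z z2 t a2 s" using s by simp
  have "opt (Z z2 t a2 s) s a2 \<tau>2" by (rule opt_initial_part[OF o2(1)]) (use s o2 in auto)
  then have "a2 = a1" using opt_unique[OF o1(1), of s a2 \<tau>2] eq s st o1 pos(1)[of s] by simp
  then show False using eq z by (simp add: Z_def)
qed

lemma mini_bounded:
  assumes x: "0 < x" and t: "0 < t"
  obtains K \<delta> where "0 < \<delta>" "\<forall>x' t' a. \<bar>x' - x\<bar> < \<delta> \<longrightarrow> \<bar>t' - t\<bar> < \<delta> \<longrightarrow> mini x' t' a \<longrightarrow> \<bar>a\<bar> \<le> K"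
proof -
  obtain K \<delta> where K: "0 < \<delta>" "\<forall>x' t' a \<tau>. \<bar>x' - x\<bar> < \<delta> \<longrightarrow> \<bar>t' - t\<bar> < \<delta> \<longrightarrow> adm x' t' a \<tau> \<longrightarrow>
      val x' t' a \<tau> \<le> V x' t' + 1 \<longrightarrow> \<bar>a\<bar> \<le> K"
    by (rule near_minimizers_bounded[OF x t])
  then have "\<forall>x' t' a. \<bar>x' - x\<bar> < \<delta> \<longrightarrow> \<bar>t' - t\<bar> < \<delta> \<longrightarrow> mini x' t' a \<longrightarrow> \<bar>a\<bar> \<le> K"
    by (auto simp: mini_def)
  then show ?thesis using that[OF K(1)] by blast
qed

lemma minis_subsequence:
  assumes x: "0 < x" and t: "0 < t" and xs: "xs \<longlonglongrightarrow> x" and ts: "ts \<longlonglongrightarrow> t"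
    and m: "\<And>n. mini (xs n) (ts n) (as n)"
  obtains r a where "strict_mono (r :: nat \<Rightarrow> nat)" "(as \<circ> r) \<longlonglongrightarrow> a" "mini x t a"
proof -
  obtain \<tau>s where \<tau>s: "\<And>n. adm (xs n) (ts n) (as n) (\<tau>s n)" "\<And>n. val (xs n) (ts n) (as n) (\<tau>s n) = V (xs n) (ts n)"
    using m unfolding mini_def by metis
  have near: "\<And>n. val (xs n) (ts n) (as n) (\<tau>s n) \<le> V (xs n) (ts n) + (\<lambda>_. 0) n" using \<tau>s(2) by simp
  obtain r a \<tau> where "strict_mono (r :: nat \<Rightarrow> nat)" "(as \<circ> r) \<longlonglongrightarrow> a" "adm x t a \<tau>" "val x t a \<tau> = V x t"
    using near_minimizers_converge[OF x t xs ts \<tau>s(1) near tendsto_const] by metis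
  then show ?thesis using that unfolding mini_def by blast
qed

text \<open>Subsequence principle: a subsequence staying away from \<open>a\<close> would contain
  one that converges to a minimizing parameter, which \<open>uniq\<close> identifies with
  \<open>a\<close>. The guards in \<open>m\<close> admit finitely many apices outside the open
  quarter plane.\<close>

lemma minis_tendsto:
  assumes x: "0 < x" and t: "0 < t" and xs: "xs \<longlonglongrightarrow> x" and ts: "ts \<longlonglongrightarrow> t"
    and m: "\<And>n. 0 < xs n \<Longrightarrow> 0 < ts n \<Longrightarrow> mini (xs n) (ts n) (as n)"
    and uniq: "\<And>r a'. strict_mono (r :: nat \<Rightarrow> nat) \<Longrightarrow> (\<lambda>n. xs (r n)) \<longlonglongrightarrow> x \<Longrightarrow> (\<lambda>n. ts (r n)) \<longlonglongrightarrow> t \<Longrightarrow>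
      (\<And>n. mini (xs (r n)) (ts (r n)) (as (r n))) \<Longrightarrow> (\<lambda>n. as (r n)) \<longlonglongrightarrow> a' \<Longrightarrow> mini x t a' \<Longrightarrow> a' = a"
  shows "as \<longlonglongrightarrow> a"
proof (rule ccontr)
  assume "\<not> as \<longlonglongrightarrow> a"
  then obtain e where e: "0 < e" "\<not> eventually (\<lambda>n. \<bar>as n - a\<bar> < e) sequentially"
    unfolding tendsto_iff dist_real_def by blast
  have "eventually (\<lambda>n. 0 < xs n) sequentially" "eventually (\<lambda>n. 0 < ts n) sequentially"
    using order_tendstoD(1)[OF xs x] order_tendstoD(1)[OF ts t] by auto
  then have ev: "eventually (\<lambda>n. 0 < xs n \<and> 0 < ts n) sequentially" by eventually_elim simp
  have "\<exists>\<^sub>F n in sequentially. \<not> \<bar>as n - a\<bar> < e" using e(2) by (simp add: not_eventually)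
  then have "\<exists>\<^sub>F n in sequentially. \<not> \<bar>as n - a\<bar> < e \<and> 0 < xs n \<and> 0 < ts n"
    by (rule frequently_rev_mp) (use ev in eventually_elim, simp)
  then have "infinite {n. \<not> \<bar>as n - a\<bar> < e \<and> 0 < xs n \<and> 0 < ts n}"
    by (simp add: frequently_cofinite flip: cofinite_eq_sequentially)
  then obtain r1 :: "nat \<Rightarrow> nat" where r1: "strict_mono r1"
    "\<And>n. \<not> \<bar>as (r1 n) - a\<bar> < e \<and> 0 < xs (r1 n) \<and> 0 < ts (r1 n)"
    using infinite_enumerate by blast
  have xr: "(\<lambda>n. xs (r1 n)) \<longlonglongrightarrow> x" and tr: "(\<lambda>n. ts (r1 n)) \<longlonglongrightarrow> t"
    using LIMSEQ_subseq_LIMSEQ[OF xs r1(1)] LIMSEQ_subseq_LIMSEQ[OF ts r1(1)] by (simp_all add: o_def)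
  have mr: "mini (xs (r1 n)) (ts (r1 n)) (as (r1 n))" for n using m r1(2) by blast
  obtain r2 a' where r2: "strict_mono (r2 :: nat \<Rightarrow> nat)" "((\<lambda>n. as (r1 n)) \<circ> r2) \<longlonglongrightarrow> a'" "mini x t a'"
    using minis_subsequence[OF x t xr tr mr] by metis
  have lim: "(\<lambda>n. as (r1 (r2 n))) \<longlonglongrightarrow> a'" using r2(2) by (simp add: o_def)
  have "a' = a"
  proof (rule uniq[of "\<lambda>n. r1 (r2 n)"])
    show "strict_mono (\<lambda>n. r1 (r2 n))" using r1(1) r2(1) by (simp add: strict_mono_def)
    show "(\<lambda>n. xs (r1 (r2 n))) \<longlonglongrightarrow> x" "(\<lambda>n. ts (r1 (r2 n))) \<longlonglongrightarrow> t"
      using LIMSEQ_subseq_LIMSEQ[OF xr r2(1)] LIMSEQ_subseq_LIMSEQ[OF tr r2(1)] by (simp_all add: o_def)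
  qed (use mr lim r2(3) in auto)
  then have "eventually (\<lambda>n. \<bar>as (r1 (r2 n)) - a\<bar> < e) sequentially"
    using tendstoD[OF lim e(1)] by (simp add: dist_real_def)
  then show False using r1(2) by (auto simp: eventually_sequentially)
qed

lemma mini_exists:
  assumes x: "0 < x" and t: "0 < t"
  shows "\<exists>a. mini x t a"
proof -
  have "\<forall>n. \<exists>a \<tau>. adm x t a \<tau> \<and> val x t a \<tau> < V x t + inverse (real (Suc n))"
    using near_minimizer[OF x t] by simp
  then obtain as \<tau>s where *: "\<And>n. adm x t (as n) (\<tau>s n)" "\<And>n. val x t (as n) (\<tau>s n) < V x t + inverse (real (Suc n))"
    by metis
  obtain r a \<tau> where "strict_mono (r :: nat \<Rightarrow> nat)" "adm x t a \<tau>" "val x t a \<tau> = V x t"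
    using near_minimizers_converge[OF x t tendsto_const tendsto_const *(1) less_imp_le[OF *(2)] LIMSEQ_inverse_real_of_nat]
    by metis
  then show ?thesis unfolding mini_def by blast
qed

text \<open>Since parameters and positions are ordered oppositely, \<open>amax\<close> labels the
  leftmost and \<open>amin\<close> the rightmost minimizing curve.\<close>

definition amax :: "real \<Rightarrow> real \<Rightarrow> real" where "amax x t = Sup {a. mini x t a}"
definition amin :: "real \<Rightarrow> real \<Rightarrow> real" where "amin x t = Inf {a. mini x t a}"

lemma extreme_minis:
  assumes x: "0 < x" and t: "0 < t"
  shows "mini x t (amax x t)" "mini x t (amin x t)" "\<And>a. mini x t a \<Longrightarrow> a \<le> amax x t \<and> amin x t \<le> a"
proof -
  let ?S = "{a. mini x t a}"
  have ne: "?S \<noteq> {}" using mini_exists[OF x t] by simp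
  have "compact ?S"
    unfolding compact_def
  proof (intro allI impI)
    fix as assume "\<forall>n::nat. as n \<in> ?S"
    then have m: "\<And>n. mini x t (as n)" by simp
    show "\<exists>l\<in>?S. \<exists>r::nat \<Rightarrow> nat. strict_mono r \<and> (as \<circ> r) \<longlonglongrightarrow> l"
      by (rule minis_subsequence[OF x t tendsto_const tendsto_const m]) auto
  qed
  then obtain k c where "k \<in> ?S" "\<forall>a\<in>?S. a \<le> k" "c \<in> ?S" "\<forall>a\<in>?S. c \<le> a"
    using compact_attains_sup[OF _ ne] compact_attains_inf[OF _ ne] by blast
  then have bc: "mini x t k" "mini x t c" "\<And>a. mini x t a \<Longrightarrow> a \<le> k \<and> c \<le> a" by auto
  have "amax x t = k" unfolding amax_def by (rule cSup_eq_maximum) (use bc in auto)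
  moreover have "amin x t = c" unfolding amin_def by (rule cInf_eq_minimum) (use bc in auto)
  ultimately show "mini x t (amax x t)" "mini x t (amin x t)" "\<And>a. mini x t a \<Longrightarrow> a \<le> amax x t \<and> amin x t \<le> a"
    using bc by auto
qed

lemma amax_eq:
  assumes "0 < x" "0 < t" "mini x t k" "\<And>a. mini x t a \<Longrightarrow> a \<le> k"
  shows "amax x t = k"
proof (rule antisym)
  show "amax x t \<le> k" by (rule assms(4)[OF extreme_minis(1)[OF assms(1,2)]])
  show "k \<le> amax x t" using extreme_minis(3)[OF assms(1,2,3)] by simp
qed

lemma amin_eq:
  assumes "0 < x" "0 < t" "mini x t k" "\<And>a. mini x t a \<Longrightarrow> k \<le> a"
  shows "amin x t = k"
proof (rule antisym)
  show "k \<le> amin x t" by (rule assms(4)[OF extreme_minis(2)[OF assms(1,2)]])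
  show "amin x t \<le> k" using extreme_minis(3)[OF assms(1,2,3)] by simp
qed

text \<open>The common bound on the parameters provides one time \<theta> at which curves from all
  nearby apices can be compared off the boundary.\<close>

lemma mini_positive_near_apex:
  assumes x: "0 < x" and t: "0 < t"
  obtains \<delta> \<theta> where "0 < \<delta>" "0 < \<theta>" "\<theta> < t"
    "\<forall>x' t' a s. \<bar>x' - x\<bar> < \<delta> \<longrightarrow> \<bar>t' - t\<bar> < \<delta> \<longrightarrow> mini x' t' a \<longrightarrow> \<theta> \<le> s \<longrightarrow> s \<le> t' \<longrightarrow> 0 < Z x' t' a s"
proof -
  obtain K \<delta>1 where K: "0 < \<delta>1" "\<forall>x' t' a. \<bar>x' - x\<bar> < \<delta>1 \<longrightarrow> \<bar>t' - t\<bar> < \<delta>1 \<longrightarrow> mini x' t' a \<longrightarrow> \<bar>a\<bar> \<le> K"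
    by (rule mini_bounded[OF x t])
  obtain \<delta> where \<delta>: "0 < \<delta>" "3 * \<delta> < t"
    "\<forall>x' t' a \<theta>. \<bar>x' - x\<bar> < \<delta> \<longrightarrow> \<bar>t' - t\<bar> < \<delta> \<longrightarrow> \<bar>a\<bar> \<le> K \<longrightarrow> t - 2 * \<delta> \<le> \<theta> \<longrightarrow> \<theta> \<le> t' \<longrightarrow> 0 < Z x' t' a \<theta>"
    by (rule positive_near_apex[OF x t])
  have "0 < Z x' t' a s" if "\<bar>x' - x\<bar> < min \<delta> \<delta>1" "\<bar>t' - t\<bar> < min \<delta> \<delta>1" "mini x' t' a" "t - 2 * \<delta> \<le> s" "s \<le> t'" for x' t' a s
  proof -
    have "\<bar>a\<bar> \<le> K" using K(2)[rule_format, OF _ _ that(3)] that(1,2) by simp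
    then show ?thesis using \<delta>(3) that by simp
  qed
  then show ?thesis using that[of "min \<delta> \<delta>1" "t - 2 * \<delta>"] K(1) \<delta>(1,2) by auto
qed

text \<open>A minimizing curve from an apex on the left cannot cross the leftmost one from
  \<open>x\<close>, so a limit parameter is at least \<open>amax x t\<close>; being minimizing
  itself, it is also at most that.\<close>

lemma minis_tendsto_left:
  assumes x: "0 < x" and t: "0 < t" and zs: "zs \<longlonglongrightarrow> x" "\<And>n. zs n < x"
    and m: "\<And>n. 0 < zs n \<Longrightarrow> mini (zs n) t (as n)"
  shows "as \<longlonglongrightarrow> amax x t"
proof -
  obtain \<delta> \<theta> where \<delta>: "0 < \<delta>" and \<theta>: "0 < \<theta>" "\<theta> < t" and pos:
    "\<forall>x' t' a s. \<bar>x' - x\<bar> < \<delta> \<longrightarrow> \<bar>t' - t\<bar> < \<delta> \<longrightarrow> mini x' t' a \<longrightarrow> \<theta> \<le> s \<longrightarrow> s \<le> t' \<longrightarrow> 0 < Z x' t' a s"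
    by (rule mini_positive_near_apex[OF x t])
  note ex = extreme_minis[OF x t]
  show ?thesis
  proof (rule minis_tendsto[OF x t zs(1) tendsto_const m])
    fix r :: "nat \<Rightarrow> nat" and a' assume r: "strict_mono r" "(\<lambda>n. zs (r n)) \<longlonglongrightarrow> x" "\<And>n. mini (zs (r n)) t (as (r n))"
      "(\<lambda>n. as (r n)) \<longlonglongrightarrow> a'" "mini x t a'"
    have "(\<lambda>n. Z (zs (r n)) t (as (r n)) \<theta>) \<longlonglongrightarrow> Z x t a' \<theta>"
      by (rule Z_tendsto) (use r \<theta> in auto)
    moreover have "eventually (\<lambda>n. \<bar>zs (r n) - x\<bar> < \<delta>) sequentially"
      using tendstoD[OF r(2) \<delta>] by (simp add: dist_real_def)
    then have "eventually (\<lambda>n. Z (zs (r n)) t (as (r n)) \<theta> \<le> Z x t (amax x t) \<theta>) sequentially"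
    proof eventually_elim
      case (elim n)
      show ?case
        by (rule no_crossing[OF r(3) ex(1) zs(2) \<theta>]) (use pos \<delta> elim r(3) ex(1,2) in auto)
    qed
    ultimately have "Z x t a' \<theta> \<le> Z x t (amax x t) \<theta>" by (rule tendsto_upperbound) simp
    then have "amax x t \<le> a'" using Z_le_iff[of \<theta> t x a' "amax x t"] \<theta> by simp
    then show "a' = amax x t" using ex(3)[OF r(5)] by simp
  qed
qed

lemma minis_tendsto_right:
  assumes x: "0 < x" and t: "0 < t" and zs: "zs \<longlonglongrightarrow> x" "\<And>n. x < zs n"
    and m: "\<And>n. 0 < zs n \<Longrightarrow> mini (zs n) t (as n)"
  shows "as \<longlonglongrightarrow> amin x t"
proof -
  obtain \<delta> \<theta> where \<delta>: "0 < \<delta>" and \<theta>: "0 < \<theta>" "\<theta> < t" and pos: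
    "\<forall>x' t' a s. \<bar>x' - x\<bar> < \<delta> \<longrightarrow> \<bar>t' - t\<bar> < \<delta> \<longrightarrow> mini x' t' a \<longrightarrow> \<theta> \<le> s \<longrightarrow> s \<le> t' \<longrightarrow> 0 < Z x' t' a s"
    by (rule mini_positive_near_apex[OF x t])
  note ex = extreme_minis[OF x t]
  show ?thesis
  proof (rule minis_tendsto[OF x t zs(1) tendsto_const m])
    fix r :: "nat \<Rightarrow> nat" and a' assume r: "strict_mono r" "(\<lambda>n. zs (r n)) \<longlonglongrightarrow> x" "\<And>n. mini (zs (r n)) t (as (r n))"
      "(\<lambda>n. as (r n)) \<longlonglongrightarrow> a'" "mini x t a'"
    have "(\<lambda>n. Z (zs (r n)) t (as (r n)) \<theta>) \<longlonglongrightarrow> Z x t a' \<theta>"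
      by (rule Z_tendsto) (use r \<theta> in auto)
    moreover have "eventually (\<lambda>n. \<bar>zs (r n) - x\<bar> < \<delta>) sequentially"
      using tendstoD[OF r(2) \<delta>] by (simp add: dist_real_def)
    then have "eventually (\<lambda>n. Z x t (amin x t) \<theta> \<le> Z (zs (r n)) t (as (r n)) \<theta>) sequentially"
    proof eventually_elim
      case (elim n)
      show ?case
        by (rule no_crossing[OF ex(2) r(3) zs(2) \<theta>]) (use pos \<delta> elim r(3) ex(1,2) in auto)
    qed
    ultimately have "Z x t (amin x t) \<theta> \<le> Z x t a' \<theta>" by (rule tendsto_lowerbound) simp
    then have "a' \<le> amin x t" using Z_le_iff[of \<theta> t x "amin x t" a'] \<theta> by simp
    then show "a' = amin x t" using ex(3)[OF r(5)] by simp
  qed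
qed

text \<open>Bounding the increments of the value function from above by the optimal curve at \<open>(x, t)\<close> and
  from below by the optimal curves at the nearby points identifies its right derivative.\<close>

lemma V_derivative_along:
  assumes x: "0 < x" and t: "0 < t" and a: "mini x t a"
    and s: "s \<longlonglongrightarrow> t" "\<And>n. t < s n" and xs: "\<And>n. 0 < xs n"
    and D: "(\<lambda>n. (xs n - x) / (s n - t)) \<longlonglongrightarrow> D"
    and m: "\<And>n. mini (xs n) (s n) (as n)" and as: "as \<longlonglongrightarrow> a"
  shows "(\<lambda>n. (V (xs n) (s n) - V x t) / (s n - t)) \<longlonglongrightarrow> a * D - eng a t"
proof -
  have xlim: "xs \<longlonglongrightarrow> x"
  proof -
    have "(\<lambda>n. (xs n - x) / (s n - t) * (s n - t) + x) \<longlonglongrightarrow> D * (t - t) + x"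
      by (intro tendsto_intros D s)
    moreover have "(xs n - x) / (s n - t) * (s n - t) + x = xs n" for n using s(2)[of n] by simp
    ultimately show ?thesis by simp
  qed
  define K where "K = \<bar>a\<bar> + 1"
  obtain \<delta> where \<delta>: "0 < \<delta>" "3 * \<delta> < t"
    "\<forall>x' t' a \<theta>. \<bar>x' - x\<bar> < \<delta> \<longrightarrow> \<bar>t' - t\<bar> < \<delta> \<longrightarrow> \<bar>a\<bar> \<le> K \<longrightarrow> t - 2 * \<delta> \<le> \<theta> \<longrightarrow> \<theta> \<le> t' \<longrightarrow> 0 < Z x' t' a \<theta>"
    by (rule positive_near_apex[OF x t])
  define \<theta> where "\<theta> = t - 2 * \<delta>"
  have \<theta>: "0 < \<theta>" "\<theta> < t" using \<delta>(1,2) by (auto simp: \<theta>_def)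
  have \<theta>s: "\<theta> < s n" for n using \<theta> s(2)[of n] by simp
  have pos: "0 < Z x' t' c \<theta>'" if "\<bar>x' - x\<bar> < \<delta>" "\<bar>t' - t\<bar> < \<delta>" "\<bar>c\<bar> \<le> K" "\<theta> \<le> \<theta>'" "\<theta>' \<le> t'" for x' t' c \<theta>'
    using \<delta>(3) that by (simp add: \<theta>_def)
  have oa: "opt x t a \<theta>"
  proof (rule mini_opt_from[OF a \<theta>])
    show "0 < Z x t a \<theta>'" if "\<theta> \<le> \<theta>'" "\<theta>' \<le> t" for \<theta>'
      by (rule pos) (use that \<delta>(1) in \<open>auto simp: K_def\<close>)
  qed
  \<comment> \<open>Direct curves from the moving apex to a fixed point of the optimal curve: the
    competitors for the upper estimate.\<close>
  have "\<forall>n. \<exists>k. Phi k (s n) - Phi k \<theta> = xs n - Z x t a \<theta>"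
    using Phi_incr_surj[OF less_imp_le[OF \<theta>(1)] \<theta>s] by blast
  then obtain c where c: "\<And>n. Phi (c n) (s n) - Phi (c n) \<theta> = xs n - Z x t a \<theta>"
    by metis
  have c_lim: "c \<longlonglongrightarrow> a"
  proof (rule Phi_incr_converges[where r = "\<lambda>_. \<theta>", OF _ s(1) tendsto_const])
    have "(\<lambda>n. xs n - Z x t a \<theta>) \<longlonglongrightarrow> x - Z x t a \<theta>" by (intro tendsto_intros xlim)
    then show "(\<lambda>n. Phi (c n) (s n) - Phi (c n) \<theta>) \<longlonglongrightarrow> Phi a t - Phi a \<theta>"
      unfolding c Phi_incr_Z[of a t \<theta> x] .
  qed (use \<theta> \<theta>s in \<open>auto intro: less_imp_le\<close>)
  \<comment> \<open>Direct curves from (x, t) to the optimal curves of the moving apices: the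
    exchanged roles, read as a lower estimate.\<close>
  have "\<forall>n. \<exists>k. Phi k t - Phi k \<theta> = x - Z (xs n) (s n) (as n) \<theta>"
    using Phi_incr_surj[OF less_imp_le[OF \<theta>(1)] \<theta>(2)] by blast
  then obtain d where d: "\<And>n. Phi (d n) t - Phi (d n) \<theta> = x - Z (xs n) (s n) (as n) \<theta>"
    by metis
  have d_lim: "d \<longlonglongrightarrow> a"
  proof (rule Phi_incr_converges[where r = "\<lambda>_. \<theta>", OF _ tendsto_const tendsto_const])
    have "(\<lambda>n. Z (xs n) (s n) (as n) \<theta>) \<longlonglongrightarrow> Z x t a \<theta>"
      by (rule Z_tendsto) (use xlim s(1) as \<theta> order_trans[OF less_imp_le[OF t] less_imp_le[OF s(2)]] in auto)
    then have "(\<lambda>n. x - Z (xs n) (s n) (as n) \<theta>) \<longlonglongrightarrow> x - Z x t a \<theta>" by (intro tendsto_intros)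
    then show "(\<lambda>n. Phi (d n) t - Phi (d n) \<theta>) \<longlonglongrightarrow> Phi a t - Phi a \<theta>"
      unfolding d Phi_incr_Z[of a t \<theta> x] .
  qed (use \<theta> in auto)
  \<comment> \<open>Both bounds have this form with parameters tending to \<open>a\<close>, hence
    the same limit.\<close>
  have quot: "(\<lambda>n. k n * ((xs n - x) / (s n - t)) - (F (k n) (s n) - F (k n) t) / (s n - t)) \<longlonglongrightarrow> a * D - eng a t"
    if "k \<longlonglongrightarrow> a" for k
    by (intro tendsto_intros that D prim_quotient_tendsto[OF eng_cont2 that s]) (use t in simp)
  have evK: "eventually (\<lambda>n. \<bar>k n\<bar> \<le> K) sequentially" if "k \<longlonglongrightarrow> a" for k :: "nat \<Rightarrow> real"
    using tendstoD[OF that, of 1] by (auto simp: dist_real_def K_def elim!: eventually_mono)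
  have near: "eventually (\<lambda>n. \<bar>xs n - x\<bar> < \<delta> \<and> \<bar>s n - t\<bar> < \<delta>) sequentially"
    using tendstoD[OF xlim \<delta>(1)] tendstoD[OF s(1) \<delta>(1)] by (auto simp: dist_real_def eventually_conj_iff)
  have upper: "eventually (\<lambda>n. (V (xs n) (s n) - V x t) / (s n - t) \<le>
      c n * ((xs n - x) / (s n - t)) - (F (c n) (s n) - F (c n) t) / (s n - t)) sequentially"
    using near evK[OF c_lim]
  proof eventually_elim
    case (elim n)
    have "V (xs n) (s n) \<le> V x t + 0 + c n * (xs n - x) - (F (c n) (s n) - F (c n) t)"
    proof (rule V_increment_le)
      show "val x t a \<theta> \<le> V x t + 0" using oa by (simp add: opt_def)
      show "Z (xs n) (s n) (c n) \<theta> = Z x t a \<theta>" using c[of n] by (simp add: Z_def)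
    qed (use \<theta> \<theta>s pos elim in \<open>auto intro: less_imp_le\<close>)
    then have "(V (xs n) (s n) - V x t) / (s n - t) \<le> (c n * (xs n - x) - (F (c n) (s n) - F (c n) t)) / (s n - t)"
      using s(2)[of n] by (intro divide_right_mono) auto
    then show ?case unfolding times_divide_eq_right diff_divide_distrib[symmetric] .
  qed
  have lower: "eventually (\<lambda>n. d n * ((xs n - x) / (s n - t)) - (F (d n) (s n) - F (d n) t) / (s n - t) \<le>
      (V (xs n) (s n) - V x t) / (s n - t)) sequentially"
    using near evK[OF d_lim] evK[OF as]
  proof eventually_elim
    case (elim n)
    have on: "opt (xs n) (s n) (as n) \<theta>"
      using mini_opt_from[OF m \<theta>(1) \<theta>s pos, of n] elim by blast
    have "V x t \<le> V (xs n) (s n) + 0 + d n * (x - xs n) - (F (d n) t - F (d n) (s n))"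
    proof (rule V_increment_le)
      show "val (xs n) (s n) (as n) \<theta> \<le> V (xs n) (s n) + 0" using on by (simp add: opt_def)
      show "Z x t (d n) \<theta> = Z (xs n) (s n) (as n) \<theta>" using d[of n] by (simp add: Z_def)
    qed (use \<theta> \<theta>s pos elim \<delta>(1) in \<open>auto intro: less_imp_le\<close>)
    then have "(d n * (xs n - x) - (F (d n) (s n) - F (d n) t)) / (s n - t) \<le> (V (xs n) (s n) - V x t) / (s n - t)"
      using s(2)[of n] by (intro divide_right_mono) (auto simp: algebra_simps)
    then show ?case unfolding times_divide_eq_right diff_divide_distrib[symmetric] .
  qed
  show ?thesis by (rule tendsto_sandwich[OF lower upper quot[OF d_lim] quot[OF c_lim]])
qed

subsection \<open>Minimizers and characteristic triangles\<close>

lemma Z_has_derivative: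
  assumes "0 \<le> s" "\<theta> \<in> {s..t}"
  shows "(Z x t' a has_real_derivative spd a \<theta>) (at \<theta> within {s..t})"
proof -
  have "(Phi a has_real_derivative spd a \<theta>) (at \<theta> within {0..})"
    using prim_has_derivative[OF spd_cont] assms by auto
  then have "(Phi a has_real_derivative spd a \<theta>) (at \<theta> within {s..t})"
    by (rule DERIV_subset) (use assms in auto)
  then show ?thesis unfolding Z_def by (auto intro!: derivative_eq_intros)
qed

text \<open>The prescribed derivative fixes \<open>X\<close> up to a constant, and the apex fixes
  the constant. Outside {s..t} \<open>X\<close> is arbitrary, so curves are identified on that
  interval only.\<close>

lemma h_curve_slope_iff:
  assumes "0 \<le> s" "s \<le> t"
  shows "h_curve_slope f \<alpha> a X (x, t) (z, s) \<longleftrightarrow> Z x t a s = z \<and> (\<forall>\<theta>\<in>{s..t}. X \<theta> = Z x t a \<theta>)"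
proof
  assume h: "h_curve_slope f \<alpha> a X (x, t) (z, s)"
  have "\<exists>c. \<forall>\<theta>\<in>{s..t}. X \<theta> - Z x t a \<theta> = c"
  proof (rule has_field_derivative_zero_constant)
    fix \<theta> assume \<theta>: "\<theta> \<in> {s..t}"
    have "(X has_real_derivative spd a \<theta>) (at \<theta> within {s..t})"
      using h \<theta> by (simp add: h_curve_slope_def spd_def)
    then show "((\<lambda>\<theta>. X \<theta> - Z x t a \<theta>) has_real_derivative 0) (at \<theta> within {s..t})"
      using Z_has_derivative[OF assms(1) \<theta>, of x t a] by (auto intro!: derivative_eq_intros)
  qed simp
  then obtain c where c: "\<And>\<theta>. \<theta> \<in> {s..t} \<Longrightarrow> X \<theta> - Z x t a \<theta> = c" by blast
  have "c = 0" using c[of t] assms h by (simp add: h_curve_slope_def)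
  then have eq: "\<forall>\<theta>\<in>{s..t}. X \<theta> = Z x t a \<theta>" using c by simp
  then show "Z x t a s = z \<and> (\<forall>\<theta>\<in>{s..t}. X \<theta> = Z x t a \<theta>)"
    using h assms by (auto simp: h_curve_slope_def)
next
  assume h: "Z x t a s = z \<and> (\<forall>\<theta>\<in>{s..t}. X \<theta> = Z x t a \<theta>)"
  have "(X has_real_derivative spd a \<theta>) (at \<theta> within {s..t})" if "\<theta> \<in> {s..t}" for \<theta>
    using Z_has_derivative[OF assms(1) that, of x t a]
    by (rule has_field_derivative_transform_within[of _ _ _ _ 1]) (use h that in auto)
  then show "h_curve_slope f \<alpha> a X (x, t) (z, s)"
    using h assms by (simp add: h_curve_slope_def spd_def)
qed

lemma Z_inj: "\<lbrakk>0 \<le> s; s < t; Z x t a s = Z x t c s\<rbrakk> \<Longrightarrow> a = c"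
  using Phi_incr_inj[of s t a c] by (simp add: Z_def)

lemma h_curve_iff:
  assumes "0 \<le> s" "s < t" "Z x t a s = z"
  shows "h_curve f \<alpha> X (x, t) (z, s) \<longleftrightarrow> (\<forall>\<theta>\<in>{s..t}. X \<theta> = Z x t a \<theta>)"
  unfolding h_curve_def h_curve_slope_iff[OF assms(1) less_imp_le[OF assms(2)]]
  using Z_inj[OF assms(1,2)] assms(3) by metis

lemma h_eq:
  assumes "0 \<le> s" "s < t" "Z x t a s = 0"
  shows "h f \<alpha> x t s = a"
  unfolding h_def h_curve_slope_iff[OF assms(1) less_imp_le[OF assms(2)]]
proof (rule the_equality)
  show "\<exists>X. Z x t a s = 0 \<and> (\<forall>\<theta>\<in>{s..t}. X \<theta> = Z x t a \<theta>)" using assms by blast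
  show "c = a" if "\<exists>X. Z x t c s = 0 \<and> (\<forall>\<theta>\<in>{s..t}. X \<theta> = Z x t c \<theta>)" for c
    using Z_inj[OF assms(1,2), of x c a] that assms(3) by auto
qed

lemma h_initial_eq: "0 < t \<Longrightarrow> h f \<alpha> (x - Z x t a 0) t 0 = a"
  by (rule h_eq) (auto simp: Z_def)

lemma Z_surj: "0 \<le> s \<Longrightarrow> s < t \<Longrightarrow> \<exists>a. Z x t a s = z"
  using Phi_incr_surj[of s t "x - z"] by (metis Z_def diff_diff_eq2 add_diff_cancel_left' diff_add_cancel)

lemma LINT_spd: "0 \<le> r \<Longrightarrow> r \<le> s \<Longrightarrow> (LINT \<theta>:{r..s}|lebesgue. deriv f (a * exp (b \<theta>))) = Phi a s - Phi a r"
  using prim_diff[OF spd_cont, of r s a] by (simp add: spd_def[abs_def])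

lemma LINT_cost:
  assumes "0 \<le> r" "r \<le> s"
  shows "(LINT \<theta>:{r..s}|lebesgue. exp (- b \<theta>) * conjugate f (deriv f (a * exp (b \<theta>)))) = cost a r s"
proof -
  have eq: "exp (- b \<theta>) * conjugate f (deriv f (a * exp (b \<theta>))) = a * spd a \<theta> - eng a \<theta>" for \<theta>
    by (simp add: spd_def eng_def conjugate_eq algebra_simps exp_minus_inverse flip: exp_add)
  show ?thesis
    unfolding eq prim_diff[OF lin_cont assms]
    using assms by (simp add: prim_linear[OF spd_cont eng_cont] cost_def algebra_simps)
qed

text \<open>Foot and parameter determine each other, and \<open>y\<close> plus the integral up to
  \<open>\<tau>\<close> is the position of the curve at \<open>\<tau>\<close>.\<close>

lemma H_A_iff:
  assumes t: "0 < t"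
  shows "y \<in> H_A f \<alpha> x t \<longleftrightarrow> (\<exists>a. Z x t a 0 = y \<and> adm x t a 0)"
proof -
  obtain a where a: "Z x t a 0 = y" using Z_surj[of 0 t] t by auto
  have "y \<in> H_A f \<alpha> x t \<longleftrightarrow> (\<forall>\<tau>\<in>{0..t}. 0 \<le> Z x t a \<tau>)"
    unfolding H_A_def using a h_initial_eq[OF t, of x a] by (auto simp: LINT_spd Z_def)
  also have "\<dots> \<longleftrightarrow> adm x t a 0" using t by (auto simp: adm_def)
  also have "\<dots> \<longleftrightarrow> (\<exists>a. Z x t a 0 = y \<and> adm x t a 0)" using a Z_inj[of 0 t x] t by blast
  finally show ?thesis .
qed

lemma A_fun_eq: "adm x t a 0 \<Longrightarrow> A_fun f \<alpha> u0 (Z x t a 0) x t = val x t a 0"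
  using h_initial_eq[of t x a] V_initial[of "Z x t a 0"] LINT_cost[of 0 t a]
  by (auto simp: A_fun_def adm_def val_def prim_def)

lemma H_B_iff: "\<tau> \<in> H_B f \<alpha> x t \<longleftrightarrow> (\<exists>a. Z x t a \<tau> = 0 \<and> adm x t a \<tau>)"
proof (cases "0 \<le> \<tau> \<and> \<tau> < t")
  case True
  then obtain a where a: "Z x t a \<tau> = 0" using Z_surj[of \<tau> t x 0] by blast
  have "\<tau> \<in> H_B f \<alpha> x t \<longleftrightarrow> (\<forall>s\<in>{\<tau>..t}. 0 \<le> Z x t a s)"
    unfolding H_B_def using a True h_eq[of \<tau> t x a] by (auto simp: LINT_spd Z_def)
  also have "\<dots> \<longleftrightarrow> adm x t a \<tau>" using True a by (auto simp: adm_def)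
  also have "\<dots> \<longleftrightarrow> (\<exists>a. Z x t a \<tau> = 0 \<and> adm x t a \<tau>)" using a Z_inj[of \<tau> t x] True by metis
  finally show ?thesis .
qed (auto simp: H_B_def adm_def)

lemma B_fun_eq: "adm x t a \<tau> \<Longrightarrow> Z x t a \<tau> = 0 \<Longrightarrow> B_fun f \<alpha> u0 ub \<tau> x t = val x t a \<tau>"
  using h_eq[of \<tau> t x a] LINT_cost[of \<tau> t a] by (auto simp: B_fun_def adm_def val_def)

text \<open>Minimizers sorted by the axis of their foot. A curve ending in the corner (0, 0) counts
  for both.\<close>

definition mA :: "real \<Rightarrow> real \<Rightarrow> real \<Rightarrow> bool" where
  "mA x t a \<longleftrightarrow> adm x t a 0 \<and> val x t a 0 = V x t"
definition mB :: "real \<Rightarrow> real \<Rightarrow> real \<Rightarrow> real \<Rightarrow> bool" where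
  "mB x t a \<tau> \<longleftrightarrow> adm x t a \<tau> \<and> Z x t a \<tau> = 0 \<and> val x t a \<tau> = V x t"

lemma mini_iff: "mini x t a \<longleftrightarrow> mA x t a \<or> (\<exists>\<tau>. mB x t a \<tau>)"
  by (auto simp: mini_def mA_def mB_def adm_def)

lemma V_le_val_adm: "adm x t a \<tau> \<Longrightarrow> V x t \<le> val x t a \<tau>"
  by (rule V_le_val) (auto simp: adm_def)

lemma A_min_ge: "0 < t \<Longrightarrow> ereal (V x t) \<le> A_min f \<alpha> u0 x t"
  unfolding A_min_def by (rule INF_greatest) (auto simp: H_A_iff A_fun_eq V_le_val_adm)

lemma B_min_ge: "ereal (V x t) \<le> B_min f \<alpha> u0 ub x t"
  unfolding B_min_def by (rule INF_greatest) (auto simp: H_B_iff B_fun_eq V_le_val_adm)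

text \<open>If the infimum equals the value function, near-minimizers with constant foot time 0 have
  a limit, which is a minimizer with foot time 0. So comparing A with B amounts to asking which
  kinds of minimizers exist.\<close>

lemma A_min_eq_iff:
  assumes x: "0 < x" and t: "0 < t"
  shows "A_min f \<alpha> u0 x t = ereal (V x t) \<longleftrightarrow> (\<exists>a. mA x t a)"
proof
  assume eq: "A_min f \<alpha> u0 x t = ereal (V x t)"
  have "\<exists>a. adm x t a 0 \<and> val x t a 0 < V x t + inverse (real (Suc n))" for n
  proof -
    have "A_min f \<alpha> u0 x t < ereal (V x t + inverse (real (Suc n)))" unfolding eq by simp
    then obtain y where y: "y \<in> H_A f \<alpha> x t" "A_fun f \<alpha> u0 y x t < V x t + inverse (real (Suc n))"
      unfolding A_min_def INF_less_iff by auto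
    then show ?thesis using H_A_iff[OF t] A_fun_eq by metis
  qed
  then obtain as where as: "\<And>n. adm x t (as n) 0" "\<And>n. val x t (as n) 0 < V x t + inverse (real (Suc n))" by metis
  obtain r a \<tau> where r: "strict_mono (r :: nat \<Rightarrow> nat)" "((\<lambda>_. 0) \<circ> r) \<longlonglongrightarrow> \<tau>" "adm x t a \<tau>" "val x t a \<tau> = V x t"
    using near_minimizers_converge[OF x t tendsto_const tendsto_const as(1) less_imp_le[OF as(2)] LIMSEQ_inverse_real_of_nat]
    by metis
  have "\<tau> = 0" using r(2) by (simp add: o_def LIMSEQ_const_iff)
  then show "\<exists>a. mA x t a" using r(3,4) by (auto simp: mA_def)
next
  assume "\<exists>a. mA x t a"
  then obtain a where a: "adm x t a 0" "val x t a 0 = V x t" by (auto simp: mA_def)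
  have "A_min f \<alpha> u0 x t \<le> ereal (A_fun f \<alpha> u0 (Z x t a 0) x t)"
    unfolding A_min_def by (rule INF_lower) (use a H_A_iff[OF t] in blast)
  then show "A_min f \<alpha> u0 x t = ereal (V x t)" using A_fun_eq[OF a(1)] a(2) A_min_ge[OF t, of x] by (simp add: antisym)
qed

lemma B_min_eq_iff:
  assumes x: "0 < x" and t: "0 < t"
  shows "B_min f \<alpha> u0 ub x t = ereal (V x t) \<longleftrightarrow> (\<exists>a \<tau>. mB x t a \<tau>)"
proof
  assume eq: "B_min f \<alpha> u0 ub x t = ereal (V x t)"
  have "\<exists>a \<tau>. adm x t a \<tau> \<and> Z x t a \<tau> = 0 \<and> val x t a \<tau> < V x t + inverse (real (Suc n))" for n
  proof -
    have "B_min f \<alpha> u0 ub x t < ereal (V x t + inverse (real (Suc n)))" unfolding eq by simp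
    then obtain \<tau> where y: "\<tau> \<in> H_B f \<alpha> x t" "B_fun f \<alpha> u0 ub \<tau> x t < V x t + inverse (real (Suc n))"
      unfolding B_min_def INF_less_iff by auto
    then show ?thesis using H_B_iff B_fun_eq by metis
  qed
  then obtain as \<tau>s where as: "\<And>n. adm x t (as n) (\<tau>s n)" "\<And>n. Z x t (as n) (\<tau>s n) = 0"
    "\<And>n. val x t (as n) (\<tau>s n) < V x t + inverse (real (Suc n))" by metis
  obtain r a \<tau> where r: "strict_mono (r :: nat \<Rightarrow> nat)" "(as \<circ> r) \<longlonglongrightarrow> a" "(\<tau>s \<circ> r) \<longlonglongrightarrow> \<tau>" "adm x t a \<tau>" "val x t a \<tau> = V x t"
    using near_minimizers_converge[OF x t tendsto_const tendsto_const as(1) less_imp_le[OF as(3)] LIMSEQ_inverse_real_of_nat]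
    by metis
  have "(\<lambda>n. Z x t ((as \<circ> r) n) ((\<tau>s \<circ> r) n)) \<longlonglongrightarrow> Z x t a \<tau>"
    by (intro Z_tendsto tendsto_const r) (use t as(1) in \<open>auto simp: adm_def\<close>)
  then have "Z x t a \<tau> = 0" using as(2) by (simp add: o_def LIMSEQ_const_iff)
  then show "\<exists>a \<tau>. mB x t a \<tau>" using r(4,5) by (auto simp: mB_def)
next
  assume "\<exists>a \<tau>. mB x t a \<tau>"
  then obtain a \<tau> where a: "adm x t a \<tau>" "Z x t a \<tau> = 0" "val x t a \<tau> = V x t" by (auto simp: mB_def)
  have "B_min f \<alpha> u0 ub x t \<le> ereal (B_fun f \<alpha> u0 ub \<tau> x t)"
    unfolding B_min_def by (rule INF_lower) (use a H_B_iff in blast)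
  then show "B_min f \<alpha> u0 ub x t = ereal (V x t)" using B_fun_eq[OF a(1,2)] a(3) B_min_ge[of x t] by (simp add: antisym)
qed

lemma A_minimizers_eq:
  assumes t: "0 < t" and "mA x t a0"
  shows "A_minimizers f \<alpha> u0 x t = {Z x t a 0 |a. mA x t a}"
proof -
  have "y \<in> A_minimizers f \<alpha> u0 x t \<longleftrightarrow> (\<exists>a. y = Z x t a 0 \<and> adm x t a 0 \<and> (\<forall>c. adm x t c 0 \<longrightarrow> val x t a 0 \<le> val x t c 0))" for y
    unfolding A_minimizers_def is_arg_min_linorder mem_Collect_eq H_A_iff[OF t]
    using A_fun_eq by (metis (no_types, opaque_lifting))
  moreover have "adm x t a 0 \<and> (\<forall>c. adm x t c 0 \<longrightarrow> val x t a 0 \<le> val x t c 0) \<longleftrightarrow> mA x t a" for a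
    using assms(2) V_le_val_adm[of x t _ 0] unfolding mA_def by (metis order_antisym)
  ultimately show ?thesis by blast
qed

lemma B_minimizers_eq:
  assumes "mB x t a0 \<tau>0"
  shows "B_minimizers f \<alpha> u0 ub x t = {\<tau>. \<exists>a. mB x t a \<tau>}"
proof -
  have "\<tau> \<in> B_minimizers f \<alpha> u0 ub x t \<longleftrightarrow> (\<exists>a. Z x t a \<tau> = 0 \<and> adm x t a \<tau> \<and>
      (\<forall>c \<sigma>. Z x t c \<sigma> = 0 \<longrightarrow> adm x t c \<sigma> \<longrightarrow> val x t a \<tau> \<le> val x t c \<sigma>))" for \<tau>
    unfolding B_minimizers_def is_arg_min_linorder mem_Collect_eq H_B_iff
    using B_fun_eq by (metis (no_types, opaque_lifting))
  moreover have "Z x t a \<tau> = 0 \<and> adm x t a \<tau> \<and> (\<forall>c \<sigma>. Z x t c \<sigma> = 0 \<longrightarrow> adm x t c \<sigma> \<longrightarrow> val x t a \<tau> \<le> val x t c \<sigma>)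
      \<longleftrightarrow> mB x t a \<tau>" for a \<tau>
    using assms V_le_val_adm[of x t] unfolding mB_def by (metis order_antisym)
  ultimately show ?thesis by blast
qed

lemma extreme_mA:
  assumes x: "0 < x" and t: "0 < t" and "mA x t a0"
  obtains k c where "mA x t k" "y_min f \<alpha> u0 x t = Z x t k 0" "\<forall>a. mA x t a \<longrightarrow> a \<le> k"
    "mA x t c" "y_max f \<alpha> u0 x t = Z x t c 0" "\<forall>a. mA x t a \<longrightarrow> c \<le> a"
proof -
  have ne: "{a. mA x t a} \<noteq> {}" using assms(3) by blast
  have "compact {a. mA x t a}"
    unfolding compact_def
  proof (intro allI impI)
    fix as assume "\<forall>n::nat. as n \<in> {a. mA x t a}"
    then have m: "\<And>n. adm x t (as n) 0" "\<And>n. val x t (as n) 0 \<le> V x t + 0" by (auto simp: mA_def)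
    obtain r a \<tau> where r: "strict_mono (r :: nat \<Rightarrow> nat)" "(as \<circ> r) \<longlonglongrightarrow> a" "((\<lambda>_. 0) \<circ> r) \<longlonglongrightarrow> \<tau>" "adm x t a \<tau>" "val x t a \<tau> = V x t"
      by (rule near_minimizers_converge[OF x t tendsto_const tendsto_const m tendsto_const])
    have "\<tau> = 0" using r(3) by (simp add: o_def LIMSEQ_const_iff)
    then show "\<exists>l\<in>{a. mA x t a}. \<exists>r::nat \<Rightarrow> nat. strict_mono r \<and> (as \<circ> r) \<longlonglongrightarrow> l"
      using r by (auto simp: mA_def)
  qed
  then obtain k c where kc: "mA x t k" "mA x t c" "\<forall>a. mA x t a \<longrightarrow> a \<le> k" "\<forall>a. mA x t a \<longrightarrow> c \<le> a"
    using compact_attains_sup[OF _ ne] compact_attains_inf[OF _ ne] by blast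
  have "y_min f \<alpha> u0 x t = Z x t k 0"
    unfolding y_min_def A_minimizers_eq[OF t assms(3)]
    by (rule cInf_eq_minimum) (use kc t in \<open>auto simp: Z_le_iff\<close>)
  moreover have "y_max f \<alpha> u0 x t = Z x t c 0"
    unfolding y_max_def A_minimizers_eq[OF t assms(3)]
    by (rule cSup_eq_maximum) (use kc t in \<open>auto simp: Z_le_iff\<close>)
  ultimately show ?thesis using that[of k c] kc by blast
qed

text \<open>Later feet belong to larger parameters: at the later of two foot times the other curve
  is still nonnegative, hence not to the left of the one that is at 0.\<close>

lemma extreme_mB:
  assumes x: "0 < x" and t: "0 < t" and "mB x t a0 \<tau>0"
  obtains k c where "mB x t k (tau_max f \<alpha> u0 ub x t)" "\<forall>a \<tau>. mB x t a \<tau> \<longrightarrow> a \<le> k"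
    "mB x t c (tau_min f \<alpha> u0 ub x t)" "\<forall>a \<tau>. mB x t a \<tau> \<longrightarrow> c \<le> a"
proof -
  let ?S = "{\<tau>. \<exists>a. mB x t a \<tau>}"
  have ne: "?S \<noteq> {}" using assms(3) by blast
  have "compact ?S"
    unfolding compact_def
  proof (intro allI impI)
    fix \<tau>s assume "\<forall>n::nat. \<tau>s n \<in> ?S"
    then obtain as where "\<And>n. mB x t (as n) (\<tau>s n)" by (simp add: mem_Collect_eq) metis
    then have m: "\<And>n. adm x t (as n) (\<tau>s n)" "\<And>n. val x t (as n) (\<tau>s n) \<le> V x t + 0" "\<And>n. Z x t (as n) (\<tau>s n) = 0"
      by (auto simp: mB_def)
    obtain r a \<tau> where r: "strict_mono (r :: nat \<Rightarrow> nat)" "(as \<circ> r) \<longlonglongrightarrow> a" "(\<tau>s \<circ> r) \<longlonglongrightarrow> \<tau>" "adm x t a \<tau>" "val x t a \<tau> = V x t"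
      by (rule near_minimizers_converge[OF x t tendsto_const tendsto_const m(1,2) tendsto_const])
    have "(\<lambda>n. Z x t ((as \<circ> r) n) ((\<tau>s \<circ> r) n)) \<longlonglongrightarrow> Z x t a \<tau>"
      by (intro Z_tendsto tendsto_const r) (use t m(1) in \<open>auto simp: adm_def\<close>)
    then have "Z x t a \<tau> = 0" using m(3) by (simp add: o_def LIMSEQ_const_iff)
    then show "\<exists>l\<in>?S. \<exists>r::nat \<Rightarrow> nat. strict_mono r \<and> (\<tau>s \<circ> r) \<longlonglongrightarrow> l"
      using r by (auto simp: mB_def)
  qed
  then obtain \<tau>u \<tau>l where \<tau>: "\<tau>u \<in> ?S" "\<forall>\<tau>\<in>?S. \<tau> \<le> \<tau>u" "\<tau>l \<in> ?S" "\<forall>\<tau>\<in>?S. \<tau>l \<le> \<tau>"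
    using compact_attains_sup[OF _ ne] compact_attains_inf[OF _ ne] by blast
  have "tau_max f \<alpha> u0 ub x t = \<tau>u" "tau_min f \<alpha> u0 ub x t = \<tau>l"
    unfolding tau_max_def tau_min_def B_minimizers_eq[OF assms(3)]
    using ne \<tau> by (auto intro!: cSup_eq_maximum cInf_eq_minimum)
  moreover obtain k c where kc: "mB x t k \<tau>u" "mB x t c \<tau>l" using \<tau> by blast
  moreover have "a \<le> k" if m: "mB x t a \<tau>" for a \<tau>
  proof -
    have "\<tau> \<le> \<tau>u" using m \<tau>(2) by blast
    then have "0 \<le> Z x t a \<tau>u" using m kc(1) by (simp add: mB_def adm_def)
    then have "Z x t k \<tau>u \<le> Z x t a \<tau>u" using kc(1) by (simp add: mB_def)
    then show ?thesis using Z_le_iff[of \<tau>u t x k a] kc(1) by (simp add: mB_def adm_def)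
  qed
  moreover have "c \<le> a" if m: "mB x t a \<tau>" for a \<tau>
  proof -
    have "\<tau>l \<le> \<tau>" using m \<tau>(4) by blast
    then have "0 \<le> Z x t c \<tau>" using m kc(2) by (simp add: mB_def adm_def)
    then have "Z x t a \<tau> \<le> Z x t c \<tau>" using m by (simp add: mB_def)
    then show ?thesis using Z_le_iff[of \<tau> t x a c] m by (simp add: mB_def adm_def)
  qed
  ultimately show ?thesis using that[of k c] by blast
qed

lemma mA_le_mB:
  assumes "mA x t a" "mB x t c \<tau>"
  shows "a \<le> c"
proof -
  have "0 \<le> Z x t a \<tau>" using assms by (auto simp: mA_def mB_def adm_def)
  then have "Z x t c \<tau> \<le> Z x t a \<tau>" using assms by (simp add: mB_def)
  then show ?thesis using Z_le_iff[of \<tau> t x c a] assms by (simp add: mB_def adm_def)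
qed

lemma A_B_cases:
  assumes x: "0 < x" and t: "0 < t"
  shows "A_min f \<alpha> u0 x t < B_min f \<alpha> u0 ub x t \<longleftrightarrow> (\<exists>a. mA x t a) \<and> \<not> (\<exists>a \<tau>. mB x t a \<tau>)"
    and "B_min f \<alpha> u0 ub x t < A_min f \<alpha> u0 x t \<longleftrightarrow> \<not> (\<exists>a. mA x t a)"
proof -
  have "(\<exists>a. mA x t a) \<or> (\<exists>a \<tau>. mB x t a \<tau>)" using mini_exists[OF x t] by (auto simp: mini_iff)
  then show "A_min f \<alpha> u0 x t < B_min f \<alpha> u0 ub x t \<longleftrightarrow> (\<exists>a. mA x t a) \<and> \<not> (\<exists>a \<tau>. mB x t a \<tau>)"
    "B_min f \<alpha> u0 ub x t < A_min f \<alpha> u0 x t \<longleftrightarrow> \<not> (\<exists>a. mA x t a)"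
    using A_min_eq_iff[OF x t] B_min_eq_iff[OF x t] A_min_ge[OF t, of x] B_min_ge[of x t]
    by (metis order_less_le not_less_iff_gr_or_eq order_less_irrefl)+
qed

text \<open>The explicit formula selects the parameter of some minimizer, and the one-sided limits
  hold for any such selection.\<close>

lemma u_mini:
  assumes x: "0 < x" and t: "0 < t"
  shows "\<exists>a. mini x t a \<and> u f \<alpha> u0 ub x t = exp (b t) * a"
proof (cases "\<exists>a. mA x t a")
  case True
  then obtain k where k: "mA x t k" "y_min f \<alpha> u0 x t = Z x t k 0" using extreme_mA[OF x t] by metis
  have "A_min f \<alpha> u0 x t \<le> B_min f \<alpha> u0 ub x t" using True A_B_cases(2)[OF x t] by (simp add: not_less[symmetric])
  then have "u f \<alpha> u0 ub x t = exp (b t) * k" using k h_initial_eq[OF t, of x k] by (simp add: u_def)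
  then show ?thesis using k by (auto simp: mini_iff)
next
  case False
  then have "\<not> A_min f \<alpha> u0 x t \<le> B_min f \<alpha> u0 ub x t" using A_B_cases(2)[OF x t] by (simp add: not_le)
  moreover obtain a \<tau> where "mB x t a \<tau>" using mini_exists[OF x t] False by (auto simp: mini_iff)
  then obtain c where c: "mB x t c (tau_min f \<alpha> u0 ub x t)" using extreme_mB[OF x t] by metis
  moreover have "h f \<alpha> x t (tau_min f \<alpha> u0 ub x t) = c"
    by (rule h_eq) (use c in \<open>auto simp: mB_def adm_def\<close>)
  ultimately have "u f \<alpha> u0 ub x t = exp (b t) * c" by (simp add: u_def)
  then show ?thesis using c by (auto simp: mini_iff)
qed

text \<open>All feet lie before \<theta>, so the slice at \<theta> does not see the axes, and for x
  > 0 the cases of \<open>char_triangle\<close> agree there.\<close>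

lemma char_triangle_near_apex:
  assumes x: "0 < x" and t: "0 < t" and \<theta>: "0 < \<theta>" "\<theta> \<le> t"
    and pos: "\<And>a s. mini x t a \<Longrightarrow> \<theta> \<le> s \<Longrightarrow> s \<le> t \<Longrightarrow> 0 < Z x t a s"
  shows "(\<xi>, \<theta>) \<in> char_triangle f \<alpha> u0 ub x t \<longleftrightarrow> Z x t (amax x t) \<theta> \<le> \<xi> \<and> \<xi> \<le> Z x t (amin x t) \<theta>"
proof -
  note ex = extreme_minis[OF x t]
  have \<xi>0: "0 \<le> \<xi>" if "Z x t (amax x t) \<theta> \<le> \<xi>" using pos[OF ex(1), of \<theta>] \<theta> that by simp
  have late: "\<tau> < \<theta>" if "mB x t a \<tau>" for a \<tau>
  proof (rule ccontr)
    assume "\<not> \<tau> < \<theta>"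
    moreover have "\<tau> < t" "Z x t a \<tau> = 0" using that by (auto simp: mB_def adm_def)
    ultimately show False using pos[of a \<tau>] that by (auto simp: mini_iff)
  qed
  \<comment> \<open>The triangle quantifies over curves that are determined only from their foot
    time on; \<theta> lies beyond both feet, so their values there are forced.\<close>
  have ext: "(\<exists>\<gamma>1 \<gamma>2 :: real \<Rightarrow> real. (\<forall>\<theta>'\<in>{r1..t}. \<gamma>1 \<theta>' = Z x t a1 \<theta>') \<and> (\<forall>\<theta>'\<in>{r2..t}. \<gamma>2 \<theta>' = Z x t a2 \<theta>') \<and>
      P (\<gamma>1 \<theta>) (\<gamma>2 \<theta>)) \<longleftrightarrow> P (Z x t a1 \<theta>) (Z x t a2 \<theta>)" if "r1 \<le> \<theta>" "r2 \<le> \<theta>" for r1 r2 a1 a2 P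
    using that \<theta> by (metis atLeastAtMost_iff)
  consider (A) "\<exists>a. mA x t a" "\<not> (\<exists>a \<tau>. mB x t a \<tau>)" | (B) "\<not> (\<exists>a. mA x t a)" "\<exists>a \<tau>. mB x t a \<tau>"
    | (AB) "\<exists>a. mA x t a" "\<exists>a \<tau>. mB x t a \<tau>"
    using ex(1) unfolding mini_iff by blast
  then show ?thesis
  proof cases
    case A
    then obtain k c where k: "mA x t k" "y_min f \<alpha> u0 x t = Z x t k 0" "\<forall>a. mA x t a \<longrightarrow> a \<le> k"
      and c: "mA x t c" "y_max f \<alpha> u0 x t = Z x t c 0" "\<forall>a. mA x t a \<longrightarrow> c \<le> a"
      using extreme_mA[OF x t] by metis
    have kc: "amax x t = k" "amin x t = c"
      using A k c by (auto intro!: amax_eq amin_eq x t simp: mini_iff)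
    have "A_min f \<alpha> u0 x t < B_min f \<alpha> u0 ub x t" using A A_B_cases(1)[OF x t] by blast
    then have "(\<xi>, \<theta>) \<in> char_triangle f \<alpha> u0 ub x t \<longleftrightarrow>
        (\<exists>\<gamma>1 \<gamma>2. h_curve f \<alpha> \<gamma>1 (x, t) (Z x t k 0, 0) \<and> h_curve f \<alpha> \<gamma>2 (x, t) (Z x t c 0, 0) \<and>
             0 \<le> \<theta> \<and> \<theta> \<le> t \<and> \<gamma>1 \<theta> \<le> \<xi> \<and> \<xi> \<le> \<gamma>2 \<theta>)"
      using x k c by (simp add: char_triangle_def Let_def)
    also have "\<dots> \<longleftrightarrow> Z x t k \<theta> \<le> \<xi> \<and> \<xi> \<le> Z x t c \<theta>"
      unfolding h_curve_iff[OF order_refl t refl] using \<theta>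
      by (subst ext[of 0 0 k c "\<lambda>p q. 0 \<le> \<theta> \<and> \<theta> \<le> t \<and> p \<le> \<xi> \<and> \<xi> \<le> q"]) auto
    finally show ?thesis unfolding kc .
  next
    case B
    then obtain k c where k: "mB x t k (tau_max f \<alpha> u0 ub x t)" "\<forall>a \<tau>. mB x t a \<tau> \<longrightarrow> a \<le> k"
      and c: "mB x t c (tau_min f \<alpha> u0 ub x t)" "\<forall>a \<tau>. mB x t a \<tau> \<longrightarrow> c \<le> a"
      using extreme_mB[OF x t] by metis
    let ?u = "tau_max f \<alpha> u0 ub x t" and ?l = "tau_min f \<alpha> u0 ub x t"
    have kc: "amax x t = k" "amin x t = c"
      using B k c by (auto intro!: amax_eq amin_eq x t simp: mini_iff)
    have gt: "B_min f \<alpha> u0 ub x t < A_min f \<alpha> u0 x t" using B A_B_cases(2)[OF x t] by blast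
    then have "\<not> A_min f \<alpha> u0 x t < B_min f \<alpha> u0 ub x t" by (metis less_asym)
    then have "(\<xi>, \<theta>) \<in> char_triangle f \<alpha> u0 ub x t \<longleftrightarrow>
        (\<exists>\<gamma>1 \<gamma>2. h_curve f \<alpha> \<gamma>1 (x, t) (0, ?u) \<and> h_curve f \<alpha> \<gamma>2 (x, t) (0, ?l) \<and>
             ?l \<le> \<theta> \<and> \<theta> \<le> t \<and> 0 \<le> \<xi> \<and> (?u \<le> \<theta> \<longrightarrow> \<gamma>1 \<theta> \<le> \<xi>) \<and> \<xi> \<le> \<gamma>2 \<theta>)"
      using gt by (simp add: char_triangle_def Let_def)
    also have "\<dots> \<longleftrightarrow> 0 \<le> \<xi> \<and> Z x t k \<theta> \<le> \<xi> \<and> \<xi> \<le> Z x t c \<theta>"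
    proof -
      have h1: "h_curve f \<alpha> X (x, t) (0, ?u) \<longleftrightarrow> (\<forall>\<theta>\<in>{?u..t}. X \<theta> = Z x t k \<theta>)" for X
        by (rule h_curve_iff) (use k in \<open>auto simp: mB_def adm_def\<close>)
      have h2: "h_curve f \<alpha> X (x, t) (0, ?l) \<longleftrightarrow> (\<forall>\<theta>\<in>{?l..t}. X \<theta> = Z x t c \<theta>)" for X
        by (rule h_curve_iff) (use c in \<open>auto simp: mB_def adm_def\<close>)
      show ?thesis unfolding h1 h2 using late[OF k(1)] late[OF c(1)] \<theta>
        by (subst ext[of ?u ?l k c "\<lambda>p q. ?l \<le> \<theta> \<and> \<theta> \<le> t \<and> 0 \<le> \<xi> \<and> (?u \<le> \<theta> \<longrightarrow> p \<le> \<xi>) \<and> \<xi> \<le> q"]) auto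
    qed
    finally show ?thesis using \<xi>0 unfolding kc by blast
  next
    case AB
    then obtain c where c: "mA x t c" "y_max f \<alpha> u0 x t = Z x t c 0" "\<forall>a. mA x t a \<longrightarrow> c \<le> a"
      using extreme_mA[OF x t] by metis
    obtain k where k: "mB x t k (tau_max f \<alpha> u0 ub x t)" "\<forall>a \<tau>. mB x t a \<tau> \<longrightarrow> a \<le> k"
      using AB(2) extreme_mB[OF x t] by metis
    let ?u = "tau_max f \<alpha> u0 ub x t"
    have kc: "amax x t = k" "amin x t = c"
    proof -
      have "mini x t k" "mini x t c" using k(1) c(1) unfolding mini_iff by blast+
      moreover have "a \<le> k" "c \<le> a" if "mini x t a" for a
        using that k(2) c(3) mA_le_mB[OF _ k(1)] mA_le_mB[OF c(1)] unfolding mini_iff by blast+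
      ultimately show "amax x t = k" "amin x t = c" by (auto intro!: amax_eq amin_eq x t)
    qed
    have "\<not> A_min f \<alpha> u0 x t < B_min f \<alpha> u0 ub x t" "\<not> B_min f \<alpha> u0 ub x t < A_min f \<alpha> u0 x t"
      using AB A_B_cases[OF x t] by blast+
    then have "(\<xi>, \<theta>) \<in> char_triangle f \<alpha> u0 ub x t \<longleftrightarrow>
        (\<exists>\<gamma>1 \<gamma>2. h_curve f \<alpha> \<gamma>1 (x, t) (0, ?u) \<and> h_curve f \<alpha> \<gamma>2 (x, t) (Z x t c 0, 0) \<and>
             0 \<le> \<theta> \<and> \<theta> \<le> t \<and> 0 \<le> \<xi> \<and> (?u \<le> \<theta> \<longrightarrow> \<gamma>1 \<theta> \<le> \<xi>) \<and> \<xi> \<le> \<gamma>2 \<theta>)"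
      using c by (simp add: char_triangle_def Let_def)
    also have "\<dots> \<longleftrightarrow> 0 \<le> \<xi> \<and> Z x t k \<theta> \<le> \<xi> \<and> \<xi> \<le> Z x t c \<theta>"
    proof -
      have h1: "h_curve f \<alpha> X (x, t) (0, ?u) \<longleftrightarrow> (\<forall>\<theta>\<in>{?u..t}. X \<theta> = Z x t k \<theta>)" for X
        by (rule h_curve_iff) (use k in \<open>auto simp: mB_def adm_def\<close>)
      show ?thesis unfolding h1 h_curve_iff[OF order_refl t refl] using late[OF k(1)] \<theta>
        by (subst ext[of ?u 0 k c "\<lambda>p q. 0 \<le> \<theta> \<and> \<theta> \<le> t \<and> 0 \<le> \<xi> \<and> (?u \<le> \<theta> \<longrightarrow> p \<le> \<xi>) \<and> \<xi> \<le> q"]) auto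
    qed
    finally show ?thesis using \<xi>0 unfolding kc by blast
  qed
qed

subsection \<open>One-sided limits and the shock speed\<close>

lemma u_tendsto_within:
  assumes x: "0 < x" and t: "0 < t"
    and lim: "\<And>zs as. zs \<longlonglongrightarrow> x \<Longrightarrow> (\<And>n. zs n \<in> S - {x}) \<Longrightarrow>
      (\<And>n. 0 < zs n \<Longrightarrow> mini (zs n) t (as n)) \<Longrightarrow> as \<longlonglongrightarrow> k"
  shows "((\<lambda>z. u f \<alpha> u0 ub z t) \<longlongrightarrow> exp (b t) * k) (at x within S)"
  unfolding tendsto_at_iff_sequentially
proof (intro allI impI)
  fix zs assume zs: "\<forall>i. zs i \<in> S - {x}" "zs \<longlonglongrightarrow> x"
  have "\<forall>n. \<exists>a. 0 < zs n \<longrightarrow> mini (zs n) t a \<and> u f \<alpha> u0 ub (zs n) t = exp (b t) * a"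
    using u_mini[OF _ t] by blast
  then obtain as where as: "\<And>n. 0 < zs n \<Longrightarrow> mini (zs n) t (as n) \<and> u f \<alpha> u0 ub (zs n) t = exp (b t) * as n"
    by metis
  have "as \<longlonglongrightarrow> k" by (rule lim[OF zs(2)]) (use zs(1) as in auto)
  then have "(\<lambda>n. exp (b t) * as n) \<longlonglongrightarrow> exp (b t) * k" by (intro tendsto_intros)
  moreover have "eventually (\<lambda>n. exp (b t) * as n = ((\<lambda>z. u f \<alpha> u0 ub z t) \<circ> zs) n) sequentially"
    using order_tendstoD(1)[OF zs(2) x] by eventually_elim (use as in simp)
  ultimately show "((\<lambda>z. u f \<alpha> u0 ub z t) \<circ> zs) \<longlonglongrightarrow> exp (b t) * k"
    by (rule Lim_transform_eventually)
qed

lemma u_tendsto_left: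
  assumes "0 < x" "0 < t"
  shows "((\<lambda>z. u f \<alpha> u0 ub z t) \<longlongrightarrow> exp (b t) * amax x t) (at_left x)"
  by (rule u_tendsto_within[OF assms]) (rule minis_tendsto_left[OF assms], auto)

lemma u_tendsto_right:
  assumes "0 < x" "0 < t"
  shows "((\<lambda>z. u f \<alpha> u0 ub z t) \<longlongrightarrow> exp (b t) * amin x t) (at_right x)"
  by (rule u_tendsto_within[OF assms]) (rule minis_tendsto_right[OF assms], auto)

text \<open>With a single minimizing parameter, minimizers from any apices tending to (x, t)
  converge to it, which is joint continuity of \<open>u\<close>.\<close>

lemma discontinuity_amin_less_amax:
  assumes x: "0 < x" and t: "0 < t" and dis: "discontinuity_point f \<alpha> u0 ub x t"
  shows "amin x t < amax x t"
proof (rule ccontr)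
  note ex = extreme_minis[OF x t]
  assume "\<not> amin x t < amax x t"
  then have uniq: "a = amax x t" if "mini x t a" for a using ex(3)[OF that] by simp
  have "isCont (\<lambda>(x, t). u f \<alpha> u0 ub x t) (x, t)"
    unfolding continuous_at_sequentially
  proof (intro allI impI)
    fix ps assume ps: "ps \<longlonglongrightarrow> (x, t)"
    define xs ts where "xs n = fst (ps n)" and "ts n = snd (ps n)" for n :: nat
    have xs: "xs \<longlonglongrightarrow> x" and ts: "ts \<longlonglongrightarrow> t"
      using tendsto_fst[OF ps] tendsto_snd[OF ps] by (simp_all add: xs_def[abs_def] ts_def[abs_def])
    have "\<forall>n. \<exists>a. 0 < xs n \<longrightarrow> 0 < ts n \<longrightarrow> mini (xs n) (ts n) a \<and> u f \<alpha> u0 ub (xs n) (ts n) = exp (b (ts n)) * a"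
      using u_mini by blast
    then obtain as where as: "\<And>n. 0 < xs n \<Longrightarrow> 0 < ts n \<Longrightarrow>
        mini (xs n) (ts n) (as n) \<and> u f \<alpha> u0 ub (xs n) (ts n) = exp (b (ts n)) * as n"
      by metis
    have "as \<longlonglongrightarrow> amax x t"
      by (rule minis_tendsto[OF x t xs ts]) (use as uniq in auto)
    moreover have "(\<lambda>n. b (ts n)) \<longlonglongrightarrow> b t"
      using b_cont ts by (simp add: continuous_on_eq_continuous_at isCont_tendsto_compose)
    ultimately have "(\<lambda>n. exp (b (ts n)) * as n) \<longlonglongrightarrow> exp (b t) * amax x t" by (intro tendsto_intros)
    moreover have "eventually (\<lambda>n. exp (b (ts n)) * as n = ((\<lambda>(x, t). u f \<alpha> u0 ub x t) \<circ> ps) n) sequentially"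
      using order_tendstoD(1)[OF xs x] order_tendstoD(1)[OF ts t]
      by eventually_elim (use as in \<open>simp add: case_prod_beta xs_def ts_def\<close>)
    ultimately have "((\<lambda>(x, t). u f \<alpha> u0 ub x t) \<circ> ps) \<longlonglongrightarrow> exp (b t) * amax x t"
      by (rule Lim_transform_eventually)
    moreover have "u f \<alpha> u0 ub x t = exp (b t) * amax x t" using u_mini[OF x t] uniq by blast
    ultimately show "((\<lambda>(x, t). u f \<alpha> u0 ub x t) \<circ> ps) \<longlonglongrightarrow> (case (x, t) of (x, t) \<Rightarrow> u f \<alpha> u0 ub x t)" by simp
  qed
  then show False using dis by (simp add: discontinuity_point_def)
qed

text \<open>Since the triangles increase along the curve, the extreme minimizers at later times lie
  outside those at \<open>(x, t)\<close> and hence converge to them.\<close>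

lemma extreme_minis_along:
  assumes x: "0 < x" and t: "0 < t" and s: "s \<longlonglongrightarrow> t" "\<And>n. t < s n"
    and xs: "xs \<longlonglongrightarrow> x" "\<And>n. 0 < xs n"
    and incr: "\<And>n. char_triangle f \<alpha> u0 ub x t \<subseteq> char_triangle f \<alpha> u0 ub (xs n) (s n)"
  shows "(\<lambda>n. amax (xs n) (s n)) \<longlonglongrightarrow> amax x t" "(\<lambda>n. amin (xs n) (s n)) \<longlonglongrightarrow> amin x t"
proof -
  have s0: "0 < s n" for n using s(2)[of n] t by simp
  obtain \<delta> \<theta> where \<delta>: "0 < \<delta>" and \<theta>: "0 < \<theta>" "\<theta> < t" and pos:
    "\<forall>x' t' a s. \<bar>x' - x\<bar> < \<delta> \<longrightarrow> \<bar>t' - t\<bar> < \<delta> \<longrightarrow> mini x' t' a \<longrightarrow> \<theta> \<le> s \<longrightarrow> s \<le> t' \<longrightarrow> 0 < Z x' t' a s"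
    by (rule mini_positive_near_apex[OF x t])
  have tri0: "(\<xi>, \<theta>) \<in> char_triangle f \<alpha> u0 ub x t \<longleftrightarrow> Z x t (amax x t) \<theta> \<le> \<xi> \<and> \<xi> \<le> Z x t (amin x t) \<theta>" for \<xi>
    by (rule char_triangle_near_apex[OF x t \<theta>(1) less_imp_le[OF \<theta>(2)]])
      (use pos \<delta> in simp)
  \<comment> \<open>The slice at \<theta> is an interval, so it is enough to follow its two end
    points into the larger triangles.\<close>
  have "Z x t (amax x t) \<theta> \<le> Z x t (amin x t) \<theta>"
    using extreme_minis(1,3)[OF x t] \<theta> by (intro Z_le) auto
  then have in0: "(Z x t (amax x t) \<theta>, \<theta>) \<in> char_triangle f \<alpha> u0 ub x t"
    "(Z x t (amin x t) \<theta>, \<theta>) \<in> char_triangle f \<alpha> u0 ub x t"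
    unfolding tri0 by simp_all
  have near: "eventually (\<lambda>n. \<bar>xs n - x\<bar> < \<delta> \<and> \<bar>s n - t\<bar> < \<delta>) sequentially"
    using tendstoD[OF xs(1) \<delta>] tendstoD[OF s(1) \<delta>]
    by (simp add: dist_real_def eventually_conj_iff)
  have outside: "eventually (\<lambda>n. Z (xs n) (s n) (amax (xs n) (s n)) \<theta> \<le> Z x t (amax x t) \<theta> \<and>
      Z x t (amin x t) \<theta> \<le> Z (xs n) (s n) (amin (xs n) (s n)) \<theta>) sequentially"
    using near
  proof eventually_elim
    case (elim n)
    have "(\<xi>, \<theta>) \<in> char_triangle f \<alpha> u0 ub (xs n) (s n) \<longleftrightarrow>
        Z (xs n) (s n) (amax (xs n) (s n)) \<theta> \<le> \<xi> \<and> \<xi> \<le> Z (xs n) (s n) (amin (xs n) (s n)) \<theta>" for \<xi>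
      by (rule char_triangle_near_apex[OF xs(2) s0 \<theta>(1)]) (use \<theta> s(2)[of n] pos elim in auto)
    then show ?case using in0 incr[of n] by blast
  qed
  have evr: "eventually (\<lambda>n. P (r n)) sequentially" if "eventually P sequentially" "strict_mono r"
    for P and r :: "nat \<Rightarrow> nat"
    using that by (rule eventually_subseq[rotated])
  have Zlim: "(\<lambda>n. Z (xs (r n)) (s (r n)) (a (r n)) \<theta>) \<longlonglongrightarrow> Z x t a' \<theta>"
    if "(\<lambda>n. xs (r n)) \<longlonglongrightarrow> x" "(\<lambda>n. s (r n)) \<longlonglongrightarrow> t" "(\<lambda>n. a (r n)) \<longlonglongrightarrow> a'" for a a' and r :: "nat \<Rightarrow> nat"
    by (rule Z_tendsto) (use that \<theta> s0 in \<open>auto intro: less_imp_le\<close>)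
  show "(\<lambda>n. amax (xs n) (s n)) \<longlonglongrightarrow> amax x t"
  proof (rule minis_tendsto[OF x t xs(1) s(1)])
    fix r a' assume r: "strict_mono (r :: nat \<Rightarrow> nat)" "(\<lambda>n. xs (r n)) \<longlonglongrightarrow> x" "(\<lambda>n. s (r n)) \<longlonglongrightarrow> t"
      "(\<lambda>n. amax (xs (r n)) (s (r n))) \<longlonglongrightarrow> a'" "mini x t a'"
    have "Z x t a' \<theta> \<le> Z x t (amax x t) \<theta>"
      by (rule tendsto_upperbound[OF Zlim[OF r(2,3), of "\<lambda>n. amax (xs n) (s n)", OF r(4)]])
        (use evr[OF outside r(1)] in \<open>auto elim: eventually_mono\<close>)
    then have "amax x t \<le> a'" using Z_le_iff[of \<theta> t x a' "amax x t"] \<theta> by simp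
    then show "a' = amax x t" using extreme_minis(3)[OF x t r(5)] by simp
  qed (rule extreme_minis)
  show "(\<lambda>n. amin (xs n) (s n)) \<longlonglongrightarrow> amin x t"
  proof (rule minis_tendsto[OF x t xs(1) s(1)])
    fix r a' assume r: "strict_mono (r :: nat \<Rightarrow> nat)" "(\<lambda>n. xs (r n)) \<longlonglongrightarrow> x" "(\<lambda>n. s (r n)) \<longlonglongrightarrow> t"
      "(\<lambda>n. amin (xs (r n)) (s (r n))) \<longlonglongrightarrow> a'" "mini x t a'"
    have "Z x t (amin x t) \<theta> \<le> Z x t a' \<theta>"
      by (rule tendsto_lowerbound[OF Zlim[OF r(2,3), of "\<lambda>n. amin (xs n) (s n)", OF r(4)]])
        (use evr[OF outside r(1)] in \<open>auto elim: eventually_mono\<close>)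
    then have "a' \<le> amin x t" using Z_le_iff[of \<theta> t x "amin x t" a'] \<theta> by simp
    then show "a' = amin x t" using extreme_minis(3)[OF x t r(5)] by simp
  qed (rule extreme_minis)
qed

lemma shock_speed_strict:
  assumes gc: "generalized_characteristic f \<alpha> u0 ub x1 t1 X" and t1: "0 < t1" "t1 \<le> t"
    and x: "0 < X t" and less: "amin (X t) t < amax (X t) t"
    and D: "(X has_real_derivative D) (at t within {t1..})"
  shows "spd (amin (X t) t) t < D" "D < spd (amax (X t) t) t"
proof -
  have t: "0 < t" using t1 by simp
  have "continuous (at t within {t1..}) X" using D by (rule DERIV_continuous)
  then have "(X \<longlongrightarrow> X t) (at t within {t1..})" by (simp add: continuous_within)
  then have "eventually (\<lambda>s. 0 < X s) (at t within {t1..})" using order_tendstoD(1) x by blast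
  then obtain d where d: "0 < d" "\<And>s. t1 \<le> s \<Longrightarrow> s \<noteq> t \<Longrightarrow> \<bar>s - t\<bar> < d \<Longrightarrow> 0 < X s"
    unfolding eventually_at dist_real_def by auto
  \<comment> \<open>Times decreasing to \<open>t\<close>, closer than \<open>d\<close> so that the
    curve is still in the interior.\<close>
  define s where "s n = t + d / 2 * inverse (real (Suc n))" for n
  have "(\<lambda>n. t + d / 2 * inverse (real (Suc n))) \<longlonglongrightarrow> t + d / 2 * 0"
    by (intro tendsto_intros LIMSEQ_inverse_real_of_nat)
  then have s: "s \<longlonglongrightarrow> t" by (simp add: s_def[abs_def])
  have ts: "t < s n" for n using d(1) by (simp add: s_def)
  have sd: "s n - t < d" for n
  proof -
    have "d / 2 * inverse (real (Suc n)) \<le> d / 2 * 1" using d(1) by (intro mult_left_mono) (auto simp: inverse_le_1_iff)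
    then show ?thesis using d(1) by (simp add: s_def)
  qed
  define xs where "xs n = X (s n)" for n
  have xs0: "0 < xs n" for n unfolding xs_def by (rule d(2)) (use ts[of n] sd[of n] t1 in auto)
  have in_dom: "\<forall>i. s i \<in> {t1..} - {t}" using ts t1 by (auto simp: less_imp_neq[symmetric] intro: less_imp_le order_trans)
  have "((\<lambda>y. (X y - X t) / (y - t)) \<longlongrightarrow> D) (at t within {t1..})"
    using D by (simp add: has_field_derivative_iff)
  then have quot: "(\<lambda>n. (xs n - X t) / (s n - t)) \<longlonglongrightarrow> D"
    unfolding tendsto_at_iff_sequentially using s in_dom by (auto simp: o_def xs_def)
  have xs: "xs \<longlonglongrightarrow> X t"
    using \<open>(X \<longlongrightarrow> X t) (at t within {t1..})\<close>
    unfolding tendsto_at_iff_sequentially using s in_dom by (auto simp: o_def xs_def[abs_def])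
  have incr: "char_triangle f \<alpha> u0 ub (X t) t \<subseteq> char_triangle f \<alpha> u0 ub (xs n) (s n)" for n
    using gc t1 ts[of n] by (simp add: generalized_characteristic_def xs_def)
  note lim = extreme_minis_along[OF x t s ts xs xs0 incr]
  have s0: "0 < s n" for n using ts[of n] t by simp
  have "(\<lambda>n. (V (xs n) (s n) - V (X t) t) / (s n - t)) \<longlonglongrightarrow> amax (X t) t * D - eng (amax (X t) t) t"
    by (rule V_derivative_along[OF x t extreme_minis(1)[OF x t] s ts xs0 quot extreme_minis(1)[OF xs0 s0] lim(1)])
  moreover have "(\<lambda>n. (V (xs n) (s n) - V (X t) t) / (s n - t)) \<longlonglongrightarrow> amin (X t) t * D - eng (amin (X t) t) t"
    by (rule V_derivative_along[OF x t extreme_minis(2)[OF x t] s ts xs0 quot extreme_minis(2)[OF xs0 s0] lim(2)])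
  ultimately have RH: "amax (X t) t * D - eng (amax (X t) t) t = amin (X t) t * D - eng (amin (X t) t) t"
    by (rule LIMSEQ_unique)
  let ?k = "amax (X t) t" and ?c = "amin (X t) t"
  \<comment> \<open>Strict tangent inequalities of \<open>\<lambda>a. eng a t\<close> at both
    parameters; combined with the jump relation \<open>RH\<close> they give the signs of the two
    speed differences.\<close>
  have "?k * spd ?c t - eng ?k t < ?c * spd ?c t - eng ?c t"
    "?c * spd ?k t - eng ?c t < ?k * spd ?k t - eng ?k t"
    using less by (auto intro!: pointwise_duality_less)
  then have "0 < (?k - ?c) * (D - spd ?c t)" "0 < (?k - ?c) * (spd ?k t - D)"
    using RH by (simp_all add: algebra_simps)
  then show "spd ?c t < D" "D < spd ?k t" using less by (simp_all add: zero_less_mult_iff)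
qed

lemma shock_inequalities:
  assumes gc: "generalized_characteristic f \<alpha> u0 ub x1 t1 X" and t1: "0 < t1" "t1 \<le> t"
    and x: "0 < X t" and dis: "discontinuity_point f \<alpha> u0 ub (X t) t"
    and D: "(X has_real_derivative D) (at t within {t1..})"
  shows "\<exists>ul ur. ((\<lambda>z. u f \<alpha> u0 ub z t) \<longlongrightarrow> ul) (at_left (X t)) \<and>
    ((\<lambda>z. u f \<alpha> u0 ub z t) \<longlongrightarrow> ur) (at_right (X t)) \<and> deriv f ul > D \<and> D > deriv f ur"
proof -
  have t: "0 < t" using t1 by simp
  have "spd (amin (X t) t) t < D" "D < spd (amax (X t) t) t"
    by (rule shock_speed_strict[OF gc t1 x discontinuity_amin_less_amax[OF x t dis] D])+
  then show ?thesis
    using u_tendsto_left[OF x t] u_tendsto_right[OF x t] by (auto simp: spd_def mult.commute)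
qed

end

theorem theorem3p2:
  fixes f \<alpha> u0 ub X :: "real \<Rightarrow> real" and x1 t1 :: real
  assumes "C2 f" and "strictly_convex f"
    and "filterlim (\<lambda>v. f v / \<bar>v\<bar>) at_top at_infinity"
    and "L_infinity \<alpha>" and "L_infinity u0" and "BV ub"
    and "0 \<le> x1" and "0 < t1"
    and "generalized_characteristic f \<alpha> u0 ub x1 t1 X"
  shows "(\<forall>x t D. t1 \<le> t \<and> x = X t \<and> 0 < x \<and> 0 < t \<and> discontinuity_point f \<alpha> u0 ub x t \<and>
            (X has_real_derivative D) (at t within {t1..}) \<longrightarrow>
            (\<exists>ul ur. ((\<lambda>z. u f \<alpha> u0 ub z t) \<longlongrightarrow> ul) (at_left x) \<and>
                     ((\<lambda>z. u f \<alpha> u0 ub z t) \<longlongrightarrow> ur) (at_right x) \<and>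
                     deriv f ul > D \<and> D > deriv f ur)) \<and>
         (AE t in lebesgue_on {t1..}. 0 < X t \<and> discontinuity_point f \<alpha> u0 ub (X t) t \<longrightarrow>
            (\<exists>D ul ur. (X has_real_derivative D) (at t) \<and>
                     ((\<lambda>z. u f \<alpha> u0 ub z t) \<longlongrightarrow> ul) (at_left (X t)) \<and>
                     ((\<lambda>z. u f \<alpha> u0 ub z t) \<longlongrightarrow> ur) (at_right (X t)) \<and>
                     deriv f ul > D \<and> D > deriv f ur))"
proof -
  interpret bvp f \<alpha> u0 ub using assms(1-6) by unfold_locales
  note gc = assms(9)
  have shock: "\<exists>ul ur. ((\<lambda>z. u f \<alpha> u0 ub z t) \<longlongrightarrow> ul) (at_left (X t)) \<and>
      ((\<lambda>z. u f \<alpha> u0 ub z t) \<longlongrightarrow> ur) (at_right (X t)) \<and> deriv f ul > D \<and> D > deriv f ur"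
    if "t1 \<le> t" "0 < X t" "discontinuity_point f \<alpha> u0 ub (X t) t" "(X has_real_derivative D) (at t within {t1..})" for t D
    by (rule shock_inequalities[OF gc \<open>0 < t1\<close> that])
  have "AE t in lebesgue. t1 < t \<longrightarrow> (\<exists>D. (X has_real_derivative D) (at t))"
    by (rule locally_lipschitz_AE_differentiable) (use gc in \<open>auto simp: generalized_characteristic_def\<close>)
  then have "AE t in lebesgue. t1 \<le> t \<longrightarrow> 0 < X t \<and> discontinuity_point f \<alpha> u0 ub (X t) t \<longrightarrow>
      (\<exists>D ul ur. (X has_real_derivative D) (at t) \<and> ((\<lambda>z. u f \<alpha> u0 ub z t) \<longlongrightarrow> ul) (at_left (X t)) \<and>
        ((\<lambda>z. u f \<alpha> u0 ub z t) \<longlongrightarrow> ur) (at_right (X t)) \<and> deriv f ul > D \<and> D > deriv f ur)"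
    \<comment> \<open>Discards the time \<open>t1\<close>, where \<open>X\<close> is controlled from
      the right only.\<close>
    using LINT_ends_AE[of t1 t1]
  proof eventually_elim
    case (elim t)
    show ?case
    proof (intro impI, elim conjE)
      assume t: "t1 \<le> t" "0 < X t" "discontinuity_point f \<alpha> u0 ub (X t) t"
      then obtain D where D: "(X has_real_derivative D) (at t)" using elim by auto
      show "\<exists>D ul ur. (X has_real_derivative D) (at t) \<and> ((\<lambda>z. u f \<alpha> u0 ub z t) \<longlongrightarrow> ul) (at_left (X t)) \<and>
        ((\<lambda>z. u f \<alpha> u0 ub z t) \<longlongrightarrow> ur) (at_right (X t)) \<and> deriv f ul > D \<and> D > deriv f ur"
        using shock[OF t has_field_derivative_at_within[OF D]] D by blast
    qed
  qed
  then show ?thesis using shock by (auto simp: AE_restrict_space_iff)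
qed

end
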